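(* For every real $\beta$ with $0 \le \beta < 1$ there exists a constant $C(\beta) < \infty$ (depending only on $\beta$) such that for all integers $n \ge 1$, $$\mathbb{E}\,\|\mathrm{cov}(\mu)\|_{\mathrm{op}} \le C(\beta),$$ where $\mu$ is the Gibbs measure of the Sherrington--Kirkpatrick model on $\{-1,+1\}^n$ at inverse temperature $\beta$ with no external field and $\mathrm{cov}(\mu)$ is its covariance matrix.
   Context: Let $(g_{ij})_{1\le i<j\le n}$ be i.i.d. standard Gaussian $N(0,1)$ random variables (the disorder), and let $\beta \ge 0$. The Sherrington--Kirkpatrick Gibbs measure (no external field) is the random probability measure on $\{-1,+1\}^n$ $$\mu(\sigma) = \frac{1}{Z}\exp\Big\{\frac{\beta}{\sqrt{n}}\sum_{i<j} g_{ij}\sigma_i\sigma_j\Big\},\qquad \sigma\in\{-1,+1\}^n,$$ with $Z$ the normalizing constant. The bracket $\langle\cdot\rangle$ denotes the average with respect to $\mu$ (for fixed disorder). The covariance matrix is the $n\times n$ random matrix $\mathrm{cov}(\mu)$ with entries $(\mathrm{cov}(\mu))_{ij} = \langle \sigma_i\sigma_j\rangle$ for $i,j\in\{1,\dots,n\}$ (the mean of $\mu$ is zero by symmetry). $\|\cdot\|_{\mathrm{op}}$ is the operator (spectral) norm, and $\mathbb{E}$ is the expectation over the disorder $(g_{ij})$. *)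

theory Defs
  imports "HOL-Probability.Probability"
begin

text \<open>Sites are \<open>0, \<dots>, n - 1\<close>; a spin configuration is an extensional function on \<open>{..<n}\<close>, so
  that \<open>spin_configs n\<close> has exactly \<open>2 ^ n\<close> elements.\<close>

definition spin_configs :: "nat \<Rightarrow> (nat \<Rightarrow> real) set" where
  "spin_configs n = {..<n} \<rightarrow>\<^sub>E {-1, 1}"

definition site_pairs :: "nat \<Rightarrow> (nat \<times> nat) set" where
  "site_pairs n = {(i, j). i < j \<and> j < n}"

text \<open>The joint law of the i.i.d. standard Gaussian couplings \<open>g (i, j)\<close>, \<open>i < j\<close>.\<close>

definition disorder :: "nat \<Rightarrow> (nat \<times> nat \<Rightarrow> real) measure" where
  "disorder n = Pi\<^sub>M (site_pairs n) (\<lambda>_. std_normal_distribution)"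

definition sk_weight :: "nat \<Rightarrow> real \<Rightarrow> (nat \<times> nat \<Rightarrow> real) \<Rightarrow> (nat \<Rightarrow> real) \<Rightarrow> real" where
  "sk_weight n \<beta> g \<sigma> =
     exp (\<beta> / sqrt (real n) * (\<Sum>(i, j)\<in>site_pairs n. g (i, j) * \<sigma> i * \<sigma> j))"

definition sk_partition :: "nat \<Rightarrow> real \<Rightarrow> (nat \<times> nat \<Rightarrow> real) \<Rightarrow> real" where
  "sk_partition n \<beta> g = (\<Sum>\<sigma>\<in>spin_configs n. sk_weight n \<beta> g \<sigma>)"

definition sk_gibbs :: "nat \<Rightarrow> real \<Rightarrow> (nat \<times> nat \<Rightarrow> real) \<Rightarrow> (nat \<Rightarrow> real) measure" where
  "sk_gibbs n \<beta> g =
     point_measure (spin_configs n) (\<lambda>\<sigma>. ennreal (sk_weight n \<beta> g \<sigma> / sk_partition n \<beta> g))"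

text \<open>The Gibbs measure is centred by the symmetry \<open>\<sigma> \<mapsto> - \<sigma>\<close>, see \<open>sk_gibbs_mean\<close> below, so no
  product of means is subtracted.\<close>

definition sk_cov :: "nat \<Rightarrow> real \<Rightarrow> (nat \<times> nat \<Rightarrow> real) \<Rightarrow> nat \<Rightarrow> nat \<Rightarrow> real" where
  "sk_cov n \<beta> g i j = (\<integral>\<sigma>. \<sigma> i * \<sigma> j \<partial>sk_gibbs n \<beta> g)"

text \<open>The operator norm, induced by the Euclidean norm, of the \<open>n \<times> n\<close> matrix
  \<open>(A i j)\<close>, \<open>i, j < n\<close>. The dimension is a term rather than a type because it varies
  inside the statement; values of \<open>A\<close> and \<open>x\<close> outside the index range are irrelevant.\<close>

definition op_norm :: "nat \<Rightarrow> (nat \<Rightarrow> nat \<Rightarrow> real) \<Rightarrow> real" where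
  "op_norm n A =
     (SUP x\<in>{x. L2_set x {..<n} \<le> 1}. L2_set (\<lambda>i. \<Sum>j<n. A i j * x j) {..<n})"

text \<open>The supremum and the integrals are genuine: the matrix norm is a supremum of a bounded
  set (\<open>op_norm_bdd_above\<close>), \<open>sk_gibbs\<close> is a centred probability measure, and the operator norm of
  \<open>sk_cov\<close> is integrable over the disorder (\<open>integrable_op_norm_sk_cov\<close>).\<close>

lemma finite_spin_configs: "finite (spin_configs n)"
  unfolding spin_configs_def by (intro finite_PiE) auto

lemma spin_configs_nonempty: "spin_configs n \<noteq> {}"
  unfolding spin_configs_def by (auto simp: PiE_eq_empty_iff)

lemma finite_site_pairs: "finite (site_pairs n)"
  by (rule finite_subset[of _ "{..<n} \<times> {..<n}"]) (auto simp: site_pairs_def)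

lemma sk_partition_pos: "sk_partition n \<beta> g > 0"
  unfolding sk_partition_def sk_weight_def
  by (intro sum_pos finite_spin_configs spin_configs_nonempty) auto

lemma sk_gibbs_integral:
  fixes f :: "(nat \<Rightarrow> real) \<Rightarrow> real"
  shows "(\<integral>\<sigma>. f \<sigma> \<partial>sk_gibbs n \<beta> g) =
     (\<Sum>\<sigma>\<in>spin_configs n. sk_weight n \<beta> g \<sigma> / sk_partition n \<beta> g * f \<sigma>)"
  unfolding sk_gibbs_def
  using sk_partition_pos[of n \<beta> g]
  by (subst lebesgue_integral_point_measure_finite)
     (auto simp: finite_spin_configs sk_weight_def intro!: divide_nonneg_pos sum.cong)

lemma prob_space_sk_gibbs: "prob_space (sk_gibbs n \<beta> g)"
proof
  have "emeasure (sk_gibbs n \<beta> g) (spin_configs n) =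
      (\<Sum>\<sigma>\<in>spin_configs n. ennreal (sk_weight n \<beta> g \<sigma> / sk_partition n \<beta> g))"
    unfolding sk_gibbs_def by (rule emeasure_point_measure_finite) (auto simp: finite_spin_configs)
  also have "\<dots> = ennreal (\<Sum>\<sigma>\<in>spin_configs n. sk_weight n \<beta> g \<sigma> / sk_partition n \<beta> g)"
    using sk_partition_pos[of n \<beta> g]
    by (intro sum_ennreal) (auto simp: sk_weight_def intro!: divide_nonneg_pos)
  also have "(\<Sum>\<sigma>\<in>spin_configs n. sk_weight n \<beta> g \<sigma> / sk_partition n \<beta> g) = 1"
    using sk_partition_pos[of n \<beta> g]
    by (simp add: sk_partition_def flip: sum_divide_distrib)
  finally show "emeasure (sk_gibbs n \<beta> g) (space (sk_gibbs n \<beta> g)) = 1"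
    by (simp add: sk_gibbs_def space_point_measure)
qed

lemma sk_gibbs_mean:
  assumes "i < n"
  shows "(\<integral>\<sigma>. \<sigma> i \<partial>sk_gibbs n \<beta> g) = 0"
proof -
  let ?flip = "\<lambda>\<sigma>. restrict (\<lambda>k. - \<sigma> k) {..<n} :: nat \<Rightarrow> real"
  let ?p = "\<lambda>\<sigma>. sk_weight n \<beta> g \<sigma> / sk_partition n \<beta> g"
  have w: "sk_weight n \<beta> g (?flip \<sigma>) = sk_weight n \<beta> g \<sigma>" for \<sigma>
    unfolding sk_weight_def
    by (intro arg_cong[where f = exp] arg_cong2[where f = "(*)"] refl sum.cong)
       (auto simp: site_pairs_def)
  have ff: "?flip (?flip \<sigma>) = \<sigma>" if "\<sigma> \<in> spin_configs n" for \<sigma>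
    using that by (auto simp: spin_configs_def fun_eq_iff PiE_def extensional_def)
  have fm: "?flip \<sigma> \<in> spin_configs n" if "\<sigma> \<in> spin_configs n" for \<sigma>
    using that by (auto simp: spin_configs_def PiE_iff)
  have "(\<Sum>\<sigma>\<in>spin_configs n. ?p \<sigma> * \<sigma> i) = (\<Sum>\<sigma>\<in>spin_configs n. ?p (?flip \<sigma>) * ?flip \<sigma> i)"
    by (rule sum.reindex_bij_witness[where i = ?flip and j = ?flip]) (use ff fm in auto)
  also have "\<dots> = - (\<Sum>\<sigma>\<in>spin_configs n. ?p \<sigma> * \<sigma> i)"
    unfolding w using assms by (simp add: sum_negf)
  finally show ?thesis
    by (simp add: sk_gibbs_integral)
qed

lemma op_norm_entries_bound:
  fixes n :: nat
  assumes "L2_set x {..<n} \<le> 1"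
  shows "L2_set (\<lambda>i. \<Sum>j<n. A i j * x j) {..<n} \<le> (\<Sum>i<n. \<Sum>j<n. \<bar>A i j\<bar>)"
proof -
  have x: "\<bar>x j\<bar> \<le> 1" if "j < n" for j
  proof -
    have "\<bar>x j\<bar> \<le> L2_set (\<lambda>j. \<bar>x j\<bar>) {..<n}"
      using that by (intro member_le_L2_set) auto
    also have "\<dots> = L2_set x {..<n}" by (simp add: L2_set_def)
    finally show ?thesis using assms by simp
  qed
  have "L2_set (\<lambda>i. \<Sum>j<n. A i j * x j) {..<n} \<le> (\<Sum>i<n. \<bar>\<Sum>j<n. A i j * x j\<bar>)"
    by (rule L2_set_le_sum_abs)
  also have "\<dots> \<le> (\<Sum>i<n. \<Sum>j<n. \<bar>A i j\<bar>)"
  proof (rule sum_mono)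
    fix i
    have "\<bar>\<Sum>j<n. A i j * x j\<bar> \<le> (\<Sum>j<n. \<bar>A i j * x j\<bar>)" by (rule sum_abs)
    also have "\<dots> \<le> (\<Sum>j<n. \<bar>A i j\<bar>)"
      by (intro sum_mono) (auto simp: abs_mult intro!: mult_left_le x)
    finally show "\<bar>\<Sum>j<n. A i j * x j\<bar> \<le> (\<Sum>j<n. \<bar>A i j\<bar>)" .
  qed
  finally show ?thesis .
qed

lemma op_norm_bdd_above:
  "bdd_above ((\<lambda>x. L2_set (\<lambda>i. \<Sum>j<n. A i j * x j) {..<n}) ` {x. L2_set x {..<n} \<le> 1})"
  for n :: nat
  by (rule bdd_aboveI2) (rule op_norm_entries_bound, simp)

lemma unit_ball_nonempty: "{x :: nat \<Rightarrow> real. L2_set x {..<n} \<le> 1} \<noteq> {}"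
  by (auto intro!: exI[of _ "\<lambda>_. 0"] simp: L2_set_def)

lemma op_norm_le_iff:
  "op_norm n A \<le> a \<longleftrightarrow>
     (\<forall>x. L2_set x {..<n} \<le> 1 \<longrightarrow> L2_set (\<lambda>i. \<Sum>j<n. A i j * x j) {..<n} \<le> a)"
  unfolding op_norm_def
  by (subst cSUP_le_iff[OF unit_ball_nonempty op_norm_bdd_above]) auto

lemma op_norm_nonneg: "op_norm n A \<ge> 0"
proof -
  have "L2_set (\<lambda>i. \<Sum>j<n. A i j * (\<lambda>_. 0) j) {..<n} \<le> op_norm n A"
    unfolding op_norm_def
    by (rule cSUP_upper2[OF op_norm_bdd_above, of "\<lambda>_. 0"]) (auto simp: L2_set_def)
  then show ?thesis by (simp add: L2_set_def)
qed

lemma measurable_op_norm: "(\<lambda>A. op_norm n (\<lambda>i j. A (i, j))) \<in> borel_measurable borel"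
proof (rule borel_measurableI_le)
  fix a :: real
  let ?S = "\<lambda>x. {A :: nat \<times> nat \<Rightarrow> real. L2_set (\<lambda>i. \<Sum>j<n. A (i, j) * x j) {..<n} \<le> a}"
  have "closed (?S x)" for x
    unfolding L2_set_def by (intro closed_Collect_le continuous_intros continuous_on_product_coordinates)
  then have "closed (\<Inter>x\<in>{x. L2_set x {..<n} \<le> 1}. ?S x)" by blast
  moreover have "{A \<in> space borel. op_norm n (\<lambda>i j. A (i, j)) \<le> a} =
      (\<Inter>x\<in>{x. L2_set x {..<n} \<le> 1}. ?S x)"
    by (auto simp: op_norm_le_iff)
  ultimately show "{A \<in> space borel. op_norm n (\<lambda>i j. A (i, j)) \<le> a} \<in> sets borel"
    by (simp add: borel_closed)
qed

lemma prob_space_disorder: "prob_space (disorder n)"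
  unfolding disorder_def by (intro prob_space_PiM prob_space_normal_density) simp

lemma measurable_sk_cov: "(\<lambda>g. sk_cov n \<beta> g i j) \<in> borel_measurable (disorder n)"
proof -
  have [measurable]: "(\<lambda>g. g p) \<in> borel_measurable (disorder n)" if "p \<in> site_pairs n" for p
    using measurable_component_singleton[OF that, of "\<lambda>_. density lborel std_normal_density"]
    by (simp add: disorder_def)
  have [measurable]: "(\<lambda>g. sk_weight n \<beta> g \<sigma>) \<in> borel_measurable (disorder n)" for \<sigma>
    unfolding sk_weight_def case_prod_beta by measurable
  show ?thesis
    unfolding sk_cov_def sk_gibbs_integral sk_partition_def by measurable
qed

lemma sk_cov_abs_le:
  assumes "i < n" "j < n"
  shows "\<bar>sk_cov n \<beta> g i j\<bar> \<le> 1"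
proof -
  interpret prob_space "sk_gibbs n \<beta> g" by (rule prob_space_sk_gibbs)
  let ?p = "\<lambda>\<sigma>. sk_weight n \<beta> g \<sigma> / sk_partition n \<beta> g"
  have p: "?p \<sigma> \<ge> 0" for \<sigma>
    using sk_partition_pos[of n \<beta> g] by (auto simp: sk_weight_def intro!: divide_nonneg_pos)
  have "\<bar>sk_cov n \<beta> g i j\<bar> \<le> (\<Sum>\<sigma>\<in>spin_configs n. \<bar>?p \<sigma> * (\<sigma> i * \<sigma> j)\<bar>)"
    unfolding sk_cov_def sk_gibbs_integral by (rule sum_abs)
  also have "\<dots> = (\<Sum>\<sigma>\<in>spin_configs n. ?p \<sigma>)"
  proof (rule sum.cong)
    fix \<sigma> assume "\<sigma> \<in> spin_configs n"
    then have "\<sigma> i \<in> {-1, 1}" "\<sigma> j \<in> {-1, 1}" using assms by (auto simp: spin_configs_def PiE_iff)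
    then have "\<bar>\<sigma> i * \<sigma> j\<bar> = 1" by auto
    then show "\<bar>?p \<sigma> * (\<sigma> i * \<sigma> j)\<bar> = ?p \<sigma>"
      unfolding abs_mult[of "?p \<sigma>"] using abs_of_nonneg[OF p[of \<sigma>]] by (simp only: mult_1_right)
  qed simp
  also have "\<dots> = 1"
    using sk_partition_pos[of n \<beta> g] by (simp add: sk_partition_def flip: sum_divide_distrib)
  finally show ?thesis .
qed

lemma integrable_op_norm_sk_cov: "integrable (disorder n) (\<lambda>g. op_norm n (sk_cov n \<beta> g))"
proof -
  interpret prob_space "disorder n" by (rule prob_space_disorder)
  have "(\<lambda>g p. sk_cov n \<beta> g (fst p) (snd p)) \<in> borel_measurable (disorder n)"
    by (rule measurable_coordinatewise_then_product) (rule measurable_sk_cov)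
  from measurable_compose[OF this measurable_op_norm]
  have m: "(\<lambda>g. op_norm n (sk_cov n \<beta> g)) \<in> borel_measurable (disorder n)"
    by simp
  have "op_norm n (sk_cov n \<beta> g) \<le> (\<Sum>i<n. \<Sum>j<n. 1)" for g
    unfolding op_norm_le_iff
    by (auto intro!: order_trans[OF op_norm_entries_bound] sum_mono sk_cov_abs_le simp del: sum_constant)
  then have "norm (op_norm n (sk_cov n \<beta> g)) \<le> (\<Sum>i<n. \<Sum>j<n. 1)" for g
    using op_norm_nonneg[of n "sk_cov n \<beta> g"] by (simp del: sum_constant)
  then show ?thesis
    by (intro integrable_const_bound[where B = "\<Sum>i<n. \<Sum>j<n. 1"] m) auto
qed

end

theory Submission
  imports Defs "HOL-Complex_Analysis.Complex_Analysis" "HOL-Real_Asymp.Real_Asymp"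
begin

text \<open>Write \<open>A\<close> for the symmetric coupling matrix \<open>g / sqrt n\<close> and \<open>H\<close> for the energy. For complex \<open>z\<close> let
  \<open>Z z\<close> and \<open>Q z\<close> be the sums over spins of \<open>exp (z * H)\<close> and of \<open>exp (z * H) * \<sigma> i * \<sigma> j\<close>, divided by the expected
  partition function, so that \<open>Q \<beta>\<close> is \<open>Z \<beta>\<close> times the covariance matrix. Both are entire in \<open>z\<close>, and
  \<open>(1 + z\<^sup>2 - z A) (Q z) = Z z + Y z\<close> for an error matrix \<open>Y z\<close>. The second moments of \<open>Z z\<close> and of the
  Hilbert--Schmidt norm of \<open>Y z\<close> involve only two replicas: after Gaussian integration they are averages over
  a Curie--Weiss model at inverse temperature \<open>|z|\<^sup>2 < 1\<close>, and they are bounded uniformly in \<open>n\<close>.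

  No information on the spectrum of \<open>A\<close> is needed to invert \<open>1 + z\<^sup>2 - z A\<close>. On the circle \<open>|z| = r < 1\<close>
  the symmetry of \<open>A\<close> bounds the inverse by a multiple of \<open>1 / |z\<^sup>2 - r\<^sup>2|\<close>, and Cauchy's formula for
  \<open>(z\<^sup>2 - r\<^sup>2) (Q z)\<close> bounds the operator norm of \<open>Q \<beta>\<close>, \<open>\<beta> < r\<close>, by the average of \<open>|Z z|\<close> and the norm of \<open>Y z\<close>
  over the circle.

  It remains to divide by \<open>Z \<beta>\<close>, that is, to bound a negative moment of \<open>Z \<beta>\<close>. By the second moment method
  \<open>Z \<beta>\<close> is bounded below, and \<open>ln (Z \<beta>)\<close> has a bounded gradient, on a set of disorders of probability bounded
  below. Since \<open>ln (Z \<beta>)\<close> is convex, Gaussian concentration transfers the lower bound to all disorders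
  (an argument of Talagrand).\<close>

section \<open>Gaussian integrals\<close>

text \<open>Under the weight \<open>exp (z * H)\<close> Gaussian integration by parts gives
  \<open>z * A \<sigma>\<close> the mean \<open>z\<^sup>2 * \<sigma>\<close> up to a factor
  \<open>1 - 1 / n\<close>. So \<open>(1 + z\<^sup>2 - z A) \<sigma>\<close> has mean close to
  \<open>\<sigma>\<close>, and \<open>\<sigma> i * \<sigma> j\<close> averages to the identity
  matrix: this is the origin of \<open>1 + z\<^sup>2\<close>. For real \<open>z\<close> in
  \<open>(0, 1)\<close> the matrix is \<open>z\<close> times \<open>z + 1 / z - A\<close>, and
  \<open>z + 1 / z > 2\<close> avoids only the limiting spectrum of \<open>A\<close>; excluding
  stray eigenvalues would need an edge estimate. Off the real axis the symmetry of \<open>A\<close>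
  does this work, and holomorphy carries the bound back to \<open>\<beta>\<close>. The price is that
  \<open>Q\<close> must stay unnormalized, as a partition function may vanish at complex
  \<open>z\<close>; the division by \<open>Z \<beta>\<close> comes last, at real temperature. The
  quotient is split by \<open>u * w \<le> u\<^sup>2 + w\<^sup>2\<close>, so second moments on the
  circle and the moment of order \<open>-2\<close> of \<open>Z \<beta>\<close> suffice. For the
  latter the obstacle is the gradient of \<open>ln (Z \<beta>)\<close>, which is
  \<open>\<beta> / sqrt n\<close> times the covariances: pointwise only a bound of order
  \<open>sqrt n\<close> is at hand, hence the detour through disorders where it is of order
  1.\<close>

lemma std_normal_density_times_exp:
  "std_normal_density x * exp (a * x) = exp (a\<^sup>2 / 2) * normal_density a 1 x"
  unfolding normal_density_def
  by (simp add: mult_exp_exp field_simps power2_eq_square)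

lemma integrable_std_normal_exp: "integrable std_normal_distribution (\<lambda>x. exp (a * x))"
  by (subst integrable_density) (auto simp: std_normal_density_times_exp)

text \<open>For exponents up to 2 the Taylor bound of \<open>exp\<close> dominates
  \<open>|x| ^ k\<close> by \<open>2 * exp |x|\<close>, which only shifts \<open>Re z\<close> by 1
  in either direction. Degree 2 is what a pair of replicas requires, each contributing at most one
  local field.\<close>

lemma integrable_std_normal_power_exp:
  fixes z :: complex
  assumes "k \<le> 2"
  shows "integrable std_normal_distribution (\<lambda>x. of_real x ^ k * exp (z * of_real x))"
proof (rule Bochner_Integration.integrable_bound)
  show "integrable std_normal_distribution (\<lambda>x. 2 * (exp ((Re z + 1) * x) + exp ((Re z - 1) * x)))"
    by (intro integrable_mult_right Bochner_Integration.integrable_add integrable_std_normal_exp)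
  have "norm (of_real x ^ k * exp (z * of_real x)) \<le> 2 * (exp ((Re z + 1) * x) + exp ((Re z - 1) * x))" for x
  proof -
    have "\<bar>x\<bar> ^ k \<le> 2 * exp \<bar>x\<bar>"
    proof -
      have "1 + \<bar>x\<bar> + \<bar>x\<bar>\<^sup>2 / 2 \<le> exp \<bar>x\<bar>" by (rule exp_lower_Taylor_quadratic) simp
      moreover have "k = 0 \<or> k = 1 \<or> k = 2" using assms by auto
      moreover have "1 \<le> exp \<bar>x\<bar>" by simp
      ultimately show ?thesis
        using zero_le_power2[of "\<bar>x\<bar>"] by (elim disjE; simp only: power_0 power_one_right; linarith)
    qed
    also have "exp \<bar>x\<bar> \<le> exp x + exp (- x)" by (cases "x \<ge> 0") auto
    finally have "\<bar>x\<bar> ^ k * exp (Re z * x) \<le> 2 * (exp x + exp (- x)) * exp (Re z * x)"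
      by (intro mult_right_mono) auto
    also have "\<dots> = 2 * (exp ((Re z + 1) * x) + exp ((Re z - 1) * x))"
      by (simp add: algebra_simps mult_exp_exp)
    finally show ?thesis by (simp add: norm_mult norm_power)
  qed
  then show "AE x in std_normal_distribution. norm (of_real x ^ k * exp (z * of_real x))
      \<le> norm (2 * (exp ((Re z + 1) * x) + exp ((Re z - 1) * x)))"
    by (intro AE_I2) (smt (verit) real_norm_def)
qed simp

text \<open>The tilt by \<open>Re z\<close> is absorbed by translating the density; what remains is
  the characteristic function at \<open>Im z\<close>.\<close>

lemma integral_std_normal_exp:
  fixes z :: complex
  shows "(\<integral>x. exp (z * of_real x) \<partial>std_normal_distribution) = exp (z\<^sup>2 / 2)"
proof -
  define a b where "a = Re z" and "b = Im z"
  have z: "z = of_real a + \<i> * of_real b" by (simp add: a_def b_def complex_eq)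
  have "(\<integral>x. exp (z * of_real x) \<partial>std_normal_distribution)
      = (\<integral>x. std_normal_density x *\<^sub>R exp (z * of_real x) \<partial>lborel)"
    by (rule integral_density) auto
  also have "\<dots> = (\<integral>x. exp (a\<^sup>2 / 2) *\<^sub>R (normal_density a 1 x *\<^sub>R exp (\<i> * of_real (b * x))) \<partial>lborel)"
  proof (rule Bochner_Integration.integral_cong)
    fix x :: real
    have "std_normal_density x *\<^sub>R exp (z * of_real x)
        = of_real (std_normal_density x * exp (a * x)) * exp (\<i> * of_real (b * x))"
      by (simp add: z scaleR_conv_of_real exp_of_real [symmetric] exp_add distrib_right mult.assoc)
    then show "std_normal_density x *\<^sub>R exp (z * of_real x)
        = exp (a\<^sup>2 / 2) *\<^sub>R (normal_density a 1 x *\<^sub>R exp (\<i> * of_real (b * x)))"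
      by (simp add: std_normal_density_times_exp scaleR_conv_of_real)
  qed simp
  also have "\<dots> = exp (a\<^sup>2 / 2) *\<^sub>R (\<integral>x. normal_density a 1 (a + 1 * x) *\<^sub>R exp (\<i> * of_real (b * (a + 1 * x)))
      \<partial>lborel)"
    unfolding integral_scaleR_right
    by (intro arg_cong[where f = "\<lambda>y. _ *\<^sub>R y"] trans[OF lborel_integral_real_affine[where c = 1 and t = a]]) auto
  also have "\<dots> = exp (a\<^sup>2 / 2) *\<^sub>R (\<integral>x. exp (\<i> * of_real (a * b)) *
      (std_normal_density x *\<^sub>R exp (\<i> * of_real (b * x))) \<partial>lborel)"
    by (simp add: normal_density_def exp_add algebra_simps)
  also have "\<dots> = exp (a\<^sup>2 / 2) *\<^sub>R (exp (\<i> * of_real (a * b)) *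
      (\<integral>x. std_normal_density x *\<^sub>R exp (\<i> * of_real (b * x)) \<partial>lborel))"
    by (simp only: integral_mult_right_zero)
  also have "(\<integral>x. std_normal_density x *\<^sub>R exp (\<i> * of_real (b * x)) \<partial>lborel) = char std_normal_distribution b"
    unfolding char_def by (subst integral_density) (auto simp: mult.commute)
  also have "\<dots> = exp (of_real (- b\<^sup>2 / 2))"
    by (simp add: char_std_normal_distribution flip: exp_of_real)
  finally show ?thesis
    by (simp add: scaleR_conv_of_real exp_of_real [symmetric] z power2_eq_square mult_exp_exp field_simps)
qed

text \<open>Integration by parts: the derivative of \<open>x ^ k * exp (z * x)\<close> times the Gaussian density has
  integral zero.\<close>

lemma integral_std_normal_power_Suc_exp:
  fixes z :: complex
  assumes "k \<le> 1"
  shows "(\<integral>x. of_real x ^ Suc k * exp (z * of_real x) \<partial>std_normal_distribution)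
    = z * (\<integral>x. of_real x ^ k * exp (z * of_real x) \<partial>std_normal_distribution)
      + of_nat k * (\<integral>x. of_real x ^ (k - 1) * exp (z * of_real x) \<partial>std_normal_distribution)"
    (is "?m (Suc k) = z * ?m k + of_nat k * ?m (k - 1)")
proof -
  let ?F = "\<lambda>x. std_normal_density x *\<^sub>R (of_real x ^ k * exp (z * of_real x))"
  define f where "f = (\<lambda>x. std_normal_density x *\<^sub>R (z * (of_real x ^ k * exp (z * of_real x))
      + of_nat k * (of_real x ^ (k - 1) * exp (z * of_real x)) - of_real x ^ Suc k * exp (z * of_real x)))"
  let ?g = "\<lambda>x. z * (of_real x ^ k * exp (z * of_real x))
      + of_nat k * (of_real x ^ (k - 1) * exp (z * of_real x)) - of_real x ^ Suc k * exp (z * of_real x)"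
  have ig: "integrable std_normal_distribution ?g"
    using assms
    by (intro Bochner_Integration.integrable_add Bochner_Integration.integrable_diff integrable_mult_right
        integrable_std_normal_power_exp) auto
  have int_f: "integrable lborel f"
    using ig by (subst (asm) integrable_density) (auto simp: f_def)
  have deriv: "(?F has_vector_derivative f x) (at x)" for x
  proof -
    \<comment> \<open>The same function at complex \<open>w\<close>: its complex derivative
      restricts to the derivative along the real line.\<close>
    let ?G = "\<lambda>w. (w ^ k * exp (z * w)) * exp (- w\<^sup>2 / 2) / of_real (sqrt (2 * pi))"
    have "(?G has_field_derivative (z * (w ^ k * exp (z * w)) + of_nat k * (w ^ (k - 1) * exp (z * w))
        - w ^ Suc k * exp (z * w)) * exp (- w\<^sup>2 / 2) / of_real (sqrt (2 * pi))) (at w)" for w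
      by (rule derivative_eq_intros refl | simp)+ (simp add: field_simps power2_eq_square)
    from has_vector_derivative_real_field[OF this[of "of_real x"]]
    show ?thesis
      by (simp add: f_def normal_density_def scaleR_conv_of_real exp_of_real [symmetric] mult.commute)
  qed
  have "interval_lebesgue_integral lborel (-\<infinity>) \<infinity> f = 0 - 0"
  proof (rule interval_integral_FTC_integrable[where F = ?F])
    show "isCont f x" for x
      unfolding f_def normal_density_def by (intro continuous_intros) auto
    show "set_integrable lborel (einterval (- \<infinity>) \<infinity>) f"
      using int_f by (simp add: set_integrable_def)
    have nF: "norm (?F x) = 1 / sqrt (2 * pi) * (\<bar>x\<bar> ^ k * exp (Re z * x - x\<^sup>2 / 2))" for x
    proof -
      have "exp (Re z * x - x\<^sup>2 / 2) = exp (Re z * x) * exp (- (x\<^sup>2) / 2)"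
        by (simp add: mult_exp_exp)
      then show ?thesis
        by (simp add: normal_density_def norm_mult norm_power)
    qed
    have k: "k = 0 \<or> k = 1" using assms by auto
    have "((\<lambda>x. \<bar>x\<bar> ^ k * exp (Re z * x - x\<^sup>2 / 2)) \<longlongrightarrow> 0) at_bot"
      using k by (elim disjE; simp only:; real_asymp)
    then have "(?F \<longlongrightarrow> 0) at_bot"
      by (subst tendsto_norm_zero_iff[symmetric], subst nF) (auto intro: tendsto_divide_zero)
    then show "((?F \<circ> real_of_ereal) \<longlongrightarrow> 0) (at_right (-\<infinity>))"
      by (simp add: ereal_tendsto_simps comp_assoc)
    have "((\<lambda>x. \<bar>x\<bar> ^ k * exp (Re z * x - x\<^sup>2 / 2)) \<longlongrightarrow> 0) at_top"
      using k by (elim disjE; simp only:; real_asymp)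
    then have "(?F \<longlongrightarrow> 0) at_top"
      by (subst tendsto_norm_zero_iff[symmetric], subst nF) (auto intro: tendsto_divide_zero)
    then show "((?F \<circ> real_of_ereal) \<longlongrightarrow> 0) (at_left \<infinity>)"
      by (simp add: ereal_tendsto_simps comp_assoc)
  qed (use deriv in auto)
  then have "integral\<^sup>L lborel f = 0"
    by (simp add: interval_integral_to_infinity_eq interval_lebesgue_integral_def set_lebesgue_integral_def)
  also have "integral\<^sup>L lborel f = integral\<^sup>L std_normal_distribution ?g"
    unfolding f_def by (subst integral_density) auto
  also have "\<dots> = z * ?m k + of_nat k * ?m (k - 1) - ?m (Suc k)"
    using assms
  proof -
    have i: "integrable std_normal_distribution (\<lambda>x. of_real x ^ j * exp (z * of_real x))" if "j \<le> Suc k" for j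
      using that assms by (intro integrable_std_normal_power_exp) auto
    show ?thesis
      by (subst Bochner_Integration.integral_diff,
          (intro Bochner_Integration.integrable_add integrable_mult_right i; simp), intro i, simp,
          subst Bochner_Integration.integral_add,
            (intro integrable_mult_right i; simp)+, simp only: integral_mult_right_zero)
  qed
  finally show ?thesis by simp
qed

lemma integral_std_normal_times_exp:
  fixes z :: complex
  shows "(\<integral>x. of_real x * exp (z * of_real x) \<partial>std_normal_distribution) = z * exp (z\<^sup>2 / 2)"
  using integral_std_normal_power_Suc_exp[of 0 z] by (simp add: integral_std_normal_exp)

lemma integral_std_normal_power2_exp:
  fixes z :: complex
  shows "(\<integral>x. (of_real x)\<^sup>2 * exp (z * of_real x) \<partial>std_normal_distribution) = (z\<^sup>2 + 1) * exp (z\<^sup>2 / 2)"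
  using integral_std_normal_power_Suc_exp[of 1 z]
  by (simp add: integral_std_normal_times_exp integral_std_normal_exp power2_eq_square algebra_simps)

section \<open>Product Gaussian measures: polynomial moments under an exponential tilt\<close>

definition gauss_measure :: "'i set \<Rightarrow> ('i \<Rightarrow> real) measure" where
  "gauss_measure I = Pi\<^sub>M I (\<lambda>_. std_normal_distribution)"

lemma prob_space_std_normal: "prob_space std_normal_distribution"
  by (rule prob_space_normal_density) simp

lemma prob_space_gauss: "prob_space (gauss_measure I)"
  unfolding gauss_measure_def by (intro prob_space_PiM prob_space_std_normal)

lemma product_prob_space_std_normal: "product_sigma_finite (\<lambda>_. std_normal_distribution)"
  unfolding product_sigma_finite_def
  using prob_space_std_normal by (auto intro!: prob_space_imp_sigma_finite)

lemma measurable_gauss_component: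
  "e \<in> I \<Longrightarrow> (\<lambda>g. g e) \<in> borel_measurable (gauss_measure I)"
  using measurable_component_singleton[of e I "\<lambda>_. std_normal_distribution"]
  by (simp add: gauss_measure_def)

text \<open>Independence reduces the integral to one-dimensional tilted moments of order 0, 1 and 2.
  Taking \<open>k\<close> to be 1 on one or two coordinates, or 2 on a single one, produces every
  linear and quadratic prefactor of an exponential.\<close>

lemma has_bochner_integral_gauss_prod:
  fixes z :: "'i \<Rightarrow> complex" and k :: "'i \<Rightarrow> nat"
  assumes "finite I" "\<And>i. i \<in> I \<Longrightarrow> k i \<le> 2"
  shows "has_bochner_integral (gauss_measure I)
      (\<lambda>g. \<Prod>i\<in>I. of_real (g i) ^ k i * exp (z i * of_real (g i)))
      (\<Prod>i\<in>I. (if k i = 0 then 1 else if k i = 1 then z i else (z i)\<^sup>2 + 1) * exp ((z i)\<^sup>2 / 2))"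
proof -
  interpret product_sigma_finite "\<lambda>_ :: 'i. std_normal_distribution" by (rule product_prob_space_std_normal)
  have i: "integrable std_normal_distribution (\<lambda>x. of_real x ^ k i * exp (z i * of_real x))" if "i \<in> I" for i
    using assms that by (intro integrable_std_normal_power_exp) auto
  have v: "(\<integral>x. of_real x ^ k i * exp (z i * of_real x) \<partial>std_normal_distribution)
      = (if k i = 0 then 1 else if k i = 1 then z i else (z i)\<^sup>2 + 1) * exp ((z i)\<^sup>2 / 2)" if "i \<in> I" for i
  proof -
    have "k i = 0 \<or> k i = 1 \<or> k i = 2" using assms(2)[OF that] by auto
    then show ?thesis
      by (auto simp: integral_std_normal_exp integral_std_normal_times_exp integral_std_normal_power2_exp)
  qed
  show ?thesis
    using product_integrable_prod[OF assms(1) i] product_integral_prod[OF assms(1) i] v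
    unfolding has_bochner_integral_iff gauss_measure_def by (simp cong: prod.cong)
qed

lemma has_bochner_integral_gauss_exp:
  fixes z :: "'i \<Rightarrow> complex"
  assumes "finite I"
  shows "has_bochner_integral (gauss_measure I) (\<lambda>g. exp (\<Sum>i\<in>I. z i * of_real (g i)))
    (exp ((\<Sum>i\<in>I. (z i)\<^sup>2) / 2))"
  using has_bochner_integral_gauss_prod[OF assms, of "\<lambda>_. 0" z] assms
  by (simp add: exp_sum sum_divide_distrib)

lemma has_bochner_integral_gauss_coord:
  fixes z :: "'i \<Rightarrow> complex"
  assumes "finite I" "e \<in> I"
  shows "has_bochner_integral (gauss_measure I)
    (\<lambda>g. of_real (g e) * exp (\<Sum>i\<in>I. z i * of_real (g i))) (z e * exp ((\<Sum>i\<in>I. (z i)\<^sup>2) / 2))"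
proof -
  have 1: "(\<Prod>i\<in>I. of_real (g i) ^ (if i = e then 1 else 0) * exp (z i * of_real (g i)))
      = of_real (g e) * exp (\<Sum>i\<in>I. z i * of_real (g i))" for g :: "'i \<Rightarrow> real"
    using assms by (simp add: exp_sum prod.distrib prod.remove[OF assms] if_distrib[of "\<lambda>k. _ ^ k"] cong: if_cong)
  have 2: "(\<Prod>i\<in>I. (if (if i = e then 1 else 0 :: nat) = 0 then 1 else if (if i = e then 1 else 0 :: nat) = 1
      then z i else (z i)\<^sup>2 + 1) * exp ((z i)\<^sup>2 / 2)) = z e * exp ((\<Sum>i\<in>I. (z i)\<^sup>2) / 2)"
    using assms by (simp add: exp_sum sum_divide_distrib prod.distrib prod.remove[OF assms])
  show ?thesis
    using has_bochner_integral_gauss_prod[OF assms(1), of "\<lambda>i. if i = e then 1 else 0" z]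
    unfolding 1 2 by simp
qed

lemma has_bochner_integral_gauss_coord2:
  fixes z :: "'i \<Rightarrow> complex"
  assumes "finite I" "e \<in> I" "f \<in> I"
  shows "has_bochner_integral (gauss_measure I)
    (\<lambda>g. of_real (g e) * of_real (g f) * exp (\<Sum>i\<in>I. z i * of_real (g i)))
    ((z e * z f + (if e = f then 1 else 0)) * exp ((\<Sum>i\<in>I. (z i)\<^sup>2) / 2))"
proof (cases "e = f")
  case True
  have 1: "(\<Prod>i\<in>I. of_real (g i) ^ (if i = e then 2 else 0) * exp (z i * of_real (g i)))
      = of_real (g e) * of_real (g e) * exp (\<Sum>i\<in>I. z i * of_real (g i))" for g :: "'i \<Rightarrow> real"
    using assms by (simp add: exp_sum prod.distrib prod.remove[OF assms(1,2)] power2_eq_square if_distrib[of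
        "\<lambda>k. _ ^ k"] cong: if_cong)
  have 2: "(\<Prod>i\<in>I. (if (if i = e then 2 else 0 :: nat) = 0 then 1 else if (if i = e then 2 else 0 :: nat) = 1
      then z i else (z i)\<^sup>2 + 1) * exp ((z i)\<^sup>2 / 2)) = (z e * z e + 1) * exp ((\<Sum>i\<in>I. (z i)\<^sup>2) / 2)"
    using assms by (simp add: exp_sum sum_divide_distrib prod.distrib prod.remove[OF assms(1,2)] power2_eq_square)
  show ?thesis
    using has_bochner_integral_gauss_prod[OF assms(1), of "\<lambda>i. if i = e then 2 else 0" z]
    unfolding 1 2 using True by simp
next
  case False
  have f: "finite (I - {e})" "f \<in> I - {e}" using assms False by auto
  have 1: "(\<Prod>i\<in>I. of_real (g i) ^ (if i = e \<or> i = f then 1 else 0) * exp (z i * of_real (g i)))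
      = of_real (g e) * of_real (g f) * exp (\<Sum>i\<in>I. z i * of_real (g i))" for g :: "'i \<Rightarrow> real"
    using assms by (simp add: exp_sum prod.distrib prod.remove[OF assms(1,2)] prod.remove[OF f] if_distrib[of
        "\<lambda>k. _ ^ k"] cong: if_cong)
  have 2: "(\<Prod>i\<in>I. (if (if i = e \<or> i = f then 1 else 0 :: nat)
      = 0 then 1 else if (if i = e \<or> i = f then 1 else 0 :: nat) = 1
      then z i else (z i)\<^sup>2 + 1) * exp ((z i)\<^sup>2 / 2)) = z e * z f * exp ((\<Sum>i\<in>I. (z i)\<^sup>2) / 2)"
    using assms by (simp add: exp_sum sum_divide_distrib prod.distrib prod.remove[OF assms(1,2)] prod.remove[OF f])
  show ?thesis
    using has_bochner_integral_gauss_prod[OF assms(1), of "\<lambda>i. if i = e \<or> i = f then 1 else 0" z]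
    unfolding 1 2 using False by simp
qed

lemma has_bochner_integral_gauss_linear_exp:
  fixes a z :: "'i \<Rightarrow> complex"
  assumes "finite I"
  shows "has_bochner_integral (gauss_measure I)
    (\<lambda>g. (\<Sum>i\<in>I. a i * of_real (g i)) * exp (\<Sum>i\<in>I. z i * of_real (g i)))
    ((\<Sum>i\<in>I. a i * z i) * exp ((\<Sum>i\<in>I. (z i)\<^sup>2) / 2))"
proof -
  have "has_bochner_integral (gauss_measure I)
      (\<lambda>g. \<Sum>e\<in>I. a e * (of_real (g e) * exp (\<Sum>i\<in>I. z i * of_real (g i))))
      (\<Sum>e\<in>I. a e * (z e * exp ((\<Sum>i\<in>I. (z i)\<^sup>2) / 2)))"
    by (intro has_bochner_integral_sum has_bochner_integral_mult_right has_bochner_integral_gauss_coord assms)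
  then show ?thesis by (simp add: sum_distrib_right mult.assoc)
qed

text \<open>Wick's formula under a tilt: each linear form is replaced by its pairing with
  \<open>z\<close>, and the two forms are in addition contracted with each other.\<close>

lemma has_bochner_integral_gauss_linear2_exp:
  fixes a b z :: "'i \<Rightarrow> complex"
  assumes "finite I"
  shows "has_bochner_integral (gauss_measure I)
    (\<lambda>g. (\<Sum>i\<in>I. a i * of_real (g i)) * (\<Sum>i\<in>I. b i * of_real (g i)) * exp (\<Sum>i\<in>I. z i * of_real (g i)))
    (((\<Sum>i\<in>I. a i * z i) * (\<Sum>i\<in>I. b i * z i) + (\<Sum>i\<in>I. a i * b i)) * exp ((\<Sum>i\<in>I. (z i)\<^sup>2) / 2))"
proof -
  let ?E = "exp ((\<Sum>i\<in>I. (z i)\<^sup>2) / 2)"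
  have *: "has_bochner_integral (gauss_measure I)
      (\<lambda>g. \<Sum>e\<in>I. \<Sum>f\<in>I. a e * b f * (of_real (g e) * of_real (g f) * exp (\<Sum>i\<in>I. z i * of_real (g i))))
      (\<Sum>e\<in>I. \<Sum>f\<in>I. a e * b f * ((z e * z f + (if e = f then 1 else 0)) * ?E))"
    by (intro has_bochner_integral_sum has_bochner_integral_mult_right has_bochner_integral_gauss_coord2 assms)
  have 1: "(\<Sum>e\<in>I. \<Sum>f\<in>I. a e * b f * (of_real (g e) * of_real (g f) * exp (\<Sum>i\<in>I. z i * of_real (g i))))
      = (\<Sum>i\<in>I. a i * of_real (g i)) * (\<Sum>i\<in>I. b i * of_real (g i)) * exp (\<Sum>i\<in>I. z i * of_real (g i))"
    for g :: "'i \<Rightarrow> real"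
    by (subst sum_product) (simp add: sum_distrib_left sum_distrib_right mult_ac)
  have "(\<Sum>e\<in>I. \<Sum>f\<in>I. a e * b f * ((z e * z f + (if e = f then 1 else 0)) * ?E))
      = (\<Sum>e\<in>I. \<Sum>f\<in>I. a e * z e * (b f * z f) * ?E + (if e = f then a e * b f * ?E else 0))"
    by (intro sum.cong) (auto simp: algebra_simps)
  also have "\<dots> = ((\<Sum>i\<in>I. a i * z i) * (\<Sum>i\<in>I. b i * z i) + (\<Sum>i\<in>I. a i * b i)) * ?E"
  proof -
    have "(\<Sum>e\<in>I. \<Sum>f\<in>I. a e * z e * (b f * z f) * ?E) = (\<Sum>i\<in>I. a i * z i) * (\<Sum>i\<in>I. b i * z i) * ?E"
      by (subst sum_product) (simp only: sum_distrib_right)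
    then show ?thesis
      using assms by (simp add: sum.distrib sum_distrib_right distrib_right)
  qed
  finally show ?thesis using * unfolding 1 by simp
qed

section \<open>The Curie--Weiss model\<close>

text \<open>The trapezoidal rule overestimates the integral of the convex function
  \<open>f'\<close>. The proof lets the half-width \<open>t\<close> of the interval grow from 0 to 1
  and follows the defect \<open>k t\<close>.\<close>

lemma hermite_hadamard_deriv:
  fixes f f' f'' :: "real \<Rightarrow> real"
  assumes f: "\<And>x. (f has_real_derivative f' x) (at x)"
    and f': "\<And>x. (f' has_real_derivative f'' x) (at x)"
    and mono: "mono f''"
  shows "f (x + 1) - f (x - 1) \<le> f' (x + 1) + f' (x - 1)"
proof -
  define k where "k t = t * (f' (x + t) + f' (x - t)) - (f (x + t) - f (x - t))" for t
  have "(k has_real_derivative t * (f'' (x + t) - f'' (x - t))) (at t)" for t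
    unfolding k_def
    by (auto intro!: derivative_eq_intros DERIV_chain2[OF f] DERIV_chain2[OF f'] simp: algebra_simps)
  moreover have "t * (f'' (x + t) - f'' (x - t)) \<ge> 0" if "t \<ge> 0" for t
    using that by (intro mult_nonneg_nonneg) (auto intro!: monoD[OF mono])
  ultimately have "k 0 \<le> k 1"
    by (intro DERIV_nonneg_imp_nondecreasing[of 0 1 k]) auto
  then show ?thesis by (simp add: k_def)
qed

lemma exp_square_hermite_hadamard:
  fixes c :: real
  assumes "c \<ge> 0"
  shows "(x + 1) * exp (c * (x + 1)\<^sup>2 / 2) - (x - 1) * exp (c * (x - 1)\<^sup>2 / 2)
    \<le> (1 + c * (x + 1)\<^sup>2) * exp (c * (x + 1)\<^sup>2 / 2) + (1 + c * (x - 1)\<^sup>2) * exp (c * (x - 1)\<^sup>2 / 2)"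
proof -
  \<comment> \<open>\<open>h\<close> is the second derivative of
    \<open>x * exp (c * x\<^sup>2 / 2)\<close>. It is odd, so its monotonicity needs checking only
    on the nonnegative half-line.\<close>
  define h :: "real \<Rightarrow> real" where "h y = (3 * c * y + c\<^sup>2 * y ^ 3) * exp (c * y\<^sup>2 / 2)" for y
  have pos: "h y \<le> h z" if "0 \<le> y" "y \<le> z" for y z
    unfolding h_def using that assms
    by (intro mult_mono add_mono mult_left_mono power_mono) (auto intro!: divide_right_mono mult_left_mono power_mono)
  have odd: "h (- y) = - h y" for y
    by (simp add: h_def algebra_simps)
  have "mono h"
  proof (rule monoI)
    fix y z :: real assume "y \<le> z"
    have h0: "h 0 = 0" by (simp add: h_def)
    consider "0 \<le> y" | "y \<le> 0" "0 \<le> z" | "z \<le> 0" by linarith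
    then show "h y \<le> h z"
    proof cases
      case 1 then show ?thesis using pos \<open>y \<le> z\<close> by simp
    next
      case 2 then show ?thesis using pos[of 0 "- y"] pos[of 0 z] odd[of y] h0 by simp
    next
      case 3 then show ?thesis using pos[of "- z" "- y"] \<open>y \<le> z\<close> odd[of y] odd[of z] by simp
    qed
  qed
  then show ?thesis
    by (intro hermite_hadamard_deriv[where f = "\<lambda>x. x * exp (c * x\<^sup>2 / 2)" and f'' = h
          and f' = "\<lambda>x. (1 + c * x\<^sup>2) * exp (c * x\<^sup>2 / 2)"])
      (auto intro!: derivative_eq_intros simp: h_def algebra_simps power2_eq_square power3_eq_cube)
qed

section \<open>Spin sums and the Curie--Weiss average\<close>

abbreviation flip_spin :: "nat \<Rightarrow> (nat \<Rightarrow> real) \<Rightarrow> nat \<Rightarrow> real" where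
  "flip_spin i \<sigma> \<equiv> \<sigma>(i := - \<sigma> i)"

lemma spin_square: "\<sigma> \<in> spin_configs n \<Longrightarrow> i < n \<Longrightarrow> \<sigma> i * \<sigma> i = 1"
  unfolding spin_configs_def by (drule PiE_mem[of _ _ _ i]) auto

lemma spin_cases: "\<sigma> \<in> spin_configs n \<Longrightarrow> i < n \<Longrightarrow> \<sigma> i = 1 \<or> \<sigma> i = -1"
  unfolding spin_configs_def by (drule PiE_mem[of _ _ _ i]) auto

lemma card_spin_configs: "card (spin_configs n) = 2 ^ n"
  unfolding spin_configs_def by (subst card_PiE) (auto simp: numeral_2_eq_2)

lemma sum_spin_configs_flip:
  assumes "i < n"
  shows "(\<Sum>\<sigma>\<in>spin_configs n. f (flip_spin i \<sigma>)) = (\<Sum>\<sigma>\<in>spin_configs n. f \<sigma>)"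
  by (rule sum.reindex_bij_witness[where i = "flip_spin i" and j = "flip_spin i"])
     (use assms in \<open>auto simp: spin_configs_def PiE_iff extensional_def\<close>)

text \<open>Gauge transformation: \<open>\<sigma> k \<mapsto> \<tau> k * \<sigma> k\<close> permutes
  the configurations, so under uniform spins the overlap with a fixed replica is distributed like
  the total magnetization. This turns two-replica sums into Curie--Weiss sums.\<close>

lemma sum_spin_configs_gauge:
  assumes "\<tau> \<in> spin_configs n"
  shows "(\<Sum>\<sigma>\<in>spin_configs n. F (\<Sum>i<n. \<tau> i * \<sigma> i)) = (\<Sum>\<sigma>\<in>spin_configs n. F (\<Sum>i<n. \<sigma> i))"
proof -
  let ?g = "\<lambda>\<sigma>. restrict (\<lambda>k. \<tau> k * \<sigma> k) {..<n}"
  have m: "?g \<sigma> \<in> spin_configs n" if "\<sigma> \<in> spin_configs n" for \<sigma>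
    using spin_cases[OF that] spin_cases[OF assms] by (fastforce simp: spin_configs_def)
  have i: "?g (?g \<sigma>) = \<sigma>" if "\<sigma> \<in> spin_configs n" for \<sigma>
    using that spin_square[OF assms]
    by (auto simp: fun_eq_iff spin_configs_def PiE_iff extensional_def mult.assoc[symmetric])
  show ?thesis
    by (rule sum.reindex_bij_witness[where i = ?g and j = ?g]) (use m i in auto)
qed

text \<open>Stein's method for the Curie--Weiss model: flipping one spin turns \<open>\<sigma> i * f S\<close> into a symmetric
  difference of \<open>f\<close>.\<close>

lemma sum_spin_stein:
  assumes "\<And>x. f (x + 1) - f (x - 1) \<le> f' (x + 1) + f' (x - 1)"
  shows "(\<Sum>\<sigma>\<in>spin_configs n. (\<Sum>i<n. \<sigma> i) * f (\<Sum>i<n. \<sigma> i))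
    \<le> real n * (\<Sum>\<sigma>\<in>spin_configs n. f' (\<Sum>i<n. \<sigma> i))"
proof -
  let ?C = "spin_configs n"
  let ?S = "\<lambda>\<sigma>. \<Sum>i<n. \<sigma> i"
  have 1: "(\<Sum>\<sigma>\<in>?C. \<sigma> i * f (?S \<sigma>)) \<le> (\<Sum>\<sigma>\<in>?C. f' (?S \<sigma>))" if i: "i < n" for i
  proof -
    have S: "?S (flip_spin i \<sigma>) = ?S \<sigma> - 2 * \<sigma> i" for \<sigma>
      using i by (simp add: sum.remove[of _ i])
    have "2 * (\<Sum>\<sigma>\<in>?C. \<sigma> i * f (?S \<sigma>))
        = (\<Sum>\<sigma>\<in>?C. \<sigma> i * f (?S \<sigma>)) + (\<Sum>\<sigma>\<in>?C. flip_spin i \<sigma> i * f (?S (flip_spin i \<sigma>)))"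
      by (subst sum_spin_configs_flip[OF i, where f = "\<lambda>\<sigma>. \<sigma> i * f (?S \<sigma>)"]) simp
    also have "\<dots> = (\<Sum>\<sigma>\<in>?C. \<sigma> i * f (?S \<sigma>) + flip_spin i \<sigma> i * f (?S (flip_spin i \<sigma>)))"
      by (simp only: sum.distrib)
    also have "\<dots> \<le> (\<Sum>\<sigma>\<in>?C. f' (?S \<sigma>) + f' (?S (flip_spin i \<sigma>)))"
    proof (rule sum_mono)
      fix \<sigma> assume "\<sigma> \<in> ?C"
      \<comment> \<open>With \<open>x\<close> the sum of the other spins, the two magnetizations are
        \<open>x + 1\<close> and \<open>x - 1\<close>, and the left-hand side is
        \<open>f (x + 1) - f (x - 1)\<close> for either sign of \<open>\<sigma> i\<close>.\<close>
      from spin_cases[OF this i] show "\<sigma> i * f (?S \<sigma>) + flip_spin i \<sigma> i * f (?S (flip_spin i \<sigma>))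
          \<le> f' (?S \<sigma>) + f' (?S (flip_spin i \<sigma>))"
        unfolding S using assms[of "?S \<sigma> - 1"] assms[of "?S \<sigma> + 1"] by (auto simp: add.commute)
    qed
    also have "\<dots> = 2 * (\<Sum>\<sigma>\<in>?C. f' (?S \<sigma>))"
      using sum_spin_configs_flip[OF i, where f = "\<lambda>\<sigma>. f' (?S \<sigma>)"] by (simp add: sum.distrib)
    finally show ?thesis by simp
  qed
  have "(\<Sum>\<sigma>\<in>?C. ?S \<sigma> * f (?S \<sigma>)) = (\<Sum>i<n. \<Sum>\<sigma>\<in>?C. \<sigma> i * f (?S \<sigma>))"
    by (subst sum.swap) (simp add: sum_distrib_right)
  also have "\<dots> \<le> (\<Sum>i<n. \<Sum>\<sigma>\<in>?C. f' (?S \<sigma>))"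
    by (intro sum_mono 1) auto
  finally show ?thesis by simp
qed

text \<open>The average is over uniform spins. In the variable \<open>s\<close>, the squared
  magnetization over \<open>n\<close>, the unnormalized Curie--Weiss weight at inverse temperature
  \<open>b\<close> is \<open>exp (b * s / 2)\<close>.\<close>

definition cw_mean :: "nat \<Rightarrow> (real \<Rightarrow> real) \<Rightarrow> real" where
  "cw_mean n F = (\<Sum>\<sigma>\<in>spin_configs n. F ((\<Sum>i<n. \<sigma> i)\<^sup>2 / real n)) / 2 ^ n"

lemma cw_mean_mono:
  "(\<And>s. 0 \<le> s \<Longrightarrow> F s \<le> G s) \<Longrightarrow> cw_mean n F \<le> cw_mean n G"
  unfolding cw_mean_def by (intro divide_right_mono sum_mono) auto

lemma cw_mean_add: "cw_mean n (\<lambda>s. F s + G s) = cw_mean n F + cw_mean n G"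
  unfolding cw_mean_def by (simp add: sum.distrib add_divide_distrib)

lemma cw_mean_cmult: "cw_mean n (\<lambda>s. c * F s) = c * cw_mean n F"
  unfolding cw_mean_def by (simp add: sum_distrib_left)

text \<open>Stein's inequality for \<open>f x = x * exp (c * x\<^sup>2 / 2)\<close> with
  \<open>c = b / n\<close>. If the magnetization were a centred Gaussian of variance
  \<open>n\<close> and \<open>b < 1\<close>, this would be an equality, the tilted mean of
  \<open>s\<close> being \<open>1 / (1 - b)\<close>.\<close>

lemma cw_mean_stein:
  assumes "b \<ge> 0" "n \<ge> 1"
  shows "cw_mean n (\<lambda>s. (s * (1 - b) - 1) * exp (b * s / 2)) \<le> 0"
proof -
  let ?C = "spin_configs n"
  let ?S = "\<lambda>\<sigma>. \<Sum>i<n. \<sigma> i"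
  define c where "c = b / real n"
  have n: "real n > 0" using assms by simp
  have "(\<Sum>\<sigma>\<in>?C. ?S \<sigma> * (?S \<sigma> * exp (c * (?S \<sigma>)\<^sup>2 / 2)))
      \<le> real n * (\<Sum>\<sigma>\<in>?C. (1 + c * (?S \<sigma>)\<^sup>2) * exp (c * (?S \<sigma>)\<^sup>2 / 2))"
    by (rule sum_spin_stein) (rule exp_square_hermite_hadamard, use assms in \<open>simp add: c_def\<close>)
  then have "0 \<ge> (\<Sum>\<sigma>\<in>?C. ?S \<sigma> * (?S \<sigma> * exp (c * (?S \<sigma>)\<^sup>2 / 2))
      - real n * ((1 + c * (?S \<sigma>)\<^sup>2) * exp (c * (?S \<sigma>)\<^sup>2 / 2)))"
    by (simp add: sum_subtractf sum_distrib_left)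
  also have "(\<Sum>\<sigma>\<in>?C. ?S \<sigma> * (?S \<sigma> * exp (c * (?S \<sigma>)\<^sup>2 / 2))
      - real n * ((1 + c * (?S \<sigma>)\<^sup>2) * exp (c * (?S \<sigma>)\<^sup>2 / 2)))
      = (\<Sum>\<sigma>\<in>?C. real n * (((?S \<sigma>)\<^sup>2 / real n * (1 - b) - 1) * exp (b * ((?S \<sigma>)\<^sup>2 / real n) / 2)))"
    using n by (intro sum.cong) (auto simp: c_def field_simps power2_eq_square)
  also have "\<dots> = real n * 2 ^ n * cw_mean n (\<lambda>s. (s * (1 - b) - 1) * exp (b * s / 2))"
    unfolding cw_mean_def sum_distrib_left[symmetric] by simp
  finally have "real n * 2 ^ n * cw_mean n (\<lambda>s. (s * (1 - b) - 1) * exp (b * s / 2)) \<le> 0" .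
  moreover have "real n * 2 ^ n > 0" using n by simp
  ultimately show ?thesis by (meson mult_pos_pos not_le)
qed

text \<open>Stein's inequality bounds the logarithmic derivative of the Curie--Weiss partition
  function by \<open>1 / (2 * (1 - t))\<close>; integrating from \<open>t = 0\<close>, where the
  value is 1, gives the Gaussian value \<open>1 / sqrt (1 - b)\<close> as an upper bound.\<close>

lemma cw_mean_exp_le:
  assumes "0 \<le> b" "b < 1" "n \<ge> 1"
  shows "cw_mean n (\<lambda>s. exp (b * s / 2)) \<le> 1 / sqrt (1 - b)"
proof -
  define k where "k t = cw_mean n (\<lambda>s. exp (t * s / 2)) * sqrt (1 - t)" for t
  have "k b \<le> k 0"
  proof (rule DERIV_nonpos_imp_nonincreasing[of 0 b k])
    fix t assume t: "0 \<le> t" "t \<le> b"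
    have d1: "((\<lambda>t. cw_mean n (\<lambda>s. exp (t * s / 2))) has_real_derivative cw_mean n (\<lambda>s. s / 2 * exp (t * s / 2)))
        (at t)"
      unfolding cw_mean_def
      by (rule derivative_eq_intros refl | simp)+ (simp add: sum_divide_distrib mult.commute)
    have d2: "((\<lambda>t. sqrt (1 - t)) has_real_derivative - 1 / (2 * sqrt (1 - t))) (at t)"
      using t assms by (auto intro!: derivative_eq_intros simp: field_simps)
    have "(k has_real_derivative cw_mean n (\<lambda>s. exp (t * s / 2)) * (- 1 / (2 * sqrt (1 - t)))
        + cw_mean n (\<lambda>s. s / 2 * exp (t * s / 2)) * sqrt (1 - t)) (at t)"
      unfolding k_def by (rule DERIV_mult'[OF d1 d2])
    moreover have "cw_mean n (\<lambda>s. exp (t * s / 2)) * (- 1 / (2 * sqrt (1 - t)))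
        + cw_mean n (\<lambda>s. s / 2 * exp (t * s / 2)) * sqrt (1 - t) \<le> 0"
    proof -
      have "cw_mean n (\<lambda>s. (s * (1 - t) - 1) * exp (t * s / 2))
          = cw_mean n (\<lambda>s. 2 * (1 - t) * (s / 2 * exp (t * s / 2)) + (-1) * exp (t * s / 2))"
        by (intro arg_cong[where f = "cw_mean n"] ext) (simp add: field_simps)
      then have "2 * (1 - t) * cw_mean n (\<lambda>s. s / 2 * exp (t * s / 2)) \<le> cw_mean n (\<lambda>s. exp (t * s / 2))"
        using cw_mean_stein[of t n] t assms unfolding cw_mean_add cw_mean_cmult by simp
      then have *: "2 * (sqrt (1 - t) * sqrt (1 - t)) * cw_mean n (\<lambda>s. s / 2 * exp (t * s / 2))
          \<le> cw_mean n (\<lambda>s. exp (t * s / 2))"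
        using t assms by simp
      have "x * (- 1 / (2 * r)) + y * r \<le> 0" if "2 * (r * r) * y \<le> x" "r > 0" for x y r :: real
        using that by (simp add: field_simps)
      from this[OF *] show ?thesis using t assms by simp
    qed
    ultimately show "\<exists>y. (k has_real_derivative y) (at t) \<and> y \<le> 0" by blast
  qed (use assms in auto)
  also have "k 0 = 1" by (simp add: k_def cw_mean_def card_spin_configs)
  finally show ?thesis using assms by (simp add: k_def field_simps)
qed

text \<open>A polynomial in \<open>s\<close> is paid for by a slightly higher inverse temperature
  that is still below 1.\<close>

lemma cw_mean_poly_exp_le:
  assumes "0 \<le> b" "b < 1" "n \<ge> 1"
  shows "cw_mean n (\<lambda>s. (1 + s + s\<^sup>2) * exp (b * s / 2)) \<le> 64 / (1 - b) ^ 3"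
proof -
  \<comment> \<open>The raised inverse temperature \<open>b + 2 * a\<close> is the midpoint of
    \<open>b\<close> and 1, so the distance to criticality is still \<open>2 * a\<close>. The final
    constant is \<open>2 / a\<^sup>2\<close> times \<open>1 / (2 * a)\<close>.\<close>
  define a where "a = (1 - b) / 4"
  have a: "0 < a" "a \<le> 1" using assms by (auto simp: a_def)
  have "(1 + s + s\<^sup>2) * exp (b * s / 2) \<le> 2 / a\<^sup>2 * exp ((b + 2 * a) * s / 2)" if "s \<ge> 0" for s
  proof -
    have "a\<^sup>2 * (1 + s + s\<^sup>2) = a\<^sup>2 + a * (a * s) + (a * s)\<^sup>2" by (simp add: algebra_simps power2_eq_square)
    also have "\<dots> \<le> 1 + 1 * (a * s) + (a * s)\<^sup>2"
      using a that by (intro add_mono mult_right_mono) (auto simp: power_le_one)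
    also have "\<dots> \<le> 2 * (1 + a * s + (a * s)\<^sup>2 / 2)"
      using a that by simp
    also have "\<dots> \<le> 2 * exp (a * s)"
      using a that by (intro mult_left_mono exp_lower_Taylor_quadratic) auto
    finally have "(1 + s + s\<^sup>2) \<le> 2 / a\<^sup>2 * exp (a * s)" using a by (simp add: field_simps)
    then have "(1 + s + s\<^sup>2) * exp (b * s / 2) \<le> 2 / a\<^sup>2 * exp (a * s) * exp (b * s / 2)"
      by (rule mult_right_mono) simp
    then show ?thesis by (simp add: mult_exp_exp field_simps)
  qed
  then have "cw_mean n (\<lambda>s. (1 + s + s\<^sup>2) * exp (b * s / 2)) \<le> 2 / a\<^sup>2 * cw_mean n (\<lambda>s. exp ((b + 2 * a) * s / 2))"
    unfolding cw_mean_cmult[symmetric] by (rule cw_mean_mono)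
  also have "\<dots> \<le> 2 / a\<^sup>2 * (1 / sqrt (1 - (b + 2 * a)))"
    using a assms by (intro mult_left_mono cw_mean_exp_le) (auto simp: a_def field_simps)
  also have "1 - (b + 2 * a) = 2 * a"
  proof -
    have "4 * a = 1 - b" by (simp add: a_def)
    then show ?thesis by linarith
  qed
  \<comment> \<open>The square root is given away, using \<open>2 * a \<le> 1\<close>, to obtain a
    rational constant.\<close>
  also have "2 / a\<^sup>2 * (1 / sqrt (2 * a)) \<le> 2 / a\<^sup>2 * (1 / (2 * a))"
  proof (intro mult_left_mono divide_left_mono)
    show "2 * a \<le> sqrt (2 * a)"
    proof (rule real_le_rsqrt)
      have "2 * a \<le> 1" using assms by (simp add: a_def)
      then show "(2 * a)\<^sup>2 \<le> 2 * a" using a mult_left_mono[of "2 * a" 1 "2 * a"] by (simp add: power2_eq_square)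
    qed
  qed (use a in auto)
  also have "\<dots> = 64 / (1 - b) ^ 3"
  proof -
    have "1 - b = 4 * a" by (simp add: a_def)
    then show ?thesis using a by (simp add: power2_eq_square power3_eq_cube)
  qed
  finally show ?thesis by simp
qed

section \<open>Second moments at complex temperature\<close>

lemma sum_site_pairs_Suc:
  "(\<Sum>e\<in>site_pairs (Suc n). F e) = (\<Sum>e\<in>site_pairs n. F e) + (\<Sum>i<n. F (i, n))"
proof -
  have "site_pairs (Suc n) = site_pairs n \<union> (\<lambda>i. (i, n)) ` {..<n}"
    by (auto simp: site_pairs_def)
  moreover have "site_pairs n \<inter> (\<lambda>i. (i, n)) ` {..<n} = {}" by (auto simp: site_pairs_def)
  ultimately show ?thesis
    by (simp add: sum.union_disjoint finite_site_pairs sum.reindex inj_on_def)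
qed

lemma sum_site_pairs_prod:
  fixes f :: "nat \<Rightarrow> 'a :: comm_ring_1"
  shows "2 * (\<Sum>e\<in>site_pairs n. f (fst e) * f (snd e)) = (\<Sum>i<n. f i)\<^sup>2 - (\<Sum>i<n. (f i)\<^sup>2)"
proof (induction n)
  case 0
  then show ?case by (simp add: site_pairs_def)
next
  case (Suc n)
  have "2 * (\<Sum>e\<in>site_pairs (Suc n). f (fst e) * f (snd e))
      = 2 * (\<Sum>e\<in>site_pairs n. f (fst e) * f (snd e)) + 2 * ((\<Sum>i<n. f i) * f n)"
    by (simp add: sum_site_pairs_Suc distrib_left sum_distrib_right)
  then show ?case unfolding Suc by (simp add: power2_eq_square algebra_simps)
qed

text \<open>The pairs through site \<open>i\<close> correspond to the other sites. \<open>F\<close>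
  receives the partner and the pair itself, since the coupling is stored under the increasing
  pair.\<close>

lemma sum_site_pairs_at:
  assumes "i < n"
  shows "(\<Sum>e\<in>site_pairs n. if fst e = i then F (snd e) e else if snd e = i then F (fst e) e else 0)
    = (\<Sum>k\<in>{..<n} - {i}. F k (if i < k then (i, k) else (k, i)))"
proof -
  let ?D = "{e \<in> site_pairs n. fst e = i \<or> snd e = i}"
  have "(\<Sum>e\<in>site_pairs n. if fst e = i then F (snd e) e else if snd e = i then F (fst e) e else 0)
      = (\<Sum>e\<in>?D. if fst e = i then F (snd e) e else F (fst e) e)"
    by (rule sum.mono_neutral_cong_right) (auto simp: finite_site_pairs)
  also have "\<dots> = (\<Sum>k\<in>{..<n} - {i}. F k (if i < k then (i, k) else (k, i)))"
    by (rule sum.reindex_bij_witness[where i = "\<lambda>k. if i < k then (i, k) else (k, i)"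
          and j = "\<lambda>e. if fst e = i then snd e else fst e"])
       (use assms in \<open>auto simp: site_pairs_def split: if_splits\<close>)
  finally show ?thesis .
qed

section \<open>Couplings, local fields, residuals and their covariances\<close>

definition coupling :: "nat \<Rightarrow> (nat \<times> nat \<Rightarrow> real) \<Rightarrow> nat \<Rightarrow> nat \<Rightarrow> real" where
  "coupling n g i k = (if i < k then g (i, k) else if k < i then g (k, i) else 0) / sqrt (real n)"

lemma coupling_sym: "coupling n g i k = coupling n g k i"
  by (auto simp: coupling_def)

definition sk_ham :: "nat \<Rightarrow> (nat \<times> nat \<Rightarrow> real) \<Rightarrow> (nat \<Rightarrow> real) \<Rightarrow> real" where
  "sk_ham n g \<sigma> = (\<Sum>e\<in>site_pairs n. \<sigma> (fst e) * \<sigma> (snd e) / sqrt (real n) * g e)"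

lemma sk_weight_eq: "sk_weight n \<beta> g \<sigma> = exp (\<beta> * sk_ham n g \<sigma>)"
  unfolding sk_weight_def sk_ham_def by (simp add: sum_distrib_left case_prod_beta mult_ac)

text \<open>The local field written as a linear form in the independent couplings, the shape to
  which Gaussian integration by parts applies.\<close>

definition field_coeff :: "nat \<Rightarrow> (nat \<Rightarrow> real) \<Rightarrow> nat \<Rightarrow> nat \<times> nat \<Rightarrow> real" where
  "field_coeff n \<sigma> i e = (if fst e = i then \<sigma> (snd e) / sqrt (real n)
     else if snd e = i then \<sigma> (fst e) / sqrt (real n) else 0)"

definition local_field :: "nat \<Rightarrow> (nat \<times> nat \<Rightarrow> real) \<Rightarrow> (nat \<Rightarrow> real) \<Rightarrow> nat \<Rightarrow> real" where
  "local_field n g \<sigma> i = (\<Sum>k<n. coupling n g i k * \<sigma> k)"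

lemma local_field_eq:
  assumes "i < n"
  shows "local_field n g \<sigma> i = (\<Sum>e\<in>site_pairs n. field_coeff n \<sigma> i e * g e)"
proof -
  have "(\<Sum>e\<in>site_pairs n. field_coeff n \<sigma> i e * g e)
      = (\<Sum>e\<in>site_pairs n. if fst e = i then \<sigma> (snd e) / sqrt (real n) * g e
          else if snd e = i then \<sigma> (fst e) / sqrt (real n) * g e else 0)"
    by (intro sum.cong) (auto simp: field_coeff_def)
  also have "\<dots> = (\<Sum>k\<in>{..<n} - {i}. \<sigma> k / sqrt (real n) * g (if i < k then (i, k) else (k, i)))"
    by (rule sum_site_pairs_at[OF assms])
  also have "\<dots> = (\<Sum>k\<in>{..<n} - {i}. coupling n g i k * \<sigma> k)"
    by (intro sum.cong) (auto simp: coupling_def)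
  also have "\<dots> = local_field n g \<sigma> i"
    using assms by (simp add: local_field_def sum.remove[of "{..<n}" i] coupling_def[of n g i i])
  finally show ?thesis by simp
qed

text \<open>Normalized by the expectation \<open>2 ^ n * exp (\<zeta>\<^sup>2 * (n - 1) / 4)\<close> of the partition function, and not by the
  partition function itself, so that averages are entire functions of \<open>\<zeta>\<close>.\<close>

definition sk_avg :: "nat \<Rightarrow> complex \<Rightarrow> (nat \<times> nat \<Rightarrow> real) \<Rightarrow> ((nat \<Rightarrow> real) \<Rightarrow> complex) \<Rightarrow> complex" where
  "sk_avg n \<zeta> g F = (\<Sum>\<sigma>\<in>spin_configs n. exp (- (\<zeta>\<^sup>2 * (of_nat n - 1) / 4)) / 2 ^ n
      * exp (\<zeta> * of_real (sk_ham n g \<sigma>)) * F \<sigma>)"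

definition resid_vec :: "nat \<Rightarrow> complex \<Rightarrow> (nat \<times> nat \<Rightarrow> real) \<Rightarrow> (nat \<Rightarrow> real) \<Rightarrow> nat \<Rightarrow> complex" where
  "resid_vec n \<zeta> g \<sigma> i = (1 + \<zeta>\<^sup>2) * of_real (\<sigma> i) - \<zeta> * of_real (local_field n g \<sigma> i)"

text \<open>Since \<open>resid_vec\<close> is
  \<open>(1 + \<zeta>\<^sup>2 - \<zeta> A) \<sigma>\<close>, this is the matrix
  \<open>(1 + \<zeta>\<^sup>2 - \<zeta> A) \<sigma> \<sigma>\<^sup>T\<close> minus the identity. Its
  average is the error matrix in the resolvent equation.\<close>

definition resid :: "nat \<Rightarrow> complex \<Rightarrow> (nat \<times> nat \<Rightarrow> real) \<Rightarrow> (nat \<Rightarrow> real) \<Rightarrow> nat \<Rightarrow> nat \<Rightarrow> complex" where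
  "resid n \<zeta> g \<sigma> i j = resid_vec n \<zeta> g \<sigma> i * of_real (\<sigma> j) - (if i = j then 1 else 0)"

definition overlap :: "nat \<Rightarrow> (nat \<Rightarrow> real) \<Rightarrow> (nat \<Rightarrow> real) \<Rightarrow> real" where
  "overlap n \<sigma> \<tau> = (\<Sum>i<n. \<sigma> i * \<tau> i)"

abbreviation overlap\<^sub>c :: "nat \<Rightarrow> (nat \<Rightarrow> real) \<Rightarrow> (nat \<Rightarrow> real) \<Rightarrow> complex" where
  "overlap\<^sub>c n \<sigma> \<tau> \<equiv> complex_of_real (overlap n \<sigma> \<tau>)"

text \<open>The coefficient of \<open>g e\<close> in \<open>x\<close> times the energy of
  \<open>\<sigma>\<close> plus \<open>y\<close> times that of \<open>\<tau>\<close>. Independent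
  complex \<open>x\<close> and \<open>y\<close> keep the calculation polynomial; the moments need
  \<open>y = cnj x\<close>.\<close>

definition pair_coeff :: "nat \<Rightarrow> (nat \<Rightarrow> real) \<Rightarrow> (nat \<Rightarrow> real) \<Rightarrow> complex \<Rightarrow> complex \<Rightarrow> nat \<times> nat \<Rightarrow> complex" where
  "pair_coeff n \<sigma> \<tau> x y e = x * of_real (\<sigma> (fst e) * \<sigma> (snd e) / sqrt (real n)) + y * of_real
      (\<tau> (fst e) * \<tau> (snd e) / sqrt (real n))"

context
  fixes n :: nat and \<sigma> \<tau> :: "nat \<Rightarrow> real"
  assumes n: "n \<ge> 1" and \<sigma>: "\<sigma> \<in> spin_configs n" and \<tau>: "\<tau> \<in> spin_configs n"
begin

lemma spin_sq1: "i < n \<Longrightarrow> \<sigma> i * \<sigma> i = 1" and spin_sq2: "i < n \<Longrightarrow> \<tau> i * \<tau> i = 1"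
  using spin_square[OF \<sigma>] spin_square[OF \<tau>] by auto

lemma spin_csq1: "i < n \<Longrightarrow> complex_of_real (\<sigma> i) * complex_of_real (\<sigma> i) = 1"
  and spin_csq2: "i < n \<Longrightarrow> complex_of_real (\<tau> i) * complex_of_real (\<tau> i) = 1"
  unfolding of_real_mult[symmetric] by (simp_all add: spin_sq1 spin_sq2)

lemma sqrt_n_sq: "complex_of_real (sqrt (real n)) * complex_of_real (sqrt (real n)) = of_nat n"
  unfolding of_real_mult[symmetric] by simp

lemma n_nonzero: "(of_nat n :: complex) \<noteq> 0" "complex_of_real (sqrt (real n)) \<noteq> 0"
  using n by auto

text \<open>This is the exponent produced by Gaussian integration. The part free of the overlap is
  exactly what the normalization of \<open>sk_avg\<close> removes; the rest is a Curie--Weiss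
  interaction at inverse temperature \<open>x * y\<close>, and the \<open>- 1\<close> comes from the
  missing diagonal pairs.\<close>

lemma sum_pair_coeff_square:
  "(\<Sum>e\<in>site_pairs n. (pair_coeff n \<sigma> \<tau> x y e)\<^sup>2) / 2
      = (x\<^sup>2 + y\<^sup>2) * (of_nat n - 1) / 4 + x * y * ((overlap\<^sub>c n \<sigma> \<tau>)\<^sup>2 / of_nat n - 1) / 2"
proof -
  let ?f = "\<lambda>i. complex_of_real (\<sigma> i * \<tau> i)"
  have fsq: "(?f i)\<^sup>2 = 1" if "i < n" for i
    using spin_csq1[OF that] spin_csq2[OF that] by (simp add: power2_eq_square mult_ac)
  have "(pair_coeff n \<sigma> \<tau> x y e)\<^sup>2 = ((x\<^sup>2 + y\<^sup>2) + 2 * x * y * (?f (fst e) * ?f (snd e))) / of_nat n"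
    if "e \<in> site_pairs n" for e
  proof -
    have ij: "fst e < n" "snd e < n" using that by (auto simp: site_pairs_def)
    let ?s = "\<lambda>i. complex_of_real (\<sigma> i)" and ?t = "\<lambda>i. complex_of_real (\<tau> i)"
    have "(pair_coeff n \<sigma> \<tau> x y e)\<^sup>2 = (x\<^sup>2 * (?s (fst e) * ?s (fst e)) * (?s (snd e) * ?s (snd e))
        + y\<^sup>2 * (?t (fst e) * ?t (fst e)) * (?t (snd e) * ?t (snd e))
        + 2 * x * y * (?f (fst e) * ?f (snd e))) /
          (complex_of_real (sqrt (real n)) * complex_of_real (sqrt (real n)))"
      unfolding pair_coeff_def using n_nonzero by (simp add: power2_eq_square field_simps)
    then show ?thesis by (simp only: sqrt_n_sq spin_csq1[OF ij(1)] spin_csq1[OF ij(2)] spin_csq2[OF ij(1)] spin_csq2[OF ij(2)] mult_1_right)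
  qed
  then have "(\<Sum>e\<in>site_pairs n. (pair_coeff n \<sigma> \<tau> x y e)\<^sup>2)
      = (\<Sum>e\<in>site_pairs n. ((x\<^sup>2 + y\<^sup>2) / 1 * (1 * 1) + 2 * x * y * (?f (fst e) * ?f (snd e))) / of_nat n)"
    by (intro sum.cong) auto
  also have "\<dots> = ((x\<^sup>2 + y\<^sup>2) / 2 * (2 * (\<Sum>e\<in>site_pairs n. 1 * 1)) + x * y *
      (2 * (\<Sum>e\<in>site_pairs n. ?f (fst e) * ?f (snd e)))) / of_nat n"
    using n_nonzero by (simp add: sum.distrib sum_distrib_left[symmetric] sum_divide_distrib[symmetric])
  also have "\<dots> = ((x\<^sup>2 + y\<^sup>2) / 2 * ((of_nat n)\<^sup>2 - of_nat n) + x * y * ((overlap\<^sub>c n \<sigma> \<tau>)\<^sup>2 - of_nat n)) / of_nat n"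
    unfolding sum_site_pairs_prod[of ?f] sum_site_pairs_prod[of "\<lambda>_. 1 :: complex"]
    using fsq by (simp add: overlap_def)
  also have "\<dots> / 2 = (x\<^sup>2 + y\<^sup>2) * (of_nat n - 1) / 4 + x * y * ((overlap\<^sub>c n \<sigma> \<tau>)\<^sup>2 / of_nat n - 1) / 2"
    using n_nonzero by (simp add: field_simps power2_eq_square)
  finally show ?thesis by simp
qed

lemma sum_except: "i < n \<Longrightarrow> (\<Sum>k\<in>{..<n} - {i}. f k) = (\<Sum>k<n. f k) - (f i :: complex)"
  by (simp add: sum.remove[of "{..<n}" i])

text \<open>The covariance of a local field with the two-replica energy. The last term, of relative
  size \<open>1 / n\<close>, corrects for the absence of self-interaction at
  \<open>i\<close>.\<close>

lemma sum_field_coeff_pair_coeff: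
  assumes i: "i < n"
  shows "(\<Sum>e\<in>site_pairs n. of_real (field_coeff n \<sigma> i e) * pair_coeff n \<sigma> \<tau> x y e)
      = x * of_real (\<sigma> i) + y * (overlap\<^sub>c n \<sigma> \<tau> / of_nat n) * of_real (\<tau> i) - (x + y) * of_real (\<sigma> i) / of_nat n"
proof -
  let ?s = "\<lambda>i. complex_of_real (\<sigma> i)" and ?t = "\<lambda>i. complex_of_real (\<tau> i)"
  let ?F = "\<lambda>k e. ?s k / of_real (sqrt (real n)) * pair_coeff n \<sigma> \<tau> x y e"
  have "(\<Sum>e\<in>site_pairs n. of_real (field_coeff n \<sigma> i e) * pair_coeff n \<sigma> \<tau> x y e)
      = (\<Sum>e\<in>site_pairs n. if fst e = i then ?F (snd e) e else if snd e = i then ?F (fst e) e else 0)"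
    by (intro sum.cong) (auto simp: field_coeff_def)
  also have "\<dots> = (\<Sum>k\<in>{..<n} - {i}. ?F k (if i < k then (i, k) else (k, i)))"
    by (rule sum_site_pairs_at[OF i])
  also have "\<dots> = (\<Sum>k\<in>{..<n} - {i}. (x * ?s i + y * ?t i * (?s k * ?t k)) / of_nat n)"
  proof (intro sum.cong refl)
    fix k assume k: "k \<in> {..<n} - {i}"
    have "?F k (if i < k then (i, k) else (k, i))
        = (x * ?s i * (?s k * ?s k) + y * ?t i * (?s k * ?t k)) /
          (complex_of_real (sqrt (real n)) * complex_of_real (sqrt (real n)))"
      unfolding pair_coeff_def using n_nonzero by (simp add: field_simps)
    then show "?F k (if i < k then (i, k) else (k, i)) = (x * ?s i + y * ?t i * (?s k * ?t k)) / of_nat n"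
      using k by (simp only: sqrt_n_sq) (simp add: spin_csq1)
  qed
  also have "\<dots> = (\<Sum>k<n. (x * ?s i + y * ?t i * (?s k * ?t k)) / of_nat n) -
      (x * ?s i + y * ?t i * (?s i * ?t i)) / of_nat n"
    by (rule sum_except[OF i])
  also have "(\<Sum>k<n. (x * ?s i + y * ?t i * (?s k * ?t k)) / of_nat n)
      = x * ?s i + y * (overlap\<^sub>c n \<sigma> \<tau> / of_nat n) * ?t i"
    using n_nonzero by (simp add: sum.distrib add_divide_distrib sum_divide_distrib[symmetric] sum_distrib_left[symmetric] overlap_def)
  also have "y * ?t i * (?s i * ?t i) = y * ?s i"
    using spin_csq2[OF i] by (simp add: mult_ac)
  finally show ?thesis by (simp add: algebra_simps add_divide_distrib)
qed

lemma sum_field_coeff_prod: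
  assumes i: "i < n"
  shows "(\<Sum>e\<in>site_pairs n. complex_of_real (field_coeff n \<sigma> i e) * of_real (field_coeff n \<tau> i e))
      = (overlap\<^sub>c n \<sigma> \<tau> - of_real (\<sigma> i * \<tau> i)) / of_nat n"
proof -
  let ?s = "\<lambda>i. complex_of_real (\<sigma> i)" and ?t = "\<lambda>i. complex_of_real (\<tau> i)"
  let ?F = "\<lambda>k (e :: nat \<times> nat). ?s k * ?t k / of_nat n"
  have "(\<Sum>e\<in>site_pairs n. complex_of_real (field_coeff n \<sigma> i e) * of_real (field_coeff n \<tau> i e))
      = (\<Sum>e\<in>site_pairs n. if fst e = i then ?F (snd e) e else if snd e = i then ?F (fst e) e else 0)"
    by (intro sum.cong) (auto simp: field_coeff_def sqrt_n_sq)
  also have "\<dots> = (\<Sum>k\<in>{..<n} - {i}. ?s k * ?t k / of_nat n)"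
    by (rule sum_site_pairs_at[OF i])
  also have "\<dots> = (overlap\<^sub>c n \<sigma> \<tau> - of_real (\<sigma> i * \<tau> i)) / of_nat n"
    using n_nonzero by (simp add: sum_except[OF i] sum_divide_distrib[symmetric] overlap_def diff_divide_distrib)
  finally show ?thesis .
qed

lemma sum_pair_coeff:
  "(\<Sum>e\<in>site_pairs n. pair_coeff n \<sigma> \<tau> x y e * of_real (g e))
      = x * of_real (sk_ham n g \<sigma>) + y * of_real (sk_ham n g \<tau>)"
  unfolding pair_coeff_def sk_ham_def by (simp add: sum_distrib_left sum.distrib[symmetric])
      (intro sum.cong; simp add: algebra_simps)

end

section \<open>Two-replica integrals over the disorder\<close>

lemma pair_coeff_swap: "pair_coeff n \<sigma> \<tau> x y = pair_coeff n \<tau> \<sigma> y x"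
  by (auto simp: pair_coeff_def fun_eq_iff)

lemma overlap_commute: "overlap n \<sigma> \<tau> = overlap n \<tau> \<sigma>"
  by (simp add: overlap_def mult.commute)

lemma of_real_local_field:
  "i < n \<Longrightarrow> complex_of_real (local_field n g \<sigma> i) = (\<Sum>e\<in>site_pairs n. of_real (field_coeff n \<sigma> i e) * of_real (g e))"
  by (simp add: local_field_eq)

lemma disorder_eq: "disorder n = gauss_measure (site_pairs n)"
  by (simp add: disorder_def gauss_measure_def)

definition pair_weight :: "nat \<Rightarrow> (nat \<Rightarrow> real) \<Rightarrow> (nat \<Rightarrow> real) \<Rightarrow> complex \<Rightarrow> complex \<Rightarrow> (nat \<times> nat \<Rightarrow> real) \<Rightarrow> complex" where
  "pair_weight n \<sigma> \<tau> x y g =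
    exp (- (x\<^sup>2 * (of_nat n - 1) / 4)) / 2 ^ n * exp (x * of_real (sk_ham n g \<sigma>))
    * (exp (- (y\<^sup>2 * (of_nat n - 1) / 4)) / 2 ^ n * exp (y * of_real (sk_ham n g \<tau>)))"

lemma sk_avg_mult:
  "sk_avg n x g F * sk_avg n y g G
    = (\<Sum>\<sigma>\<in>spin_configs n. \<Sum>\<tau>\<in>spin_configs n. F \<sigma> * G \<tau> * pair_weight n \<sigma> \<tau> x y g)"
  unfolding sk_avg_def sum_product pair_weight_def by (simp add: mult_ac)

text \<open>The disorder expectation of \<open>pair_weight\<close>: a Curie--Weiss weight in the
  overlap, depending on the two temperatures only through \<open>b = x * y\<close>.\<close>

definition cw_weight :: "nat \<Rightarrow> (nat \<Rightarrow> real) \<Rightarrow> (nat \<Rightarrow> real) \<Rightarrow> complex \<Rightarrow> complex" where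
  "cw_weight n \<sigma> \<tau> b = exp (b * ((overlap\<^sub>c n \<sigma> \<tau>)\<^sup>2 / of_nat n - 1) / 2) / (2 ^ n * 2 ^ n)"

context
  fixes n :: nat and \<sigma> \<tau> :: "nat \<Rightarrow> real" and x y :: complex
  assumes n: "n \<ge> 1" and \<sigma>: "\<sigma> \<in> spin_configs n" and \<tau>: "\<tau> \<in> spin_configs n"
begin

lemma pair_weight_eq:
  "pair_weight n \<sigma> \<tau> x y g = exp (- (x\<^sup>2 * (of_nat n - 1) / 4)) * exp (- (y\<^sup>2 * (of_nat n - 1) / 4)) / (2 ^ n * 2 ^ n)
    * exp (\<Sum>e\<in>site_pairs n. pair_coeff n \<sigma> \<tau> x y e * of_real (g e))"
  unfolding pair_weight_def sum_pair_coeff[OF n \<sigma> \<tau>] by (simp add: exp_add mult_ac)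

lemma cw_weight_eq:
  "exp (- (x\<^sup>2 * (of_nat n - 1) / 4)) * exp (- (y\<^sup>2 * (of_nat n - 1) / 4)) / (2 ^ n * 2 ^ n)
    * exp ((\<Sum>e\<in>site_pairs n. (pair_coeff n \<sigma> \<tau> x y e)\<^sup>2) / 2) = cw_weight n \<sigma> \<tau> (x * y)"
  unfolding sum_pair_coeff_square[OF n \<sigma> \<tau>] cw_weight_def
  by (simp add: mult_exp_exp ring_distribs add_divide_distrib diff_divide_distrib)

lemma integral_pair_weight: "has_bochner_integral (disorder n) (pair_weight n \<sigma> \<tau> x y) (cw_weight n \<sigma> \<tau> (x * y))"
  unfolding pair_weight_eq[abs_def] disorder_eq cw_weight_eq[symmetric]
  by (intro has_bochner_integral_mult_right has_bochner_integral_gauss_exp finite_site_pairs)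

lemma integral_pair_weight_linear:
  fixes a :: "nat \<times> nat \<Rightarrow> complex"
  shows "has_bochner_integral (disorder n) (\<lambda>g. (\<Sum>e\<in>site_pairs n. a e * of_real (g e)) * pair_weight n \<sigma> \<tau> x y g)
    ((\<Sum>e\<in>site_pairs n. a e * pair_coeff n \<sigma> \<tau> x y e) * cw_weight n \<sigma> \<tau> (x * y))"
  unfolding pair_weight_eq[abs_def] disorder_eq cw_weight_eq[symmetric]
  by (subst (1 2) mult.left_commute)
     (intro has_bochner_integral_mult_right has_bochner_integral_gauss_linear_exp finite_site_pairs)

lemma integral_pair_weight_linear2:
  fixes a :: "nat \<times> nat \<Rightarrow> complex"
  shows "has_bochner_integral (disorder n) (\<lambda>g. ((\<Sum>e\<in>site_pairs n. a e * of_real (g e))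
      * (\<Sum>e\<in>site_pairs n. b e * of_real (g e))) * pair_weight n \<sigma> \<tau> x y g)
    (((\<Sum>e\<in>site_pairs n. a e * pair_coeff n \<sigma> \<tau> x y e) * (\<Sum>e\<in>site_pairs n. b e * pair_coeff n \<sigma> \<tau> x y e)
      + (\<Sum>e\<in>site_pairs n. a e * b e)) * cw_weight n \<sigma> \<tau> (x * y))"
  unfolding pair_weight_eq[abs_def] disorder_eq cw_weight_eq[symmetric]
  by (subst (1 2) mult.left_commute)
     (intro has_bochner_integral_mult_right has_bochner_integral_gauss_linear2_exp finite_site_pairs)

text \<open>The mean of the local field of the first (second) replica after the disorder is tilted
  by the two-replica weight, that is, its covariance with the exponent.\<close>

definition "mean_field\<^sub>1 i = x * of_real (\<sigma> i) + y * (overlap\<^sub>c n \<sigma> \<tau> / of_nat n) * of_real (\<tau> i) - (x + y)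
    * of_real (\<sigma> i) / of_nat n"
definition "mean_field\<^sub>2 i = y * of_real (\<tau> i) + x * (overlap\<^sub>c n \<sigma> \<tau> / of_nat n) * of_real (\<sigma> i) - (x + y)
    * of_real (\<tau> i) / of_nat n"

lemma integral_field1:
  assumes "i < n"
  shows "has_bochner_integral (disorder n) (\<lambda>g. of_real (local_field n g \<sigma> i) * pair_weight n \<sigma> \<tau> x y g)
      (mean_field\<^sub>1 i * cw_weight n \<sigma> \<tau> (x * y))"
  using integral_pair_weight_linear[of "\<lambda>e. of_real (field_coeff n \<sigma> i e)"] assms
  by (simp add: of_real_local_field sum_field_coeff_pair_coeff[OF n \<sigma> \<tau>] mean_field\<^sub>1_def)

lemma sum_field_coeff_pair_coeff2:
  assumes "i < n"
  shows "(\<Sum>e\<in>site_pairs n. of_real (field_coeff n \<tau> i e) * pair_coeff n \<sigma> \<tau> x y e) = mean_field\<^sub>2 i"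
  using assms
  by (simp add: pair_coeff_swap[of n \<sigma>] sum_field_coeff_pair_coeff[OF n \<tau> \<sigma>] mean_field\<^sub>2_def overlap_commute add.commute)

lemma integral_field2:
  assumes "i < n"
  shows "has_bochner_integral (disorder n) (\<lambda>g. of_real (local_field n g \<tau> i) * pair_weight n \<sigma> \<tau> x y g)
      (mean_field\<^sub>2 i * cw_weight n \<sigma> \<tau> (x * y))"
  using integral_pair_weight_linear[of "\<lambda>e. of_real (field_coeff n \<tau> i e)"] assms
  by (simp add: of_real_local_field sum_field_coeff_pair_coeff2)

lemma integral_field12:
  assumes "i < n"
  shows "has_bochner_integral (disorder n)
    (\<lambda>g. (of_real (local_field n g \<sigma> i) * of_real (local_field n g \<tau> i)) * pair_weight n \<sigma> \<tau> x y g)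
    ((mean_field\<^sub>1 i * mean_field\<^sub>2 i + (overlap\<^sub>c n \<sigma> \<tau> - of_real (\<sigma> i * \<tau> i)) / of_nat n) * cw_weight n \<sigma> \<tau>
        (x * y))"
  using integral_pair_weight_linear2[of "\<lambda>e. of_real (field_coeff n \<sigma> i e)" "\<lambda>e. of_real (field_coeff n \<tau> i e)"] assms
  by (simp add: of_real_local_field sum_field_coeff_pair_coeff[OF n \<sigma> \<tau>] sum_field_coeff_pair_coeff2
      mean_field\<^sub>1_def sum_field_coeff_prod[OF n \<sigma> \<tau>])

definition "mean_resid\<^sub>1 i = (1 + x\<^sup>2) * of_real (\<sigma> i) - x * mean_field\<^sub>1 i"
definition "mean_resid\<^sub>2 i = (1 + y\<^sup>2) * of_real (\<tau> i) - y * mean_field\<^sub>2 i"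

lemma integral_resid1:
  assumes "i < n"
  shows "has_bochner_integral (disorder n) (\<lambda>g. resid_vec n x g \<sigma> i * pair_weight n \<sigma> \<tau> x y g)
      (mean_resid\<^sub>1 i * cw_weight n \<sigma> \<tau> (x * y))"
proof -
  let ?w = "cw_weight n \<sigma> \<tau> (x * y)"
  have "has_bochner_integral (disorder n) (\<lambda>g. (1 + x\<^sup>2) * of_real (\<sigma> i) * pair_weight n \<sigma> \<tau> x y g
      - x * (of_real (local_field n g \<sigma> i) * pair_weight n \<sigma> \<tau> x y g))
      ((1 + x\<^sup>2) * of_real (\<sigma> i) * ?w - x * (mean_field\<^sub>1 i * ?w))"
    by (intro has_bochner_integral_diff has_bochner_integral_mult_right integral_field1 integral_pair_weight assms)
  then show ?thesis by (simp add: resid_vec_def mean_resid\<^sub>1_def algebra_simps)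
qed

lemma integral_resid2:
  assumes "i < n"
  shows "has_bochner_integral (disorder n) (\<lambda>g. resid_vec n y g \<tau> i * pair_weight n \<sigma> \<tau> x y g)
      (mean_resid\<^sub>2 i * cw_weight n \<sigma> \<tau> (x * y))"
proof -
  let ?w = "cw_weight n \<sigma> \<tau> (x * y)"
  have "has_bochner_integral (disorder n) (\<lambda>g. (1 + y\<^sup>2) * of_real (\<tau> i) * pair_weight n \<sigma> \<tau> x y g
      - y * (of_real (local_field n g \<tau> i) * pair_weight n \<sigma> \<tau> x y g))
      ((1 + y\<^sup>2) * of_real (\<tau> i) * ?w - y * (mean_field\<^sub>2 i * ?w))"
    by (intro has_bochner_integral_diff has_bochner_integral_mult_right integral_field2 integral_pair_weight assms)
  then show ?thesis by (simp add: resid_vec_def mean_resid\<^sub>2_def algebra_simps)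
qed

text \<open>The product of the mean residuals is corrected by one contraction, the covariance of the
  local fields of the two replicas at the same site.\<close>

lemma integral_resid12:
  assumes "i < n"
  shows "has_bochner_integral (disorder n) (\<lambda>g. (resid_vec n x g \<sigma> i * resid_vec n y g \<tau> i) * pair_weight n \<sigma> \<tau> x y g)
    ((mean_resid\<^sub>1 i * mean_resid\<^sub>2 i + x * y * ((overlap\<^sub>c n \<sigma> \<tau> - of_real (\<sigma> i * \<tau> i)) / of_nat n))
        * cw_weight n \<sigma> \<tau> (x * y))"
proof -
  let ?R = "overlap\<^sub>c n \<sigma> \<tau>" and ?w = "cw_weight n \<sigma> \<tau> (x * y)"
  let ?a = "(1 + x\<^sup>2) * of_real (\<sigma> i)" and ?b = "(1 + y\<^sup>2) * of_real (\<tau> i)"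
  let ?f = "\<lambda>g. complex_of_real (local_field n g \<sigma> i)" and ?h = "\<lambda>g. complex_of_real (local_field n g \<tau> i)"
  let ?P = "pair_weight n \<sigma> \<tau> x y"
  have "has_bochner_integral (disorder n) (\<lambda>g. ?a * ?b * ?P g - ?a * y * (?h g * ?P g) - ?b * x * (?f g * ?P g)
        + x * y * ((?f g * ?h g) * ?P g))
      (?a * ?b * ?w - ?a * y * (mean_field\<^sub>2 i * ?w) - ?b * x * (mean_field\<^sub>1 i * ?w)
        + x * y * ((mean_field\<^sub>1 i * mean_field\<^sub>2 i + (?R - of_real (\<sigma> i * \<tau> i)) / of_nat n) * ?w))"
    by (intro has_bochner_integral_add has_bochner_integral_diff has_bochner_integral_mult_right
        integral_field1 integral_field2 integral_field12 integral_pair_weight assms)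
  then show ?thesis by (simp add: resid_vec_def mean_resid\<^sub>1_def mean_resid\<^sub>2_def algebra_simps)
qed

text \<open>The bilinear Hilbert--Schmidt pairing of the residual matrices of the two replicas with
  the sum over \<open>j\<close> already carried out, which leaves one factor of the overlap.\<close>

definition resid_pair :: "(nat \<times> nat \<Rightarrow> real) \<Rightarrow> complex" where
  "resid_pair g = overlap\<^sub>c n \<sigma> \<tau> * (\<Sum>i<n. resid_vec n x g \<sigma> i * resid_vec n y g \<tau> i)
    - (\<Sum>i<n. of_real (\<sigma> i) * resid_vec n x g \<sigma> i) - (\<Sum>i<n. of_real (\<tau> i) * resid_vec n y g \<tau> i) + of_nat n"

lemma sum_resid_prod:
  "(\<Sum>i<n. \<Sum>j<n. resid n x g \<sigma> i j * resid n y g \<tau> i j) = resid_pair g"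
proof -
  have "(\<Sum>j<n. resid n x g \<sigma> i j * resid n y g \<tau> i j)
      = overlap\<^sub>c n \<sigma> \<tau> * (resid_vec n x g \<sigma> i * resid_vec n y g \<tau> i) - of_real (\<sigma> i) * resid_vec n x g \<sigma> i
        - of_real (\<tau> i) * resid_vec n y g \<tau> i + 1" if "i < n" for i
  proof -
    have "(\<Sum>j<n. resid n x g \<sigma> i j * resid n y g \<tau> i j)
        = (\<Sum>j<n. (resid_vec n x g \<sigma> i * resid_vec n y g \<tau> i) * of_real (\<sigma> j * \<tau> j)
          + (if i = j then 1 - of_real (\<sigma> i) * resid_vec n x g \<sigma> i - of_real (\<tau> i) * resid_vec n y g \<tau> i else 0))"
      by (intro sum.cong) (auto simp: resid_def algebra_simps)
    also have "\<dots> = (resid_vec n x g \<sigma> i * resid_vec n y g \<tau> i) * overlap\<^sub>c n \<sigma> \<tau>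
        + (1 - of_real (\<sigma> i) * resid_vec n x g \<sigma> i - of_real (\<tau> i) * resid_vec n y g \<tau> i)"
      using that by (simp add: sum.distrib sum_distrib_left overlap_def)
    finally show ?thesis by simp
  qed
  then show ?thesis
    by (simp add: resid_pair_def sum.distrib sum_subtractf sum_distrib_left)
qed

text \<open>Grouped by order in \<open>n\<close>, with the squared overlap over \<open>n\<close> in
  the role of \<open>s\<close>: the leading term is the expression of Stein's inequality at
  \<open>b = x * y\<close>, which is why its average can be controlled.\<close>

definition "resid_moment = of_nat n * ((overlap\<^sub>c n \<sigma> \<tau>)\<^sup>2 / of_nat n * (1 - x * y) - 1) +
    (overlap\<^sub>c n \<sigma> \<tau>)\<^sup>2 / of_nat n * ((1 - x * y) * (x + y)\<^sup>2 + x * y)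
    + (x * y)\<^sup>2 * ((overlap\<^sub>c n \<sigma> \<tau>)\<^sup>2 / of_nat n)\<^sup>2 - (x + y)\<^sup>2 + (overlap\<^sub>c n \<sigma> \<tau>)\<^sup>2 / of_nat n * (x * y) *
      (x + y)\<^sup>2 / of_nat n"

text \<open>Once the squares of the spins are replaced by 1, the mean residuals enter only through
  the overlap, and everything becomes a rational identity. The terms of order \<open>n\<close>
  combine into \<open>n * (s * (1 - x * y) - 1)\<close>: the squared overlap gets the factor
  \<open>1 - x * y\<close>, and the identity parts contribute \<open>- 2 * n + n\<close>.\<close>

lemma integral_resid_pair:
  "has_bochner_integral (disorder n) (\<lambda>g. resid_pair g * pair_weight n \<sigma> \<tau> x y g)
      (resid_moment * cw_weight n \<sigma> \<tau> (x * y))"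
proof -
  let ?R = "overlap\<^sub>c n \<sigma> \<tau>" and ?w = "cw_weight n \<sigma> \<tau> (x * y)" and ?N = "of_nat n :: complex"
  let ?P = "pair_weight n \<sigma> \<tau> x y"
  let ?s = "\<lambda>i. complex_of_real (\<sigma> i)" and ?t = "\<lambda>i. complex_of_real (\<tau> i)"
  let ?b = "x * y" and ?e1 = "x * (x + y) / ?N" and ?e2 = "y * (x + y) / ?N"
  have nz: "?N \<noteq> 0" using n by simp
  have ss: "?s i * ?s i = 1" and tt: "?t i * ?t i = 1" if "i < n" for i
    using spin_csq1[OF n \<sigma> \<tau> that] spin_csq2[OF n \<sigma> \<tau> that] by auto
  have int: "has_bochner_integral (disorder n) (\<lambda>g. ?R * (\<Sum>i<n. (resid_vec n x g \<sigma> i * resid_vec n y g \<tau> i) * ?P g)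
      - (\<Sum>i<n. ?s i * (resid_vec n x g \<sigma> i * ?P g)) - (\<Sum>i<n. ?t i * (resid_vec n y g \<tau> i * ?P g)) + ?N * ?P g)
      (?R * (\<Sum>i<n. (mean_resid\<^sub>1 i * mean_resid\<^sub>2 i + x * y * ((?R - of_real (\<sigma> i * \<tau> i)) / ?N)) * ?w)
      - (\<Sum>i<n. ?s i * (mean_resid\<^sub>1 i * ?w)) - (\<Sum>i<n. ?t i * (mean_resid\<^sub>2 i * ?w)) + ?N * ?w)"
    by (intro has_bochner_integral_add has_bochner_integral_diff has_bochner_integral_mult_right has_bochner_integral_sum
        integral_resid1 integral_resid2 integral_resid12 integral_pair_weight) auto
  have sumS: "(\<Sum>i<n. ?s i * ?t i) = ?R" by (simp add: overlap_def)
  \<comment> \<open>Here the coefficient \<open>1 + x\<^sup>2\<close> pays off: the replica's own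
    contribution to its mean field cancels \<open>x\<^sup>2\<close>, leaving
    \<open>\<sigma> i\<close> up to order \<open>1 / n\<close> and a coupling to the other replica
    proportional to the overlap.\<close>
  have r1: "mean_resid\<^sub>1 i = (1 + ?e1) * ?s i - ?b * (?R / ?N) * ?t i" for i
    using nz by (simp add: mean_resid\<^sub>1_def mean_field\<^sub>1_def field_simps power2_eq_square)
  have r2: "mean_resid\<^sub>2 i = (1 + ?e2) * ?t i - ?b * (?R / ?N) * ?s i" for i
    using nz by (simp add: mean_resid\<^sub>2_def mean_field\<^sub>2_def field_simps power2_eq_square)
  have "(\<Sum>i<n. mean_resid\<^sub>1 i * mean_resid\<^sub>2 i + x * y * ((?R - of_real (\<sigma> i * \<tau> i)) / ?N))
      = (\<Sum>i<n. ((1 + ?e1) * (1 + ?e2) + ?b\<^sup>2 * (?R / ?N)\<^sup>2 - ?b / ?N) * (?s i * ?t i)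
          + (?b * (?R / ?N) - ?b * (?R / ?N) * (1 + ?e1) - ?b * (?R / ?N) * (1 + ?e2)))"
  proof (intro sum.cong refl)
    fix i assume i: "i \<in> {..<n}"
    have "mean_resid\<^sub>1 i * mean_resid\<^sub>2 i = ((1 + ?e1) * (1 + ?e2) + ?b\<^sup>2 * (?R / ?N)\<^sup>2) * (?s i * ?t i)
        - ?b * (?R / ?N) * (1 + ?e1) * (?s i * ?s i) - ?b * (?R / ?N) * (1 + ?e2) * (?t i * ?t i)"
    proof -
      have poly: "((1 + e1) * s - b * r * t) * ((1 + e2) * t - b * r * s)
          = ((1 + e1) * (1 + e2) + b\<^sup>2 * r\<^sup>2) * (s * t) - b * r * (1 + e1) * (s * s) - b * r * (1 + e2) * (t * t)"
        for e1 e2 b r s t :: complex by (simp add: algebra_simps power2_eq_square)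
      show ?thesis unfolding r1 r2 by (rule poly)
    qed
    moreover have "m + b * ((r - q) / k) = (A - b / k) * q + (b * (r / k) - c1 - c2)"
      if "m = A * q - c1 * 1 - c2 * 1" for m b r q k A c1 c2 :: complex
      using that by (simp add: algebra_simps diff_divide_distrib)
    ultimately show "mean_resid\<^sub>1 i * mean_resid\<^sub>2 i + x * y * ((?R - of_real (\<sigma> i * \<tau> i)) / ?N)
        = ((1 + ?e1) * (1 + ?e2) + ?b\<^sup>2 * (?R / ?N)\<^sup>2 - ?b / ?N) * (?s i * ?t i)
          + (?b * (?R / ?N) - ?b * (?R / ?N) * (1 + ?e1) - ?b * (?R / ?N) * (1 + ?e2))"
      using i by (simp only: ss tt lessThan_iff of_real_mult)
  qed
  also have "\<dots> = ((1 + ?e1) * (1 + ?e2) + ?b\<^sup>2 * (?R / ?N)\<^sup>2 - ?b / ?N) * ?R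
      + ?N * (?b * (?R / ?N) - ?b * (?R / ?N) * (1 + ?e1) - ?b * (?R / ?N) * (1 + ?e2))"
    unfolding sum.distrib sum_distrib_left[symmetric] sumS by simp
  finally have m12: "(\<Sum>i<n. mean_resid\<^sub>1 i * mean_resid\<^sub>2 i + x * y * ((?R - of_real (\<sigma> i * \<tau> i)) / ?N)) = \<dots>" .
  have "(\<Sum>i<n. ?s i * mean_resid\<^sub>1 i) = (\<Sum>i<n. (1 + ?e1) - ?b * (?R / ?N) * (?s i * ?t i))"
  proof (intro sum.cong refl)
    fix i assume i: "i \<in> {..<n}"
    have "?s i * mean_resid\<^sub>1 i = (1 + ?e1) * (?s i * ?s i) - ?b * (?R / ?N) * (?s i * ?t i)"
      unfolding r1 by (simp add: algebra_simps)
    then show "?s i * mean_resid\<^sub>1 i = (1 + ?e1) - ?b * (?R / ?N) * (?s i * ?t i)"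
      using i ss by simp
  qed
  also have "\<dots> = ?N * (1 + ?e1) - ?b * (?R / ?N) * ?R"
    unfolding sum_subtractf sum_distrib_left[symmetric] sumS by simp
  finally have m1: "(\<Sum>i<n. ?s i * mean_resid\<^sub>1 i) = \<dots>" .
  have "(\<Sum>i<n. ?t i * mean_resid\<^sub>2 i) = (\<Sum>i<n. (1 + ?e2) - ?b * (?R / ?N) * (?s i * ?t i))"
  proof (intro sum.cong refl)
    fix i assume i: "i \<in> {..<n}"
    have "?t i * mean_resid\<^sub>2 i = (1 + ?e2) * (?t i * ?t i) - ?b * (?R / ?N) * (?s i * ?t i)"
      unfolding r2 by (simp add: algebra_simps)
    then show "?t i * mean_resid\<^sub>2 i = (1 + ?e2) - ?b * (?R / ?N) * (?s i * ?t i)"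
      using i tt by simp
  qed
  also have "\<dots> = ?N * (1 + ?e2) - ?b * (?R / ?N) * ?R"
    unfolding sum_subtractf sum_distrib_left[symmetric] sumS by simp
  finally have m2: "(\<Sum>i<n. ?t i * mean_resid\<^sub>2 i) = \<dots>" .
  have "?R * (((1 + ?e1) * (1 + ?e2) + ?b\<^sup>2 * (?R / ?N)\<^sup>2 - ?b / ?N) * ?R
      + ?N * (?b * (?R / ?N) - ?b * (?R / ?N) * (1 + ?e1) - ?b * (?R / ?N) * (1 + ?e2)))
      - (?N * (1 + ?e1) - ?b * (?R / ?N) * ?R) - (?N * (1 + ?e2) - ?b * (?R / ?N) * ?R) + ?N
        = resid_moment" (is "?lhs = _")
    using nz by (simp add: resid_moment_def field_simps power2_eq_square)
  then have "(?R * (\<Sum>i<n. (mean_resid\<^sub>1 i * mean_resid\<^sub>2 i + x * y * ((?R - of_real (\<sigma> i * \<tau> i)) / ?N)) * ?w)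
      - (\<Sum>i<n. ?s i * (mean_resid\<^sub>1 i * ?w)) - (\<Sum>i<n. ?t i * (mean_resid\<^sub>2 i * ?w)) + ?N * ?w) = resid_moment * ?w"
  proof -
    have d: "a * (m * v) - p * v - q * v + c * v = (a * m - p - q + c) * v" for a m p q c v :: complex
      by (simp add: algebra_simps)
    have e1: "(\<Sum>i<n. ?s i * (mean_resid\<^sub>1 i * v)) = (\<Sum>i<n. ?s i * mean_resid\<^sub>1 i) * v"
      and e2: "(\<Sum>i<n. ?t i * (mean_resid\<^sub>2 i * v)) = (\<Sum>i<n. ?t i * mean_resid\<^sub>2 i) * v" for v
      by (simp_all only: sum_distrib_right mult.assoc)
    assume eq: "?lhs = resid_moment"
    show ?thesis
      unfolding e1 e2 sum_distrib_right[symmetric] m12 m1 m2 d eq ..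
  qed
  moreover have "?R * (\<Sum>i<n. (resid_vec n x g \<sigma> i * resid_vec n y g \<tau> i) * ?P g)
      - (\<Sum>i<n. ?s i * (resid_vec n x g \<sigma> i * ?P g)) - (\<Sum>i<n. ?t i * (resid_vec n y g \<tau> i * ?P g)) + ?N * ?P g
      = resid_pair g * ?P g" for g
    unfolding resid_pair_def
    by (simp add: sum_distrib_right[symmetric] mult.assoc[symmetric] ring_distribs)
  ultimately show ?thesis using int by simp
qed

end

section \<open>Second moments of the partition function, the correlations and the error
  matrix\<close>

definition "sk_Z n x g = sk_avg n x g (\<lambda>_. 1)"
definition "sk_Q n x g i j = sk_avg n x g (\<lambda>\<sigma>. of_real (\<sigma> i) * of_real (\<sigma> j))"
definition "sk_Y n x g i j = sk_avg n x g (\<lambda>\<sigma>. resid n x g \<sigma> i j)"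

text \<open>Disorder and spins are real, so a squared modulus at temperature \<open>x\<close> is a
  product of two replica sums at \<open>x\<close> and \<open>cnj x\<close>. The product of the two
  temperatures is then \<open>|x|\<^sup>2\<close>.\<close>

lemma cnj_sk_avg: "cnj (sk_avg n x g F) = sk_avg n (cnj x) g (\<lambda>\<sigma>. cnj (F \<sigma>))"
  unfolding sk_avg_def by (simp add: exp_cnj)

lemma cnj_sk_Z: "cnj (sk_Z n x g) = sk_Z n (cnj x) g"
  by (simp add: sk_Z_def cnj_sk_avg)

lemma cnj_sk_Q: "cnj (sk_Q n x g i j) = sk_Q n (cnj x) g i j"
  by (simp add: sk_Q_def cnj_sk_avg)

lemma cnj_sk_Y: "cnj (sk_Y n x g i j) = sk_Y n (cnj x) g i j"
  by (simp add: sk_Y_def cnj_sk_avg resid_def resid_vec_def if_distrib cong: if_cong)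

text \<open>\<open>K\<close> is the two-replica observable before, and \<open>T\<close> after,
  integration over the disorder. As \<open>T\<close> sees only the squared overlap, the gauge
  transformation makes the inner sum independent of \<open>\<sigma>\<close>.\<close>

lemma integral_sum_pairs:
  assumes "\<And>\<sigma> \<tau>. \<sigma> \<in> spin_configs n \<Longrightarrow> \<tau> \<in> spin_configs n \<Longrightarrow>
    has_bochner_integral (disorder n) (\<lambda>g. K \<sigma> \<tau> g * pair_weight n \<sigma> \<tau> x (cnj x) g)
      (complex_of_real (T ((overlap n \<sigma> \<tau>)\<^sup>2 / real n)) * cw_weight n \<sigma> \<tau> (x * cnj x))"
    and f: "\<And>g. complex_of_real (f g) = (\<Sum>\<sigma>\<in>spin_configs n. \<Sum>\<tau>\<in>spin_configs n. K \<sigma> \<tau> g * pair_weight n \<sigma> \<tau> x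
        (cnj x) g)"
  shows "has_bochner_integral (disorder n) f (cw_mean n (\<lambda>s. T s * exp ((cmod x)\<^sup>2 * (s - 1) / 2)))"
proof -
  let ?C = "spin_configs n"
  let ?F = "\<lambda>s. T s * exp ((cmod x)\<^sup>2 * (s - 1) / 2)"
  have "has_bochner_integral (disorder n) (\<lambda>g. complex_of_real (f g))
      (\<Sum>\<sigma>\<in>?C. \<Sum>\<tau>\<in>?C.
        complex_of_real (T ((overlap n \<sigma> \<tau>)\<^sup>2 / real n)) * cw_weight n \<sigma> \<tau> (x * cnj x))"
    unfolding f by (intro has_bochner_integral_sum assms(1))
  also have "(\<Sum>\<sigma>\<in>?C. \<Sum>\<tau>\<in>?C.
        complex_of_real (T ((overlap n \<sigma> \<tau>)\<^sup>2 / real n)) * cw_weight n \<sigma> \<tau> (x * cnj x))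
      = complex_of_real (\<Sum>\<sigma>\<in>?C. \<Sum>\<tau>\<in>?C. ?F ((overlap n \<sigma> \<tau>)\<^sup>2 / real n) / (2 ^ n * 2 ^ n))"
    by (simp add: cw_weight_def complex_norm_square[symmetric] exp_of_real[symmetric] mult.commute[of x])
  also have "(\<Sum>\<sigma>\<in>?C. \<Sum>\<tau>\<in>?C. ?F ((overlap n \<sigma> \<tau>)\<^sup>2 / real n) / (2 ^ n * 2 ^ n))
      = (\<Sum>\<sigma>\<in>?C. cw_mean n ?F / 2 ^ n)"
  proof (intro sum.cong refl)
    fix \<sigma> assume "\<sigma> \<in> ?C"
    from sum_spin_configs_gauge[OF this, of "\<lambda>S. ?F (S\<^sup>2 / real n) / (2 ^ n * 2 ^ n)"]
    show "(\<Sum>\<tau>\<in>?C. ?F ((overlap n \<sigma> \<tau>)\<^sup>2 / real n) / (2 ^ n * 2 ^ n)) = cw_mean n ?F / 2 ^ n"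
      unfolding overlap_def cw_mean_def by (simp add: sum_divide_distrib)
  qed
  also have "\<dots> = cw_mean n ?F" by (simp add: card_spin_configs)
  finally have "has_bochner_integral (disorder n) (\<lambda>g. Re (complex_of_real (f g)))
      (Re (complex_of_real (cw_mean n ?F)))"
    by (rule has_bochner_integral_bounded_linear[OF bounded_linear_Re])
  then show ?thesis by simp
qed

lemma integral_sk_Z:
  assumes "n \<ge> 1"
  shows "has_bochner_integral (disorder n) (\<lambda>g. (cmod (sk_Z n x g))\<^sup>2)
      (cw_mean n (\<lambda>s. 1 * exp ((cmod x)\<^sup>2 * (s - 1) / 2)))"
proof (rule integral_sum_pairs[where K = "\<lambda>\<sigma> \<tau> g. 1"])
  let ?C = "spin_configs n"
  show "has_bochner_integral (disorder n) (\<lambda>g. 1 * pair_weight n \<sigma> \<tau> x (cnj x) g)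
      (complex_of_real 1 * cw_weight n \<sigma> \<tau> (x * cnj x))"
    if "\<sigma> \<in> ?C" "\<tau> \<in> ?C" for \<sigma> \<tau>
    using integral_pair_weight[OF assms that] by simp
  show "complex_of_real ((cmod (sk_Z n x g))\<^sup>2) = (\<Sum>\<sigma>\<in>?C. \<Sum>\<tau>\<in>?C. 1 * pair_weight n \<sigma> \<tau> x (cnj x) g)" for g
    unfolding complex_norm_square cnj_sk_Z by (simp add: sk_Z_def sk_avg_mult)
qed

lemma complex_norm_square_sum2:
  "complex_of_real (\<Sum>i\<in>A. \<Sum>j\<in>B. (cmod (f i j))\<^sup>2) = (\<Sum>i\<in>A. \<Sum>j\<in>B. f i j * cnj (f i j))"
  unfolding of_real_sum complex_norm_square ..

text \<open>The Hilbert--Schmidt pairing of two spin matrices is the squared overlap, hence the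
  factor \<open>n * s\<close>. This bound of order \<open>n\<close> serves the gradient of the free
  energy, not the operator norm.\<close>

lemma integral_sk_Q:
  assumes "n \<ge> 1"
  shows "has_bochner_integral (disorder n) (\<lambda>g. \<Sum>i<n. \<Sum>j<n. (cmod (sk_Q n x g i j))\<^sup>2)
    (cw_mean n (\<lambda>s. (real n * s) * exp ((cmod x)\<^sup>2 * (s - 1) / 2)))"
proof (rule integral_sum_pairs[where K = "\<lambda>\<sigma> \<tau> g. (overlap\<^sub>c n \<sigma> \<tau>)\<^sup>2"])
  let ?C = "spin_configs n"
  show "has_bochner_integral (disorder n) (\<lambda>g. (overlap\<^sub>c n \<sigma> \<tau>)\<^sup>2 * pair_weight n \<sigma> \<tau> x (cnj x) g)
      (complex_of_real (real n * ((overlap n \<sigma> \<tau>)\<^sup>2 / real n)) * cw_weight n \<sigma> \<tau> (x * cnj x))"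
    if "\<sigma> \<in> ?C" "\<tau> \<in> ?C" for \<sigma> \<tau>
    using has_bochner_integral_mult_right[OF integral_pair_weight[OF assms that], of "(overlap\<^sub>c n \<sigma> \<tau>)\<^sup>2"] assms
        by simp
  show "complex_of_real (\<Sum>i<n. \<Sum>j<n. (cmod (sk_Q n x g i j))\<^sup>2)
      = (\<Sum>\<sigma>\<in>?C. \<Sum>\<tau>\<in>?C. (overlap\<^sub>c n \<sigma> \<tau>)\<^sup>2 * pair_weight n \<sigma> \<tau> x (cnj x) g)" for g
  proof -
    have "complex_of_real (\<Sum>i<n. \<Sum>j<n. (cmod (sk_Q n x g i j))\<^sup>2)
        = (\<Sum>i<n. \<Sum>j<n. \<Sum>\<sigma>\<in>?C. \<Sum>\<tau>\<in>?C.
            of_real (\<sigma> i) * of_real (\<sigma> j) * (of_real (\<tau> i) * of_real (\<tau> j)) * pair_weight n \<sigma> \<tau> x (cnj x) g)"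
      unfolding complex_norm_square_sum2 cnj_sk_Q unfolding sk_Q_def sk_avg_mult ..
    also have "\<dots> = (\<Sum>\<sigma>\<in>?C. \<Sum>\<tau>\<in>?C. \<Sum>i<n. \<Sum>j<n.
            of_real (\<sigma> i) * of_real (\<sigma> j) * (of_real (\<tau> i) * of_real (\<tau> j)) * pair_weight n \<sigma> \<tau> x (cnj x) g)"
      by (simp only: sum.swap[of _ "?C" "{..<n}"])
    also have "\<dots> = (\<Sum>\<sigma>\<in>?C. \<Sum>\<tau>\<in>?C. (overlap\<^sub>c n \<sigma> \<tau>)\<^sup>2 * pair_weight n \<sigma> \<tau> x (cnj x) g)"
    proof (intro sum.cong refl)
      fix \<sigma> \<tau> :: "nat \<Rightarrow> real"
      have "(\<Sum>i<n. \<Sum>j<n. of_real (\<sigma> i) * of_real (\<sigma> j) * (of_real (\<tau> i) * of_real (\<tau> j)) * pair_weight n \<sigma> \<tau> x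
          (cnj x) g)
          = (\<Sum>i<n. \<Sum>j<n. complex_of_real (\<sigma> i * \<tau> i) * complex_of_real (\<sigma> j * \<tau> j)) * pair_weight n \<sigma> \<tau> x (cnj x) g"
        unfolding sum_distrib_right by (intro sum.cong refl) (simp add: mult_ac)
      also have "\<dots> = (overlap\<^sub>c n \<sigma> \<tau>)\<^sup>2 * pair_weight n \<sigma> \<tau> x (cnj x) g"
        unfolding overlap_def power2_eq_square of_real_sum sum_product ..
      finally show "(\<Sum>i<n. \<Sum>j<n. of_real (\<sigma> i) * of_real (\<sigma> j) * (of_real (\<tau> i) * of_real (\<tau> j))
          * pair_weight n \<sigma> \<tau> x (cnj x) g) = \<dots>" .
    qed
    finally show ?thesis .
  qed
qed

definition resid_moment_real :: "nat \<Rightarrow> complex \<Rightarrow> real \<Rightarrow> real" where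
  "resid_moment_real n x s = real n * (s * (1 - (cmod x)\<^sup>2) - 1) + s * ((1 - (cmod x)\<^sup>2) * (2 * Re x)\<^sup>2 + (cmod x)\<^sup>2)
    + ((cmod x)\<^sup>2)\<^sup>2 * s\<^sup>2 - (2 * Re x)\<^sup>2 + s * (cmod x)\<^sup>2 * (2 * Re x)\<^sup>2 / real n"

lemma resid_moment_eq:
  assumes "n \<ge> 1" "\<sigma> \<in> spin_configs n" "\<tau> \<in> spin_configs n"
  shows "resid_moment n \<sigma> \<tau> x (cnj x) = of_real (resid_moment_real n x ((overlap n \<sigma> \<tau>)\<^sup>2 / real n))"
proof -
  have 1: "x * cnj x = complex_of_real ((cmod x)\<^sup>2)" by (simp only: complex_norm_square)
  have 2: "x + cnj x = complex_of_real (2 * Re x)" by (simp add: complex_add_cnj)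
  show ?thesis
    unfolding resid_moment_def[OF assms] resid_moment_real_def 1 2 by simp
qed

lemma integral_sk_Y:
  assumes "n \<ge> 1"
  shows "has_bochner_integral (disorder n) (\<lambda>g. \<Sum>i<n. \<Sum>j<n. (cmod (sk_Y n x g i j))\<^sup>2)
    (cw_mean n (\<lambda>s. resid_moment_real n x s * exp ((cmod x)\<^sup>2 * (s - 1) / 2)))"
proof (rule integral_sum_pairs[where K = "\<lambda>\<sigma> \<tau>. resid_pair n \<sigma> \<tau> x (cnj x)"])
  let ?C = "spin_configs n"
  show "has_bochner_integral (disorder n) (\<lambda>g. resid_pair n \<sigma> \<tau> x (cnj x) g * pair_weight n \<sigma> \<tau> x (cnj x) g)
      (complex_of_real (resid_moment_real n x ((overlap n \<sigma> \<tau>)\<^sup>2 / real n)) * cw_weight n \<sigma> \<tau> (x * cnj x))"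
    if "\<sigma> \<in> ?C" "\<tau> \<in> ?C" for \<sigma> \<tau>
    using integral_resid_pair[OF assms that, of x "cnj x"] unfolding resid_moment_eq[OF assms that] .
  show "complex_of_real (\<Sum>i<n. \<Sum>j<n. (cmod (sk_Y n x g i j))\<^sup>2)
      = (\<Sum>\<sigma>\<in>?C. \<Sum>\<tau>\<in>?C. resid_pair n \<sigma> \<tau> x (cnj x) g * pair_weight n \<sigma> \<tau> x (cnj x) g)" for g
  proof -
    have "complex_of_real (\<Sum>i<n. \<Sum>j<n. (cmod (sk_Y n x g i j))\<^sup>2)
        = (\<Sum>i<n. \<Sum>j<n. \<Sum>\<sigma>\<in>?C. \<Sum>\<tau>\<in>?C.
            resid n x g \<sigma> i j * resid n (cnj x) g \<tau> i j * pair_weight n \<sigma> \<tau> x (cnj x) g)"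
      unfolding complex_norm_square_sum2 cnj_sk_Y unfolding sk_Y_def sk_avg_mult ..
    also have "\<dots> = (\<Sum>\<sigma>\<in>?C. \<Sum>\<tau>\<in>?C. \<Sum>i<n. \<Sum>j<n.
            resid n x g \<sigma> i j * resid n (cnj x) g \<tau> i j * pair_weight n \<sigma> \<tau> x (cnj x) g)"
      by (simp only: sum.swap[of _ "?C" "{..<n}"])
    also have "\<dots> = (\<Sum>\<sigma>\<in>?C. \<Sum>\<tau>\<in>?C. resid_pair n \<sigma> \<tau> x (cnj x) g * pair_weight n \<sigma> \<tau> x (cnj x) g)"
      by (intro sum.cong refl) (simp add: sum_resid_prod[OF assms] sum_distrib_right[symmetric])
    finally show ?thesis .
  qed
qed

text \<open>The coefficient \<open>c\<close> is 0 or 1 in the applications and switches on a term of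
  order \<open>n\<close> whose average has a sign by Stein's inequality, so the bound depends on
  \<open>n\<close> only through \<open>a\<close>. The shift from \<open>s\<close> to
  \<open>s - 1\<close> costs a factor at most 1.\<close>

lemma cw_mean_shifted_exp_le:
  assumes "0 \<le> b" "b < 1" "n \<ge> 1" "0 \<le> a" "\<And>s. 0 \<le> s \<Longrightarrow> T s
      \<le> real n * (s * (1 - b) - 1) * c + a * (1 + s + s\<^sup>2)" "c \<ge> 0"
  shows "cw_mean n (\<lambda>s. T s * exp (b * (s - 1) / 2)) \<le> a * (64 / (1 - b) ^ 3)"
proof -
  have e: "exp (b * (s - 1) / 2) = exp (- (b / 2)) * exp (b * s / 2)" for s :: real
    by (simp add: mult_exp_exp field_simps)
  have "cw_mean n (\<lambda>s. T s * exp (b * (s - 1) / 2))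
      \<le> cw_mean n (\<lambda>s. exp (- (b / 2)) *
        (real n * c * ((s * (1 - b) - 1) * exp (b * s / 2)) + a * ((1 + s + s\<^sup>2) * exp (b * s / 2))))"
  proof (rule cw_mean_mono)
    fix s :: real assume "0 \<le> s"
    have "T s * exp (b * (s - 1) / 2) \<le> (real n * (s * (1 - b) - 1) * c + a * (1 + s + s\<^sup>2)) * exp (b * (s - 1) / 2)"
      by (intro mult_right_mono assms(5) \<open>0 \<le> s\<close>) simp
    also have "\<dots> = exp (- (b / 2)) * (real n * c * ((s * (1 - b) - 1) * exp (b * s / 2)) + a *
        ((1 + s + s\<^sup>2) * exp (b * s / 2)))"
      unfolding e by (simp add: algebra_simps)
    finally show "T s * exp (b * (s - 1) / 2) \<le> \<dots>" .
  qed
  also have "\<dots> = exp (- (b / 2)) * (real n * c * cw_mean n (\<lambda>s. (s * (1 - b) - 1) * exp (b * s / 2))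
      + a * cw_mean n (\<lambda>s. (1 + s + s\<^sup>2) * exp (b * s / 2)))"
    unfolding cw_mean_cmult cw_mean_add ..
  also have "\<dots> \<le> exp (- (b / 2)) * (0 + a * (64 / (1 - b) ^ 3))"
    using assms cw_mean_stein[of b n] cw_mean_poly_exp_le[of b n]
    by (intro mult_left_mono add_mono) (auto simp: mult_nonneg_nonpos)
  also have "\<dots> \<le> 1 * (0 + a * (64 / (1 - b) ^ 3))"
    using assms by (intro mult_right_mono) auto
  finally show ?thesis by simp
qed

lemma integral_sk_Z_le:
  assumes "n \<ge> 1" "cmod x < 1"
  shows "(\<integral>g. (cmod (sk_Z n x g))\<^sup>2 \<partial>disorder n) \<le> 64 / (1 - (cmod x)\<^sup>2) ^ 3"
proof -
  have "(cmod x)\<^sup>2 < 1" using assms by (simp add: power_less_one_iff)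
  then have "cw_mean n (\<lambda>s. 1 * exp ((cmod x)\<^sup>2 * (s - 1) / 2)) \<le> 1 * (64 / (1 - (cmod x)\<^sup>2) ^ 3)"
    using assms by (intro cw_mean_shifted_exp_le[where c = 0]) auto
  then show ?thesis
    using integral_sk_Z[OF assms(1), of x] by (simp add: has_bochner_integral_iff)
qed

lemma integral_sk_Q_le:
  assumes "n \<ge> 1" "cmod x < 1"
  shows "(\<integral>g. (\<Sum>i<n. \<Sum>j<n. (cmod (sk_Q n x g i j))\<^sup>2) \<partial>disorder n) \<le> real n * (64 / (1 - (cmod x)\<^sup>2) ^ 3)"
proof -
  have "(cmod x)\<^sup>2 < 1" using assms by (simp add: power_less_one_iff)
  then have "cw_mean n (\<lambda>s. (real n * s) * exp ((cmod x)\<^sup>2 * (s - 1) / 2)) \<le> real n * (64 / (1 - (cmod x)\<^sup>2) ^ 3)"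
    using assms by (intro cw_mean_shifted_exp_le[where c = 0]) (auto intro!: mult_left_mono)
  then show ?thesis
    using integral_sk_Q[OF assms(1), of x] by (simp add: has_bochner_integral_iff)
qed

text \<open>The leading term \<open>n * (s * (1 - b) - 1)\<close> of the residual moment is of order \<open>n\<close> pointwise, but its average
  is nonpositive by \<open>cw_mean_stein\<close>.\<close>

lemma integral_sk_Y_le:
  assumes "n \<ge> 1" "cmod x < 1"
  shows "(\<integral>g. (\<Sum>i<n. \<Sum>j<n. (cmod (sk_Y n x g i j))\<^sup>2) \<partial>disorder n) \<le> 9 * (64 / (1 - (cmod x)\<^sup>2) ^ 3)"
proof -
  let ?b = "(cmod x)\<^sup>2" and ?p = "(2 * Re x)\<^sup>2"
  have b: "?b < 1" "0 \<le> ?b" using assms by (auto simp: power_less_one_iff)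
  have p: "0 \<le> ?p" "?p \<le> 4"
  proof -
    have "\<bar>2 * Re x\<bar> \<le> 2" using assms abs_Re_le_cmod[of x] by simp
    then have "\<bar>2 * Re x\<bar>\<^sup>2 \<le> 2\<^sup>2" by (intro power_mono) auto
    then show "?p \<le> 4" by simp
  qed simp
  have "cw_mean n (\<lambda>s. resid_moment_real n x s * exp (?b * (s - 1) / 2)) \<le> 9 * (64 / (1 - ?b) ^ 3)"
  proof (rule cw_mean_shifted_exp_le[where c = 1])
    fix s :: real assume s: "0 \<le> s"
    have "(1 - ?b) * ?p + ?b \<le> 1 * 4 + 1" using b p by (intro add_mono mult_mono) auto
    then have "s * ((1 - ?b) * ?p + ?b) \<le> 5 * s" using s mult_left_mono[of _ 5 s] by (simp add: mult.commute[of s 5])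
    moreover have "?b\<^sup>2 * s\<^sup>2 \<le> s\<^sup>2"
      using mult_right_mono[OF power_le_one[OF b(2) less_imp_le[OF b(1)], of 2], of "s\<^sup>2"] by simp
    moreover have "s * ?b * ?p / real n \<le> 4 * s"
    proof -
      have "s * ?b * ?p / real n \<le> s * 1 * 4 / 1"
        using b p s assms by (intro frac_le mult_mono) auto
      then show ?thesis by simp
    qed
    \<comment> \<open>The terms linear in \<open>s\<close> have coefficients at most 5 and 4, using
      \<open>(2 * Re x)\<^sup>2 \<le> 4\<close>; this is the constant 9. The quadratic coefficient
      is at most 1, and the remaining term is negative.\<close>
    moreover have gen: "A + B + C - P + D \<le> A * 1 + 9 * (1 + s + q)"
      if "B \<le> 5 * s" "C \<le> q" "D \<le> 4 * s" "0 \<le> s" "0 \<le> q" "0 \<le> P" for A B C D P q :: real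
      using that by (simp add: distrib_left)
    ultimately show "resid_moment_real n x s \<le> real n * (s * (1 - ?b) - 1) * 1 + 9 * (1 + s + s\<^sup>2)"
      using gen[OF _ _ _ s zero_le_power2 p(1)] unfolding resid_moment_real_def by blast
  qed (use assms b in auto)
  then show ?thesis
    using integral_sk_Y[OF assms(1), of x] by (simp add: has_bochner_integral_iff)
qed

section \<open>From second moments to the operator norm\<close>

text \<open>On the circle \<open>|z| = r\<close> one has \<open>|z\<^sup>2 - r\<^sup>2| = 2 * r * |Im z|\<close>, while \<open>z + 1 / z\<close> has imaginary part
  \<open>Im z * (1 - 1 / r\<^sup>2)\<close>. Since \<open>A\<close> is real symmetric, its resolvent at \<open>z + 1 / z\<close> is bounded by the
  inverse of the latter, which \<open>z\<^sup>2 - r\<^sup>2\<close> compensates.\<close>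

lemma symmetric_resolvent_bound:
  fixes A :: "nat \<Rightarrow> nat \<Rightarrow> real" and q v :: "nat \<Rightarrow> complex" and z :: complex
  assumes sym: "\<And>i k. A i k = A k i"
    and eq: "\<And>i. i < n \<Longrightarrow> (1 + z\<^sup>2) * q i - z * (\<Sum>k<n. of_real (A i k) * q k) = v i"
    and r: "cmod z = r" "0 < r" "r < 1"
  shows "cmod (z\<^sup>2 - (of_real r)\<^sup>2) * L2_set (\<lambda>i. cmod (q i)) {..<n}
      \<le> 2 * r\<^sup>2 / (1 - r\<^sup>2) * L2_set (\<lambda>i. cmod (v i)) {..<n}"
proof -
  let ?nq = "L2_set (\<lambda>i. cmod (q i)) {..<n}" and ?nv = "L2_set (\<lambda>i. cmod (v i)) {..<n}"
  have z0: "z \<noteq> 0" using r by auto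
  have zz: "z * cnj z = of_real (r\<^sup>2)" using r by (simp add: complex_norm_square[symmetric])
  have r2: "r\<^sup>2 < 1" using r by (simp add: power_less_one_iff)
  \<comment> \<open>The quadratic form of \<open>A\<close> at \<open>q\<close>; it is real because
    \<open>A\<close> is real and symmetric.\<close>
  define a where "a = (\<Sum>i<n. \<Sum>k<n. cnj (q i) * (of_real (A i k) * q k))"
  have "cnj a = (\<Sum>i<n. \<Sum>k<n. q i * (of_real (A i k) * cnj (q k)))" by (simp add: a_def)
  also have "\<dots> = (\<Sum>k<n. \<Sum>i<n. q i * (of_real (A i k) * cnj (q k)))" by (rule sum.swap)
  also have "\<dots> = a" unfolding a_def by (intro sum.cong refl) (simp add: sym mult_ac)
  finally have a: "Im a = 0" by (metis Reals_cnj_iff complex_is_Real_iff)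
  have nq: "(\<Sum>i<n. cnj (q i) * q i) = of_real (?nq\<^sup>2)"
    unfolding L2_set_def by (simp add: sum_nonneg complex_norm_square[symmetric] mult.commute[of "cnj _"])
  have "(\<Sum>i<n. cnj (q i) * v i) = (\<Sum>i<n. cnj (q i) * ((1 + z\<^sup>2) * q i - z * (\<Sum>k<n. of_real (A i k) * q k)))"
    using eq by simp
  also have "\<dots> = (1 + z\<^sup>2) * (\<Sum>i<n. cnj (q i) * q i) - z * a"
    unfolding a_def by (simp add: right_diff_distrib sum_subtractf sum_distrib_left mult_ac)
  finally have qv: "(\<Sum>i<n. cnj (q i) * v i) = (1 + z\<^sup>2) * (\<Sum>i<n. cnj (q i) * q i) - z * a" .
  \<comment> \<open>Multiplying by \<open>cnj z\<close> turns the factor of \<open>a\<close> into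
    the real number \<open>r\<^sup>2\<close>, so \<open>A\<close> disappears from the imaginary
    part.\<close>
  have "cnj z * ((1 + z\<^sup>2) * w - z * a) = (cnj z + (z * cnj z) * z) * w - (z * cnj z) * a" for w
    by (simp add: algebra_simps power2_eq_square)
  then have "cnj z * (\<Sum>i<n. cnj (q i) * v i) = (cnj z + (z * cnj z) * z) * of_real (?nq\<^sup>2) - (z * cnj z) * a"
    unfolding qv nq by blast
  then have "Im (cnj z * (\<Sum>i<n. cnj (q i) * v i))
      = Im ((cnj z + of_real (r\<^sup>2) * z) * of_real (?nq\<^sup>2) - of_real (r\<^sup>2) * a)"
    unfolding zz by (rule arg_cong)
  also have "\<dots> = - Im z * (1 - r\<^sup>2) * ?nq\<^sup>2" by (simp add: a algebra_simps)
  finally have "\<bar>Im z\<bar> * (1 - r\<^sup>2) * ?nq\<^sup>2 = \<bar>Im (cnj z * (\<Sum>i<n. cnj (q i) * v i))\<bar>"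
    using r2 by (simp add: abs_mult)
  also have "\<dots> \<le> cmod (cnj z * (\<Sum>i<n. cnj (q i) * v i))" by (rule abs_Im_le_cmod)
  also have "\<dots> = r * cmod (\<Sum>i<n. cnj (q i) * v i)" using r by (simp add: norm_mult)
  also have "cmod (\<Sum>i<n. cnj (q i) * v i) \<le> (\<Sum>i<n. \<bar>cmod (q i)\<bar> * \<bar>cmod (v i)\<bar>)"
    by (rule order_trans[OF norm_sum]) (simp add: norm_mult)
  also have "\<dots> \<le> ?nq * ?nv" by (rule L2_set_mult_ineq)
  finally have 1: "\<bar>Im z\<bar> * (1 - r\<^sup>2) * ?nq\<^sup>2 \<le> r * (?nq * ?nv)" using r by (simp add: mult_left_mono)
  have 2: "\<bar>Im z\<bar> * (1 - r\<^sup>2) * ?nq \<le> r * ?nv"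
  proof (cases "?nq = 0")
    case False
    then have "?nq > 0" by (simp add: less_le)
    then show ?thesis using 1 by (simp add: power2_eq_square mult.left_commute[of _ ?nq])
  qed (use r in simp)
  have "z\<^sup>2 - (of_real r)\<^sup>2 = z * (z - cnj z)"
    using zz by (simp add: power2_eq_square right_diff_distrib)
  then have "cmod (z\<^sup>2 - (of_real r)\<^sup>2) = r * (2 * \<bar>Im z\<bar>)"
    using r by (simp add: norm_mult complex_diff_cnj)
  then have "cmod (z\<^sup>2 - (of_real r)\<^sup>2) * ?nq = 2 * r / (1 - r\<^sup>2) * (\<bar>Im z\<bar> * (1 - r\<^sup>2) * ?nq)"
    using r2 by simp
  also have "\<dots> \<le> 2 * r / (1 - r\<^sup>2) * (r * ?nv)"
    using 2 r r2 by (intro mult_left_mono) auto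
  finally show ?thesis by (simp add: power2_eq_square)
qed

text \<open>Cauchy's integral formula with the kernel estimated by the distance \<open>r - b\<close>
  from the point to the circle.\<close>

lemma cauchy_circle_bound:
  assumes f: "f holomorphic_on UNIV" and b: "0 \<le> b" "b < r"
  shows "cmod (f (of_real b)) \<le> r / (r - b) * integral {0..1}
      (\<lambda>t. cmod (f (of_real r * exp (2 * of_real pi * \<i> * of_real t))))"
proof -
  let ?e = "\<lambda>t. of_real r * exp (2 * of_real pi * \<i> * of_real t) :: complex"
  have cont: "continuous_on {0..1} (\<lambda>t. f (?e t))"
    by (intro continuous_on_compose2[OF holomorphic_on_imp_continuous_on[OF f]] continuous_intros) auto
  have ne: "?e t \<noteq> of_real b" for t
  proof
    assume "?e t = of_real b"
    then have "cmod (?e t) = cmod (of_real b :: complex)" by simp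
    then show False using b by (simp add: norm_mult)
  qed
  have "((\<lambda>u. f u / (u - of_real b)) has_contour_integral 2 * of_real pi * \<i> * f (of_real b)) (circlepath 0 r)"
    using b f by (intro Cauchy_integral_circlepath)
      (auto intro: holomorphic_on_imp_continuous_on holomorphic_on_subset)
  then have "((\<lambda>t. f (?e t) / (?e t - of_real b) * (2 * of_real pi * \<i> * ?e t)) has_integral 2 * of_real pi * \<i>
      * f (of_real b)) {0..1}"
    unfolding has_contour_integral vector_derivative_circlepath by (simp add: circlepath mult_ac)
  note int = this
  have bound: "cmod (f (?e t) / (?e t - of_real b) * (2 * of_real pi * \<i> * ?e t))
      \<le> 2 * pi * r / (r - b) * cmod (f (?e t))" for t
  proof -
    have "cmod (?e t) = r" using b by (simp add: norm_mult)
    moreover from this have "r - b \<le> cmod (?e t - of_real b)"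
      using norm_triangle_ineq2[of "?e t" "of_real b"] b by simp
    ultimately have "cmod (f (?e t)) * (2 * pi * r) / cmod (?e t - of_real b)
        \<le> cmod (f (?e t)) * (2 * pi * r) / (r - b)"
      using b order_less_le_trans[of 0 "r - b"] by (intro divide_left_mono mult_pos_pos) auto
    then show ?thesis using \<open>cmod (?e t) = r\<close> by (simp add: norm_mult norm_divide mult_ac)
  qed
  have "2 * pi * cmod (f (of_real b)) = cmod (2 * of_real pi * \<i> * f (of_real b))"
    by (simp add: norm_mult)
  also have "\<dots> \<le> integral {0..1} (\<lambda>t. 2 * pi * r / (r - b) * cmod (f (?e t)))"
    unfolding integral_unique[OF int, symmetric]
    by (intro integral_norm_bound_integral bound has_integral_integrable[OF int] integrable_continuous_real continuous_intros cont)
  also have "\<dots> = 2 * pi * (r / (r - b) * integral {0..1} (\<lambda>t. cmod (f (?e t))))" by simp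
  finally show ?thesis by (rule mult_left_le_imp_le) simp
qed

lemma L2_set_matrix_vector_le:
  fixes Y :: "nat \<Rightarrow> nat \<Rightarrow> complex" and x :: "nat \<Rightarrow> real"
  shows "L2_set (\<lambda>i. cmod (\<Sum>j<n. Y i j * of_real (x j))) {..<n}
      \<le> sqrt (\<Sum>i<n. \<Sum>j<n. (cmod (Y i j))\<^sup>2) * L2_set x {..<n}"
proof -
  have "L2_set (\<lambda>i. cmod (\<Sum>j<n. Y i j * of_real (x j))) {..<n}
      \<le> L2_set (\<lambda>i. L2_set (\<lambda>j. cmod (Y i j)) {..<n} * L2_set x {..<n}) {..<n}"
  proof (rule L2_set_mono)
    fix i
    have "cmod (\<Sum>j<n. Y i j * of_real (x j)) \<le> (\<Sum>j<n. \<bar>cmod (Y i j)\<bar> * \<bar>x j\<bar>)"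
      by (rule order_trans[OF norm_sum]) (simp add: norm_mult)
    also have "\<dots> \<le> L2_set (\<lambda>j. cmod (Y i j)) {..<n} * L2_set x {..<n}" by (rule L2_set_mult_ineq)
    finally show "cmod (\<Sum>j<n. Y i j * of_real (x j)) \<le> \<dots>" .
  qed simp
  also have "\<dots> = sqrt (\<Sum>i<n. \<Sum>j<n. (cmod (Y i j))\<^sup>2) * L2_set x {..<n}"
    by (simp add: L2_set_def power_mult_distrib sum_nonneg sum_distrib_right[symmetric] real_sqrt_mult)
  finally show ?thesis .
qed

text \<open>The constant has three sources: \<open>r / (r - b)\<close> from Cauchy's formula,
  \<open>2 * r\<^sup>2 / (1 - r\<^sup>2)\<close> from the resolvent bound, and
  \<open>1 / (r\<^sup>2 - b\<^sup>2)\<close> from the value of the multiplier at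
  \<open>b\<close>.\<close>

lemma op_norm_circle_bound:
  fixes Q Y :: "complex \<Rightarrow> nat \<Rightarrow> nat \<Rightarrow> complex" and Z :: "complex \<Rightarrow> complex" and A Q\<^sub>0 :: "nat \<Rightarrow> nat \<Rightarrow> real"
  assumes sym: "\<And>i k. A i k = A k i"
    and hol: "\<And>i j. (\<lambda>z. Q z i j) holomorphic_on UNIV"
    and cont: "continuous_on UNIV Z" "\<And>i j. continuous_on UNIV (\<lambda>z. Y z i j)"
    and eq: "\<And>z i j. i < n \<Longrightarrow> j < n \<Longrightarrow>
      (1 + z\<^sup>2) * Q z i j - z * (\<Sum>k<n. of_real (A i k) * Q z k j) = Y z i j + (if i = j then Z z else 0)"
    and Q\<^sub>0: "\<And>i j. Q (of_real b) i j = of_real (Q\<^sub>0 i j)"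
    and b: "0 \<le> b" "b < r" "r < 1"
  shows "op_norm n Q\<^sub>0 \<le> 2 * r ^ 3 / ((1 - r\<^sup>2) * (r - b) * (r\<^sup>2 - b\<^sup>2))
    * integral {0..1} (\<lambda>t. cmod (Z (of_real r * exp (2 * of_real pi * \<i> * of_real t)))
      + sqrt (\<Sum>i<n. \<Sum>j<n. (cmod (Y (of_real r * exp (2 * of_real pi * \<i> * of_real t)) i j))\<^sup>2))"
  unfolding op_norm_le_iff
proof (intro allI impI)
  fix x :: "nat \<Rightarrow> real" assume x: "L2_set x {..<n} \<le> 1"
  let ?e = "\<lambda>t. of_real r * exp (2 * of_real pi * \<i> * of_real t) :: complex"
  define W where "W z = cmod (Z z) + sqrt (\<Sum>i<n. \<Sum>j<n. (cmod (Y z i j))\<^sup>2)" for z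
  define p where "p i = (\<Sum>j<n. Q\<^sub>0 i j * x j)" for i
  define N where "N = L2_set p {..<n}"
  define q where "q z i = (\<Sum>j<n. Q z i j * of_real (x j))" for z i
  define v where "v z i = Z z * of_real (x i) * (if i < n then 1 else 0) + (\<Sum>j<n. Y z i j * of_real (x j))" for z i
  \<comment> \<open>Pairing with the fixed vector \<open>p\<close>, the image of \<open>x\<close>
    under \<open>Q\<^sub>0\<close>, gives a scalar entire function whose modulus at \<open>b\<close>
    is the squared norm of \<open>p\<close> up to the multiplier. The multiplier vanishes at
    \<open>r\<close> and \<open>- r\<close>, where the resolvent bound degenerates.\<close>
  define h where "h z = (z\<^sup>2 - (of_real r)\<^sup>2) * (\<Sum>i<n. of_real (p i) * q z i)" for z :: complex
  have r: "0 < r" "r\<^sup>2 < 1" "b\<^sup>2 < r\<^sup>2"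
    using b by (auto simp: power_less_one_iff intro: power_strict_mono)
  have N: "N \<ge> 0" by (simp add: N_def)
  have W: "W z \<ge> 0" for z by (auto simp: W_def intro!: add_nonneg_nonneg sum_nonneg)
  have hol_h: "h holomorphic_on UNIV"
    unfolding h_def q_def by (intro holomorphic_intros hol)
  have Wcont: "continuous_on {0..1} (\<lambda>t. W (?e t))"
    unfolding W_def
    by (intro continuous_intros continuous_on_compose2[OF cont(1)] continuous_on_compose2[OF cont(2)]) auto
  have eqv: "(1 + z\<^sup>2) * q z i - z * (\<Sum>k<n. of_real (A i k) * q z k) = v z i" if i: "i < n" for z i
  proof -
    have "(1 + z\<^sup>2) * q z i - z * (\<Sum>k<n. of_real (A i k) * q z k)
        = (\<Sum>j<n. ((1 + z\<^sup>2) * Q z i j - z * (\<Sum>k<n. of_real (A i k) * Q z k j)) * of_real (x j))"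
    proof -
      have "(\<Sum>k<n. of_real (A i k) * q z k) = (\<Sum>j<n. (\<Sum>k<n. of_real (A i k) * Q z k j) * of_real (x j))"
        unfolding q_def sum_distrib_left sum_distrib_right by (subst sum.swap) (simp add: mult_ac)
      moreover have "a * (\<Sum>j<n. f j * y j) - c * (\<Sum>j<n. T j * y j) = (\<Sum>j<n. (a * f j - c * T j) * y j)"
        for a c :: complex and f T y :: "nat \<Rightarrow> complex"
        by (simp add: sum_distrib_left sum_subtractf[symmetric] algebra_simps)
      ultimately show ?thesis unfolding q_def by simp
    qed
    also have "\<dots> = (\<Sum>j<n. Y z i j * of_real (x j) + (if i = j then Z z * of_real (x j) else 0))"
      using i by (intro sum.cong refl) (subst eq, auto simp: distrib_right)
    also have "\<dots> = v z i" using i by (simp add: v_def sum.distrib)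
    finally show ?thesis .
  qed
  have v: "L2_set (\<lambda>i. cmod (v z i)) {..<n} \<le> W z" for z
  proof -
    have "L2_set (\<lambda>i. cmod (v z i)) {..<n}
        \<le> L2_set (\<lambda>i. cmod (Z z) * \<bar>x i\<bar> + cmod (\<Sum>j<n. Y z i j * of_real (x j))) {..<n}"
      by (intro L2_set_mono) (auto simp: v_def norm_mult intro!: order_trans[OF norm_triangle_ineq])
    also have "\<dots> \<le> L2_set (\<lambda>i. cmod (Z z) * \<bar>x i\<bar>) {..<n} + L2_set (\<lambda>i. cmod (\<Sum>j<n. Y z i j * of_real (x j))) {..<n}"
      by (rule L2_set_triangle_ineq)
    also have "L2_set (\<lambda>i. cmod (Z z) * \<bar>x i\<bar>) {..<n} = cmod (Z z) * L2_set x {..<n}"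
      by (subst L2_set_right_distrib[symmetric]) (auto simp: L2_set_def)
    also have "cmod (Z z) * L2_set x {..<n} + L2_set (\<lambda>i. cmod (\<Sum>j<n. Y z i j * of_real (x j))) {..<n}
        \<le> cmod (Z z) * 1 + sqrt (\<Sum>i<n. \<Sum>j<n. (cmod (Y z i j))\<^sup>2) * 1"
      using x by (intro add_mono mult_left_mono order_trans[OF L2_set_matrix_vector_le]) (auto intro!: sum_nonneg)
    finally show ?thesis by (simp add: W_def)
  qed
  have h_circle: "cmod (h (?e t)) \<le> N * (2 * r\<^sup>2 / (1 - r\<^sup>2)) * W (?e t)" for t
  proof -
    let ?z = "?e t"
    have z: "cmod ?z = r" using r by (simp add: norm_mult)
    have "cmod (\<Sum>i<n. of_real (p i) * q ?z i) \<le> (\<Sum>i<n. \<bar>p i\<bar> * \<bar>cmod (q ?z i)\<bar>)"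
      by (rule order_trans[OF norm_sum]) (simp add: norm_mult)
    also have "\<dots> \<le> N * L2_set (\<lambda>i. cmod (q ?z i)) {..<n}" unfolding N_def by (rule L2_set_mult_ineq)
    finally have "cmod (h ?z) \<le> cmod (?z\<^sup>2 - (of_real r)\<^sup>2) * (N * L2_set (\<lambda>i. cmod (q ?z i)) {..<n})"
      unfolding h_def norm_mult by (intro mult_left_mono) auto
    also have "\<dots> = N * (cmod (?z\<^sup>2 - (of_real r)\<^sup>2) * L2_set (\<lambda>i. cmod (q ?z i)) {..<n})" by (simp only: mult_ac)
    also have "\<dots> \<le> N * (2 * r\<^sup>2 / (1 - r\<^sup>2) * L2_set (\<lambda>i. cmod (v ?z i)) {..<n})"
      using r b by (intro mult_left_mono N symmetric_resolvent_bound[OF sym eqv z]) auto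
    also have "\<dots> \<le> N * (2 * r\<^sup>2 / (1 - r\<^sup>2) * W ?z)"
      using r by (intro mult_left_mono N v) auto
    finally show ?thesis by (simp only: mult.assoc)
  qed
  have "h (of_real b) = of_real ((b\<^sup>2 - r\<^sup>2) * (\<Sum>i<n. p i * p i))"
    by (simp add: h_def q_def Q\<^sub>0 p_def)
  also have "(\<Sum>i<n. p i * p i) = N\<^sup>2" by (simp add: N_def L2_set_def sum_nonneg power2_eq_square)
  finally have hb: "h (of_real b) = of_real ((b\<^sup>2 - r\<^sup>2) * N\<^sup>2)" .
  have "cmod (h (of_real b)) = (r\<^sup>2 - b\<^sup>2) * N\<^sup>2"
    unfolding hb norm_of_real using r by (simp add: abs_mult)
  moreover have "cmod (h (of_real b)) \<le> r / (r - b) * integral {0..1} (\<lambda>t. cmod (h (?e t)))"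
    by (rule cauchy_circle_bound[OF hol_h b(1,2)])
  moreover have "\<dots> \<le> r / (r - b) * integral {0..1} (\<lambda>t. N * (2 * r\<^sup>2 / (1 - r\<^sup>2)) * W (?e t))"
    using r b h_circle Wcont
    by (intro mult_left_mono integral_le integrable_continuous_real continuous_intros
        continuous_on_compose2[OF holomorphic_on_imp_continuous_on[OF hol_h]]) auto
  ultimately have "(r\<^sup>2 - b\<^sup>2) * N\<^sup>2 \<le> r / (r - b) * (N * (2 * r\<^sup>2 / (1 - r\<^sup>2)) * integral {0..1} (\<lambda>t. W (?e t)))"
    by simp
  \<comment> \<open>One factor \<open>N\<close> is common to both sides and can be cancelled unless
    it is zero.\<close>
  then have main: "N * ((r\<^sup>2 - b\<^sup>2) * N) \<le> N * (r / (r - b) * (2 * r\<^sup>2 / (1 - r\<^sup>2) * integral {0..1} (\<lambda>t. W (?e t))))"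
    by (simp only: power2_eq_square mult_ac)
  have I: "integral {0..1} (\<lambda>t. W (?e t)) \<ge> 0"
    by (intro integral_nonneg integrable_continuous_real Wcont W)
  have "N \<le> r / (r - b) * (2 * r\<^sup>2 / (1 - r\<^sup>2) * integral {0..1} (\<lambda>t. W (?e t))) / (r\<^sup>2 - b\<^sup>2)"
  proof (cases "N = 0")
    case True
    then show ?thesis using r b I by (auto intro!: divide_nonneg_nonneg mult_nonneg_nonneg)
  next
    case False
    then have "N > 0" using N by simp
    from mult_left_le_imp_le[OF main this] show ?thesis
      using r by (intro mult_imp_le_div_pos) (simp_all only: mult.commute[of N] diff_gt_0_iff_gt)
  qed
  also have "\<dots> = 2 * r ^ 3 / ((1 - r\<^sup>2) * (r - b) * (r\<^sup>2 - b\<^sup>2)) * integral {0..1} (\<lambda>t. W (?e t))"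
    by (simp add: power2_eq_square power3_eq_cube mult_ac)
  finally show "L2_set (\<lambda>i. \<Sum>j<n. Q\<^sub>0 i j * x j) {..<n} \<le> 2 * r ^ 3 / ((1 - r\<^sup>2) * (r - b) * (r\<^sup>2 - b\<^sup>2))
    * integral {0..1} (\<lambda>t. cmod (Z (?e t)) + sqrt (\<Sum>i<n. \<Sum>j<n. (cmod (Y (?e t) i j))\<^sup>2))"
    by (simp only: W_def N_def p_def[abs_def])
qed

section \<open>Gaussian concentration for convex functions\<close>

lemma std_normal_density_rotate:
  assumes "c\<^sup>2 + s\<^sup>2 = 1"
  shows "std_normal_density (c * u - s * v) * std_normal_density (s * u + c * v)
      = std_normal_density u * std_normal_density v"
proof -
  have "(c * u - s * v)\<^sup>2 + (s * u + c * v)\<^sup>2 = (c\<^sup>2 + s\<^sup>2) * (u\<^sup>2 + v\<^sup>2)"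
    by (simp add: power2_eq_square algebra_simps)
  then have e: "- (c * u - s * v)\<^sup>2 / 2 + - (s * u + c * v)\<^sup>2 / 2 = - u\<^sup>2 / 2 + - v\<^sup>2 / 2"
    using assms by (simp add: field_simps)
  have *: "std_normal_density a * std_normal_density b = 1 / (2 * pi) * exp (- a\<^sup>2 / 2 + - b\<^sup>2 / 2)" for a b
    unfolding normal_density_def by (simp add: exp_add[symmetric])
  show ?thesis unfolding * e ..
qed

text \<open>The rotation is carried out by two one-dimensional affine substitutions:
  \<open>u = c * a + s * b\<close> at fixed \<open>b\<close>, then
  \<open>v = (b - s * u) / c\<close> at fixed \<open>u\<close>. Their Jacobians \<open>1 / c\<close>
  and \<open>c\<close> cancel, and only the rotation invariance of the product density
  enters.\<close>

lemma nn_integral_density_rotate: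
  fixes F :: "real \<Rightarrow> real \<Rightarrow> ennreal" and \<phi> :: "real \<Rightarrow> real"
  assumes [measurable]: "\<phi> \<in> borel_measurable borel" and \<phi>: "\<And>x. 0 \<le> \<phi> x"
    and rot: "\<And>u v. \<phi> (c * u - s * v) * \<phi> (s * u + c * v) = \<phi> u * \<phi> v"
    and sf: "sigma_finite_measure (density lborel \<phi>)"
    and cs: "c\<^sup>2 + s\<^sup>2 = 1" "c > 0" and [measurable]: "case_prod F \<in> borel_measurable (borel \<Otimes>\<^sub>M borel)"
  shows "(\<integral>\<^sup>+a. \<integral>\<^sup>+b. F (c * a + s * b) (c * b - s * a) \<partial>(density lborel \<phi>) \<partial>(density lborel \<phi>))
    = (\<integral>\<^sup>+a. \<integral>\<^sup>+b. F a b \<partial>(density lborel \<phi>) \<partial>(density lborel \<phi>))"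
proof -
  let ?D = "density lborel \<phi>"
  let ?\<phi> = "\<lambda>x. ennreal (\<phi> x)"
  interpret N: sigma_finite_measure "density lborel \<phi>" by (rule sf)
  have conv: "(\<integral>\<^sup>+a. \<integral>\<^sup>+b. G a b \<partial>?D \<partial>?D)
      = (\<integral>\<^sup>+a. \<integral>\<^sup>+b. ennreal (\<phi> a * \<phi> b) * G a b \<partial>lborel \<partial>lborel)"
    if [measurable]: "case_prod G \<in> borel_measurable (borel \<Otimes>\<^sub>M borel)" for G :: "real \<Rightarrow> real \<Rightarrow> ennreal"
  proof -
    have "(\<integral>\<^sup>+a. \<integral>\<^sup>+b. G a b \<partial>?D \<partial>?D)
        = (\<integral>\<^sup>+a. ?\<phi> a * (\<integral>\<^sup>+b. G a b \<partial>?D) \<partial>lborel)"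
      by (rule nn_integral_density) measurable
    also have "\<dots> = (\<integral>\<^sup>+a. ?\<phi> a * (\<integral>\<^sup>+b. ?\<phi> b * G a b \<partial>lborel) \<partial>lborel)"
      by (intro nn_integral_cong arg_cong2[where f = "(*)"] refl nn_integral_density) measurable
    also have "\<dots> = (\<integral>\<^sup>+a. \<integral>\<^sup>+b. ennreal (\<phi> a * \<phi> b) * G a b \<partial>lborel \<partial>lborel)"
    proof (intro nn_integral_cong)
      fix a
      have "?\<phi> a * (\<integral>\<^sup>+b. ?\<phi> b * G a b \<partial>lborel) = (\<integral>\<^sup>+b. ?\<phi> a * (?\<phi> b * G a b) \<partial>lborel)"
        by (rule nn_integral_cmult[symmetric]) measurable
      also have "\<dots> = (\<integral>\<^sup>+b. ennreal (\<phi> a * \<phi> b) * G a b \<partial>lborel)"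
        by (simp only: ennreal_mult \<phi> mult.assoc)
      finally show "?\<phi> a * (\<integral>\<^sup>+b. ?\<phi> b * G a b \<partial>lborel) = \<dots>" .
    qed
    finally show ?thesis .
  qed
  have e: "ennreal k * (ennreal a * X) = ennreal (k * a) * X" if "k \<ge> 0" for k a X
    using that by (simp add: ennreal_mult' mult.assoc)
  have c0: "c \<noteq> 0" using cs by simp
  have s2: "s * s = 1 - c * c" using cs by (simp add: power2_eq_square)
  have "(\<integral>\<^sup>+a. \<integral>\<^sup>+b. F (c * a + s * b) (c * b - s * a) \<partial>?D \<partial>?D)
      = (\<integral>\<^sup>+a. \<integral>\<^sup>+b. ennreal (\<phi> a * \<phi> b) * F (c * a + s * b) (c * b - s * a) \<partial>lborel \<partial>lborel)"
    by (rule conv) measurable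
  also have "\<dots> = (\<integral>\<^sup>+b. \<integral>\<^sup>+a. ennreal (\<phi> a * \<phi> b) * F (c * a + s * b) (c * b - s * a) \<partial>lborel \<partial>lborel)"
    by (rule lborel_pair.Fubini') measurable
  also have "\<dots> = (\<integral>\<^sup>+b. ennreal \<bar>1 / c\<bar> * (\<integral>\<^sup>+u. ennreal (\<phi> (- s * b / c + 1 / c * u) * \<phi> b)
      * F (c * (- s * b / c + 1 / c * u) + s * b) (c * b - s * (- s * b / c + 1 / c * u)) \<partial>lborel) \<partial>lborel)"
    using c0 by (intro nn_integral_cong nn_integral_real_affine) auto
  also have "\<dots> = (\<integral>\<^sup>+b. (\<integral>\<^sup>+u. ennreal (1 / c * (\<phi> ((u - s * b) / c) * \<phi> b))
      * F u ((b - s * u) / c) \<partial>lborel) \<partial>lborel)"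
  proof (intro nn_integral_cong)
    fix b
    have 1: "- s * b / c + 1 / c * u = (u - s * b) / c" "c * ((u - s * b) / c) + s * b = u"
      "c * b - s * ((u - s * b) / c) = (b - s * u) / c" for u
    proof -
      show "- s * b / c + 1 / c * u = (u - s * b) / c" by (simp add: diff_divide_distrib)
      show "c * ((u - s * b) / c) + s * b = u" using c0 by simp
      have "c * b - s * ((u - s * b) / c) = ((c * c + s * s) * b - s * u) / c" using c0 by (simp add: field_simps)
      then show "c * b - s * ((u - s * b) / c) = (b - s * u) / c" unfolding s2 by simp
    qed
    show "ennreal \<bar>1 / c\<bar> * (\<integral>\<^sup>+u. ennreal (\<phi> (- s * b / c + 1 / c * u) * \<phi> b)
      * F (c * (- s * b / c + 1 / c * u) + s * b) (c * b - s * (- s * b / c + 1 / c * u)) \<partial>lborel)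
      = (\<integral>\<^sup>+u. ennreal (1 / c * (\<phi> ((u - s * b) / c) * \<phi> b)) * F u ((b - s * u) / c) \<partial>lborel)"
      unfolding 1 using cs by (subst nn_integral_cmult[symmetric]) (auto simp: e intro!: nn_integral_cong)
  qed
  also have "\<dots> = (\<integral>\<^sup>+u. (\<integral>\<^sup>+b. ennreal (1 / c * (\<phi> ((u - s * b) / c) * \<phi> b))
      * F u ((b - s * u) / c) \<partial>lborel) \<partial>lborel)"
    by (rule lborel_pair.Fubini') measurable
  also have "\<dots> = (\<integral>\<^sup>+u. ennreal \<bar>c\<bar> * (\<integral>\<^sup>+v. ennreal (1 / c * (\<phi> ((u - s * (s * u + c * v)) / c) * \<phi> (s * u + c * v)))
      * F u ((s * u + c * v - s * u) / c) \<partial>lborel) \<partial>lborel)"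
    using c0 by (intro nn_integral_cong nn_integral_real_affine) auto
  also have "\<dots> = (\<integral>\<^sup>+u. \<integral>\<^sup>+v. ennreal (\<phi> u * \<phi> v) * F u v \<partial>lborel \<partial>lborel)"
  proof (intro nn_integral_cong)
    fix u
    have 1: "(u - s * (s * u + c * v)) / c = c * u - s * v" "(s * u + c * v - s * u) / c = v" for v
    proof -
      have "u - s * (s * u + c * v) = u - (s * s) * u - c * (s * v)" by (simp add: algebra_simps)
      also have "\<dots> = c * (c * u - s * v)" unfolding s2 by (simp add: algebra_simps)
      finally show "(u - s * (s * u + c * v)) / c = c * u - s * v" using c0 by simp
    qed (use c0 in simp)
    show "ennreal \<bar>c\<bar> * (\<integral>\<^sup>+v. ennreal (1 / c * (\<phi> ((u - s * (s * u + c * v)) / c) * \<phi> (s * u + c * v)))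
      * F u ((s * u + c * v - s * u) / c) \<partial>lborel) = (\<integral>\<^sup>+v. ennreal (\<phi> u * \<phi> v) * F u v \<partial>lborel)"
      unfolding 1 rot using cs
      by (subst nn_integral_cmult[symmetric])
          (auto simp: ennreal_mult \<phi> mult.assoc[symmetric] simp flip: ennreal_mult)
  qed
  also have "\<dots> = (\<integral>\<^sup>+a. \<integral>\<^sup>+b. F a b \<partial>?D \<partial>?D)"
    by (rule conv[symmetric]) measurable
  finally show ?thesis .
qed

lemma nn_integral_std_normal_rotate:
  fixes F :: "real \<Rightarrow> real \<Rightarrow> ennreal"
  assumes "c\<^sup>2 + s\<^sup>2 = 1" "c > 0" "case_prod F \<in> borel_measurable (borel \<Otimes>\<^sub>M borel)"
  shows "(\<integral>\<^sup>+a. \<integral>\<^sup>+b. F (c * a + s * b) (c * b - s * a) \<partial>std_normal_distribution \<partial>std_normal_distribution)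
    = (\<integral>\<^sup>+a. \<integral>\<^sup>+b. F a b \<partial>std_normal_distribution \<partial>std_normal_distribution)"
  by (rule nn_integral_density_rotate[OF _ _ std_normal_density_rotate[OF assms(1)] _ assms])
    (auto intro: prob_space_imp_sigma_finite[OF prob_space_std_normal])

definition lin_comb :: "'i set \<Rightarrow> real \<Rightarrow> real \<Rightarrow> ('i \<Rightarrow> real) \<Rightarrow> ('i \<Rightarrow> real) \<Rightarrow> 'i \<Rightarrow> real" where
  "lin_comb I a b x y = (\<lambda>i\<in>I. a * x i + b * y i)"

lemma measurable_gauss_component':
  "e \<in> I \<Longrightarrow> f \<in> measurable M (gauss_measure I) \<Longrightarrow> (\<lambda>x. f x e) \<in> borel_measurable M"
  by (rule measurable_compose[OF _ measurable_gauss_component])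

lemma measurable_into_gauss:
  assumes "\<And>i. i \<in> I \<Longrightarrow> (\<lambda>x. f x i) \<in> borel_measurable M" "\<And>x. x \<in> space M \<Longrightarrow> f x \<in> extensional I"
  shows "f \<in> measurable M (gauss_measure I)"
  unfolding gauss_measure_def using assms
  by (intro measurable_PiM_single') (auto simp: PiE_def)

lemma measurable_lin_comb [measurable (raw)]:
  assumes "f \<in> measurable M (gauss_measure I)" "g \<in> measurable M (gauss_measure I)"
  shows "(\<lambda>x. lin_comb I a b (f x) (g x)) \<in> measurable M (gauss_measure I)"
proof (rule measurable_into_gauss)
  fix i assume i: "i \<in> I"
  have [measurable]: "(\<lambda>x. f x i) \<in> borel_measurable M" "(\<lambda>x. g x i) \<in> borel_measurable M"
    using i by (rule measurable_gauss_component', intro assms)+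
  show "(\<lambda>x. lin_comb I a b (f x) (g x) i) \<in> borel_measurable M"
    unfolding lin_comb_def using i by simp
qed (simp add: lin_comb_def)

lemma measurable_gauss_upd:
  assumes [measurable]: "f \<in> measurable M (gauss_measure I)" "h \<in> borel_measurable M"
  shows "(\<lambda>x. (f x)(i := h x)) \<in> measurable M (gauss_measure (insert i I))"
proof (rule measurable_into_gauss)
  fix j assume "j \<in> insert i I"
  then show "(\<lambda>x. ((f x)(i := h x)) j) \<in> borel_measurable M"
    using measurable_gauss_component'[OF _ assms(1), of j] by (cases "j = i") auto
next
  fix x assume "x \<in> space M"
  then have "f x \<in> space (gauss_measure I)" by (rule measurable_space[OF assms(1)])
  then show "(f x)(i := h x) \<in> extensional (insert i I)"
    by (auto simp: gauss_measure_def space_PiM PiE_def extensional_def)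
qed

lemma sigma_finite_gauss: "sigma_finite_measure (gauss_measure I)"
  by (rule prob_space_imp_sigma_finite[OF prob_space_gauss])

lemma nn_integral_gauss_insert:
  assumes "finite I" "i \<notin> I" "f \<in> borel_measurable (gauss_measure (insert i I))"
  shows "(\<integral>\<^sup>+x. f x \<partial>gauss_measure (insert i I))
      = (\<integral>\<^sup>+x. \<integral>\<^sup>+t. f (x(i := t)) \<partial>std_normal_distribution \<partial>gauss_measure I)"
  using product_sigma_finite.product_nn_integral_insert[OF product_prob_space_std_normal assms[unfolded gauss_measure_def]]
  by (simp add: gauss_measure_def)

text \<open>Both fresh coordinates are moved innermost, so that a planar rotation can act on them
  while all others stay fixed.\<close>

lemma nn_integral_gauss_insert2:
  assumes I: "finite I" "i \<notin> I"
    and [measurable]: "case_prod F \<in> borel_measurable (gauss_measure (insert i I) \<Otimes>\<^sub>M gauss_measure (insert i I))"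
  shows "(\<integral>\<^sup>+x. \<integral>\<^sup>+y. F x y \<partial>gauss_measure (insert i I) \<partial>gauss_measure (insert i I))
    = (\<integral>\<^sup>+x. \<integral>\<^sup>+y. \<integral>\<^sup>+a. \<integral>\<^sup>+b. F (x(i := a)) (y(i := b)) \<partial>std_normal_distribution \<partial>std_normal_distribution
      \<partial>gauss_measure I \<partial>gauss_measure I)"
proof -
  let ?\<gamma> = "gauss_measure I" and ?J = "gauss_measure (insert i I)" and ?N = std_normal_distribution
  interpret J: sigma_finite_measure "?J" by (rule sigma_finite_gauss)
  interpret K: sigma_finite_measure "?\<gamma>" by (rule sigma_finite_gauss)
  interpret N: sigma_finite_measure "?N" by (rule prob_space_imp_sigma_finite[OF prob_space_std_normal])
  interpret P: pair_sigma_finite "?\<gamma>" "?N" ..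
  note [measurable] = measurable_gauss_upd
  have "(\<integral>\<^sup>+x. \<integral>\<^sup>+y. F x y \<partial>?J \<partial>?J)
      = (\<integral>\<^sup>+x. \<integral>\<^sup>+a. \<integral>\<^sup>+y. F (x(i := a)) y \<partial>?J \<partial>?N \<partial>?\<gamma>)"
    by (rule nn_integral_gauss_insert[OF I]) measurable
  also have "\<dots> = (\<integral>\<^sup>+x. \<integral>\<^sup>+a. \<integral>\<^sup>+y. \<integral>\<^sup>+b. F (x(i := a)) (y(i := b)) \<partial>?N \<partial>?\<gamma> \<partial>?N \<partial>?\<gamma>)"
  proof (intro nn_integral_cong nn_integral_gauss_insert[OF I])
    fix x a assume [measurable]: "x \<in> space (?\<gamma>)"
    have [measurable]: "x(i := a) \<in> space (?J)"
      using \<open>x \<in> space (?\<gamma>)\<close> by (auto simp: gauss_measure_def space_PiM PiE_def extensional_def)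
    show "(\<lambda>y. F (x(i := a)) y) \<in> borel_measurable (?J)" by measurable
  qed
  also have "\<dots> = (\<integral>\<^sup>+x. \<integral>\<^sup>+y. \<integral>\<^sup>+a. \<integral>\<^sup>+b. F (x(i := a)) (y(i := b)) \<partial>?N \<partial>?N \<partial>?\<gamma> \<partial>?\<gamma>)"
  proof (intro nn_integral_cong P.Fubini')
    fix x assume [measurable]: "x \<in> space (?\<gamma>)"
    show "(\<lambda>(y, a). \<integral>\<^sup>+b. F (x(i := a)) (y(i := b)) \<partial>?N) \<in> borel_measurable (?\<gamma> \<Otimes>\<^sub>M ?N)"
      by measurable
  qed
  finally show ?thesis .
qed

text \<open>The rotation acts in each coordinate pair separately, so the claim follows by induction
  on the index set from the planar case.\<close>

lemma nn_integral_gauss_rotate: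
  assumes "finite I" and cs: "c\<^sup>2 + s\<^sup>2 = 1" "c > 0"
    and "case_prod F \<in> borel_measurable (gauss_measure I \<Otimes>\<^sub>M gauss_measure I)"
  shows "(\<integral>\<^sup>+x. \<integral>\<^sup>+y. F (lin_comb I c s x y) (lin_comb I (- s) c x y) \<partial>gauss_measure I \<partial>gauss_measure I)
    = (\<integral>\<^sup>+x. \<integral>\<^sup>+y. F x y \<partial>gauss_measure I \<partial>gauss_measure I)"
  using assms(1,4)
proof (induction I arbitrary: F)
  case empty
  \<comment> \<open>Over the empty index set the space has a single point, the function with
    constant value \<open>undefined\<close>.\<close>
  have "lin_comb {} a b x y = (\<lambda>_. undefined)" for a b :: real and x y :: "'a \<Rightarrow> real"
    by (simp add: lin_comb_def restrict_def)
  moreover have "x = (\<lambda>_. undefined)" if "x \<in> space (gauss_measure {})" for x :: "'a \<Rightarrow> real"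
    using that by (simp add: gauss_measure_def space_PiM)
  ultimately show ?case by (intro nn_integral_cong arg_cong2[where f = F]) metis+
next
  case (insert i I)
  note [measurable] = measurable_gauss_upd insert.prems
  let ?\<gamma> = "gauss_measure I" and ?J = "gauss_measure (insert i I)" and ?N = std_normal_distribution
  have l: "lin_comb (insert i I) p q (x(i := a)) (y(i := b))
      = (lin_comb I p q x y)(i := p * a + q * b)" for p q x y a b
    using insert.hyps by (auto simp: lin_comb_def fun_eq_iff)
  interpret N: sigma_finite_measure std_normal_distribution by
      (rule prob_space_imp_sigma_finite[OF prob_space_std_normal])
  have "(\<integral>\<^sup>+x. \<integral>\<^sup>+y. F (lin_comb (insert i I) c s x y) (lin_comb (insert i I) (- s) c x y) \<partial>?J \<partial>?J)
      = (\<integral>\<^sup>+x. \<integral>\<^sup>+y. \<integral>\<^sup>+a. \<integral>\<^sup>+b. F (lin_comb (insert i I) c s (x(i := a)) (y(i := b)))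
        (lin_comb (insert i I) (- s) c (x(i := a)) (y(i := b))) \<partial>?N \<partial>?N \<partial>?\<gamma> \<partial>?\<gamma>)"
    by (rule nn_integral_gauss_insert2[OF insert.hyps(1,2)]) measurable
  also have "\<dots> = (\<integral>\<^sup>+x. \<integral>\<^sup>+y. \<integral>\<^sup>+a. \<integral>\<^sup>+b. F ((lin_comb I c s x y)(i := c * a + s * b))
      ((lin_comb I (- s) c x y)(i := c * b - s * a)) \<partial>?N \<partial>?N \<partial>?\<gamma> \<partial>?\<gamma>)"
    unfolding l by (simp add: add.commute[of "- (s * _)"])
  also have "\<dots> = (\<integral>\<^sup>+x. \<integral>\<^sup>+y. \<integral>\<^sup>+a. \<integral>\<^sup>+b. F ((lin_comb I c s x y)(i := a)) ((lin_comb I (- s) c x y)(i := b)) \<partial>?N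
      \<partial>?N \<partial>?\<gamma> \<partial>?\<gamma>)"
  proof (rule nn_integral_cong, rule nn_integral_cong, rule nn_integral_std_normal_rotate[OF cs])
    fix x y assume [measurable]: "x \<in> space ?\<gamma>" "y \<in> space ?\<gamma>"
    show "(\<lambda>(a, b). F ((lin_comb I c s x y)(i := a)) ((lin_comb I (- s) c x y)(i := b))) \<in> borel_measurable
        (borel \<Otimes>\<^sub>M borel)"
      by measurable
  qed
  also have "\<dots> = (\<integral>\<^sup>+x. \<integral>\<^sup>+y. \<integral>\<^sup>+a. \<integral>\<^sup>+b. F (x(i := a)) (y(i := b)) \<partial>?N \<partial>?N \<partial>?\<gamma> \<partial>?\<gamma>)"
    by (rule insert.IH) measurable
  also have "\<dots> = (\<integral>\<^sup>+x. \<integral>\<^sup>+y. F x y \<partial>?J \<partial>?J)"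
    by (rule nn_integral_gauss_insert2[OF insert.hyps(1,2), symmetric]) measurable
  finally show ?case .
qed

section \<open>Exponential moments and concentration\<close>

lemma nn_integral_gauss_exp_linear:
  fixes a :: "'i \<Rightarrow> real"
  assumes "finite I"
  shows "(\<integral>\<^sup>+g. ennreal (exp (\<Sum>i\<in>I. a i * g i)) \<partial>gauss_measure I) = ennreal (exp ((\<Sum>i\<in>I. (a i)\<^sup>2) / 2))"
proof -
  have "has_bochner_integral (gauss_measure I) (\<lambda>g. Re (exp (\<Sum>i\<in>I. of_real (a i) * of_real (g i))))
      (Re (exp ((\<Sum>i\<in>I. (of_real (a i))\<^sup>2) / 2)))"
    by (rule has_bochner_integral_bounded_linear[OF bounded_linear_Re has_bochner_integral_gauss_exp[OF assms]])
  moreover have "Re (exp (\<Sum>i\<in>I. of_real (a i) * of_real (g i))) = exp (\<Sum>i\<in>I. a i * g i)" for g :: "'i \<Rightarrow> real"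
    using Re_exp[of "of_real (\<Sum>i\<in>I. a i * g i)"] by simp
  moreover have "Re (exp ((\<Sum>i\<in>I. (of_real (a i))\<^sup>2) / 2)) = exp ((\<Sum>i\<in>I. (a i)\<^sup>2) / 2)"
    using Re_exp[of "of_real ((\<Sum>i\<in>I. (a i)\<^sup>2) / 2)"] by simp
  ultimately have "has_bochner_integral (gauss_measure I) (\<lambda>g. exp (\<Sum>i\<in>I. a i * g i)) (exp ((\<Sum>i\<in>I. (a i)\<^sup>2) / 2))"
    by simp
  then show ?thesis
    by (subst nn_integral_eq_integral) (auto simp: has_bochner_integral_iff)
qed

text \<open>By convexity \<open>exp (e * |t|)\<close> lies below the chord
  \<open>1 - e + e * exp |t|\<close>. A bound \<open>1 + O(e)\<close> per coordinate is essential: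
  the product over all coordinates then stays bounded once \<open>e\<close> is small compared with
  \<open>1 / card I\<close>.\<close>

lemma nn_integral_std_normal_exp_abs:
  assumes "0 \<le> e" "e \<le> 1"
  shows "(\<integral>\<^sup>+t. ennreal (exp (e * \<bar>t\<bar>)) \<partial>std_normal_distribution) \<le> ennreal (exp (3 * e))"
proof -
  interpret prob_space std_normal_distribution by (rule prob_space_std_normal)
  have mgf: "(\<integral>t. exp (a * t) \<partial>std_normal_distribution) = exp (a\<^sup>2 / 2)" for a :: real
  proof -
    have "(\<integral>t. complex_of_real (exp (a * t)) \<partial>std_normal_distribution) = of_real (exp (a\<^sup>2 / 2))"
      using integral_std_normal_exp[of "of_real a"] by (simp add: exp_of_real[symmetric])
    then show ?thesis by (simp only: integral_complex_of_real of_real_eq_iff)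
  qed
  let ?g = "\<lambda>t. 1 - e + e * (exp (1 * t) + exp (- 1 * t)) :: real"
  have int: "integrable std_normal_distribution ?g"
    by (intro Bochner_Integration.integrable_add integrable_mult_right integrable_std_normal_exp integrable_const)
  have le: "exp (e * \<bar>t\<bar>) \<le> ?g t" for t
  proof -
    have "exp ((1 - e) * 0 + e * \<bar>t\<bar>) \<le> (1 - e) * exp 0 + e * exp \<bar>t\<bar>"
      using convex_onD[OF exp_convex, of e 0 "\<bar>t\<bar>"] assms by simp
    also have "exp \<bar>t\<bar> \<le> exp (1 * t) + exp (- 1 * t)" by (cases "t \<ge> 0") auto
    finally show ?thesis using assms by (simp add: mult_left_mono)
  qed
  have "(\<integral>\<^sup>+t. ennreal (exp (e * \<bar>t\<bar>)) \<partial>std_normal_distribution) \<le> (\<integral>\<^sup>+t. ennreal (?g t) \<partial>std_normal_distribution)"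
    by (intro nn_integral_mono ennreal_leI le)
  also have "\<dots> = ennreal (\<integral>t. ?g t \<partial>std_normal_distribution)"
    using le by (intro nn_integral_eq_integral int AE_I2) (meson exp_ge_zero order_trans)
  also have "(\<integral>t. ?g t \<partial>std_normal_distribution) = 1 - e + e * (2 * exp (1 / 2))"
    by (subst Bochner_Integration.integral_add) (auto simp: integrable_std_normal_exp[of 1, simplified]
      integrable_std_normal_exp[of "-1", simplified] mgf[of 1, simplified] mgf[of
          "-1", simplified] prob_space[simplified])
  also have "\<dots> \<le> 1 + 3 * e"
  proof -
    have "exp (1 / 2 :: real) \<le> 2" using exp_half_le2 by simp
    then have "e * (2 * exp (1 / 2)) \<le> e * 4" using assms by (intro mult_left_mono) auto
    then show ?thesis by simp
  qed
  also have "1 + 3 * e \<le> exp (3 * e)" by (rule exp_ge_add_one_self)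
  finally show ?thesis by (simp add: ennreal_leI)
qed

lemma nn_integral_gauss_exp_abs:
  assumes I: "finite I" and e: "0 \<le> e" "e \<le> 1" "3 * e * real (card I) \<le> 1"
  shows "(\<integral>\<^sup>+x. ennreal (exp (e * (\<Sum>i\<in>I. \<bar>x i\<bar>))) \<partial>gauss_measure I) \<le> ennreal 3"
proof -
  interpret product_sigma_finite "\<lambda>_. std_normal_distribution" by (rule product_prob_space_std_normal)
  have "(\<integral>\<^sup>+x. ennreal (exp (e * (\<Sum>i\<in>I. \<bar>x i\<bar>))) \<partial>gauss_measure I)
      = (\<integral>\<^sup>+x. (\<Prod>i\<in>I. ennreal (exp (e * \<bar>x i\<bar>))) \<partial>gauss_measure I)"
    using I by (simp add: sum_distrib_left exp_sum prod_ennreal)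
  also have "\<dots> = (\<Prod>i\<in>I. \<integral>\<^sup>+t. ennreal (exp (e * \<bar>t\<bar>)) \<partial>std_normal_distribution)"
    unfolding gauss_measure_def by (intro product_nn_integral_prod I) auto
  also have "\<dots> \<le> (\<Prod>i\<in>I. ennreal (exp (3 * e)))"
    by (intro prod_mono_ennreal nn_integral_std_normal_exp_abs e)
  also have "\<dots> = ennreal (exp (3 * e * real (card I)))"
    by (simp add: ennreal_power exp_of_nat_mult[symmetric] mult.commute)
  also have "\<dots> \<le> ennreal 3"
    using e exp_le by (intro ennreal_leI) (meson exp_le_cancel_iff order_trans)
  finally show ?thesis .
qed

lemma exp_sum_le_mean:
  fixes g :: "nat \<Rightarrow> real"
  assumes "M \<ge> 1"
  shows "exp (l * (\<Sum>m<M. g m)) \<le> (\<Sum>m<M. 1 / real M * exp (l * real M * g m))"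
proof -
  have "exp (\<Sum>m<M. (1 / real M) *\<^sub>R (l * real M * g m)) \<le> (\<Sum>m<M. 1 / real M * exp (l * real M * g m))"
    using assms by (intro convex_on_sum[OF _ _ exp_convex]) (auto simp: lessThan_empty_iff)
  moreover have "(\<Sum>m<M. (1 / real M) *\<^sub>R (l * real M * g m)) = l * (\<Sum>m<M. g m)"
    using assms by (simp add: sum_distrib_left)
  ultimately show ?thesis by simp
qed

text \<open>Concentration after Maurey and Pisier. The two independent points are joined by a quarter circle cut into
  \<open>M\<close> arcs; for a convex function the increment along an arc is controlled by the subgradient \<open>D\<close> at its
  start, which is independent of the direction of the arc up to an error of order \<open>1 / M\<^sup>2\<close>. No smoothness
  of \<open>f\<close> is needed.\<close>

lemma gauss_concentration:
  fixes f :: "('i \<Rightarrow> real) \<Rightarrow> real"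
  assumes I: "finite I"
    and f [measurable]: "f \<in> borel_measurable (gauss_measure I)"
    and D: "\<And>i. i \<in> I \<Longrightarrow> (\<lambda>x. D x i) \<in> borel_measurable (gauss_measure I)"
    and DK: "\<And>x. x \<in> space (gauss_measure I) \<Longrightarrow> (\<Sum>i\<in>I. (D x i)\<^sup>2) \<le> K\<^sup>2"
    and sub: "\<And>x y. x \<in> space (gauss_measure I) \<Longrightarrow> y \<in> space (gauss_measure I) \<Longrightarrow> f x + (\<Sum>i\<in>I. D x i * (y i - x i))
        \<le> f y"
    and K: "K \<ge> 0" and l: "l \<ge> 0"
  shows "(\<integral>\<^sup>+x. \<integral>\<^sup>+y. ennreal (exp (l * (f x - f y))) \<partial>gauss_measure I \<partial>gauss_measure I)
    \<le> ennreal (3 * exp (l\<^sup>2 * pi\<^sup>2 * K\<^sup>2 / 8))"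
proof -
  let ?\<gamma> = "gauss_measure I"
  interpret G: prob_space ?\<gamma> by (rule prob_space_gauss)
  interpret P: pair_sigma_finite ?\<gamma> ?\<gamma> ..
  \<comment> \<open>\<open>c\<^sub>0 / M\<close> is the coefficient of the sum of the
    \<open>|x i|\<close> in the second-order error of the arcs; \<open>M\<close> is taken so large
    that the exponential moment of this error is at most 3.\<close>
  define c\<^sub>0 where "c\<^sub>0 = l * pi\<^sup>2 * K / 8"
  have c\<^sub>0: "c\<^sub>0 \<ge> 0" using l K by (simp add: c\<^sub>0_def)
  obtain M :: nat where M: "M \<ge> 2" "c\<^sub>0 * (3 * real (card I) + 1) \<le> real M"
  proof -
    obtain M0 :: nat where "c\<^sub>0 * (3 * real (card I) + 1) \<le> real M0" using real_arch_simple by blast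
    then show thesis by (intro that[of "M0 + 2"]) auto
  qed
  have M0: "real M > 0" using M by simp
  define h where "h = pi / (2 * real M)"
  have h: "0 \<le> h" "real M * h = pi / 2" using M0 by (auto simp: h_def)
  define X where "X m = lin_comb I (cos (real m * h)) (sin (real m * h))" for m
  define X' where "X' m = lin_comb I (- sin (real m * h)) (cos (real m * h))" for m
  \<comment> \<open>The next point on the quarter circle is \<open>cos h\<close> times the current
    point plus \<open>sin h\<close> times its orthogonal companion \<open>X'\<close>;
    \<open>g\<close> is minus the subgradient applied to this step.\<close>
  define g where "g x y = (\<Sum>i\<in>I. D x i * ((1 - cos h) * x i - sin h * y i))" for x y
  have sp: "lin_comb I a b x y \<in> space ?\<gamma>" for a b x y
    by (simp add: lin_comb_def gauss_measure_def space_PiM)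
  have ext: "x i = undefined" if "x \<in> space ?\<gamma>" "i \<notin> I" for x i
    using that by (auto simp: gauss_measure_def space_PiM PiE_def extensional_def)
  have chain: "f x - f y \<le> (\<Sum>m<M. g (X m x y) (X' m x y))" if xy: "x \<in> space ?\<gamma>" "y \<in> space ?\<gamma>" for x y
  proof -
    have X0: "X 0 x y = x" using ext[OF xy(1)] by (auto simp: X_def lin_comb_def fun_eq_iff)
    have XM: "X M x y = y" using ext[OF xy(2)] by (auto simp: X_def lin_comb_def fun_eq_iff h)
    have step: "f (X m x y) - f (X (Suc m) x y) \<le> g (X m x y) (X' m x y)" for m
    proof -
      have "X (Suc m) x y i - X m x y i = - ((1 - cos h) * X m x y i - sin h * X' m x y i)" if "i \<in> I" for i
        using that by (simp add: X_def X'_def lin_comb_def distrib_right cos_add sin_add algebra_simps)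
      then have "(\<Sum>i\<in>I. D (X m x y) i * (X (Suc m) x y i - X m x y i)) = - g (X m x y) (X' m x y)"
        by (simp add: g_def sum_negf[symmetric] algebra_simps)
      moreover have "f (X m x y) + (\<Sum>i\<in>I. D (X m x y) i * (X (Suc m) x y i - X m x y i)) \<le> f (X (Suc m) x y)"
        unfolding X_def by (intro sub sp)
      ultimately show ?thesis by simp
    qed
    have "f x - f y = (\<Sum>m<M. f (X m x y) - f (X (Suc m) x y))"
      by (subst sum_lessThan_telescope') (simp add: X0 XM)
    also have "\<dots> \<le> (\<Sum>m<M. g (X m x y) (X' m x y))" by (intro sum_mono step)
    finally show ?thesis .
  qed
  have gmeas: "(\<lambda>(x, y). g x y) \<in> borel_measurable (?\<gamma> \<Otimes>\<^sub>M ?\<gamma>)"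
    unfolding g_def case_prod_beta
    by (intro borel_measurable_sum borel_measurable_times borel_measurable_diff borel_measurable_const
        measurable_compose[OF measurable_fst D] measurable_compose[OF measurable_fst measurable_gauss_component]
        measurable_compose[OF measurable_snd measurable_gauss_component])
  define G where "G x y = ennreal (exp (l * real M * g x y))" for x y
  have Gmeas [measurable]: "(\<lambda>(x, y). G x y) \<in> borel_measurable (?\<gamma> \<Otimes>\<^sub>M ?\<gamma>)"
    using gmeas unfolding G_def by measurable
  have Gmeas' [measurable]: "(\<lambda>(x, y). G (X m x y) (X' m x y)) \<in> borel_measurable (?\<gamma> \<Otimes>\<^sub>M ?\<gamma>)" for m
    unfolding X_def X'_def by measurable
  have "(\<integral>\<^sup>+x. \<integral>\<^sup>+y. ennreal (exp (l * (f x - f y))) \<partial>?\<gamma> \<partial>?\<gamma>)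
      \<le> (\<integral>\<^sup>+x. \<integral>\<^sup>+y. (\<Sum>m<M. ennreal (1 / real M) * G (X m x y) (X' m x y)) \<partial>?\<gamma> \<partial>?\<gamma>)"
  proof (intro nn_integral_mono)
    fix x y assume xy: "x \<in> space ?\<gamma>" "y \<in> space ?\<gamma>"
    have "exp (l * (f x - f y)) \<le> exp (l * (\<Sum>m<M. g (X m x y) (X' m x y)))"
      using chain[OF xy] l by (simp add: mult_left_mono)
    also have "\<dots> \<le> (\<Sum>m<M. 1 / real M * exp (l * real M * g (X m x y) (X' m x y)))"
      using M by (intro exp_sum_le_mean) auto
    finally have "ennreal (exp (l * (f x - f y))) \<le> ennreal \<dots>" by (rule ennreal_leI)
    then show "ennreal (exp (l * (f x - f y))) \<le> (\<Sum>m<M. ennreal (1 / real M) * G (X m x y) (X' m x y))"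
      unfolding G_def using M0 by (simp add: sum_ennreal ennreal_mult'[symmetric])
  qed
  also have "\<dots> = (\<integral>\<^sup>+z. (\<Sum>m<M. ennreal (1 / real M) * (case z of (x, y) \<Rightarrow> G (X m x y) (X' m x y))) \<partial>(?\<gamma> \<Otimes>\<^sub>M ?\<gamma>))"
    by (subst G.nn_integral_fst[symmetric]) auto
  also have "\<dots> = (\<Sum>m<M. ennreal (1 / real M) * (\<integral>\<^sup>+z. (case z of (x, y) \<Rightarrow> G (X m x y) (X' m x y)) \<partial>(?\<gamma> \<Otimes>\<^sub>M ?\<gamma>)))"
    by (simp add: nn_integral_sum nn_integral_cmult)
  also have "\<dots> = (\<Sum>m<M. ennreal (1 / real M) * (\<integral>\<^sup>+x. \<integral>\<^sup>+y. G x y \<partial>?\<gamma> \<partial>?\<gamma>))"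
  proof (intro sum.cong arg_cong2[where f = "(*)"] refl)
    fix m assume "m \<in> {..<M}"
    then have m: "real m < real M" by simp
    have "real m * h < real M * h" using m M0 by (intro mult_strict_right_mono) (auto simp: h_def)
    then have cos: "cos (real m * h) > 0" using h(2) pi_gt_zero mult_nonneg_nonneg[OF of_nat_0_le_iff[of m] h(1)]
        by (intro cos_gt_zero_pi) linarith+
    have "(\<integral>\<^sup>+z. (case z of (x, y) \<Rightarrow> G (X m x y) (X' m x y)) \<partial>(?\<gamma> \<Otimes>\<^sub>M ?\<gamma>))
        = (\<integral>\<^sup>+x. \<integral>\<^sup>+y. G (X m x y) (X' m x y) \<partial>?\<gamma> \<partial>?\<gamma>)"
      by (subst G.nn_integral_fst[symmetric]) auto
    \<comment> \<open>The point on the circle and its companion are a rotation of the original pair,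
      so every arc contributes the same integral.\<close>
    also have "\<dots> = (\<integral>\<^sup>+x. \<integral>\<^sup>+y. G x y \<partial>?\<gamma> \<partial>?\<gamma>)"
      unfolding X_def X'_def by (rule nn_integral_gauss_rotate[OF I _ cos Gmeas]) simp
    finally show "(\<integral>\<^sup>+z. (case z of (x, y) \<Rightarrow> G (X m x y) (X' m x y)) \<partial>(?\<gamma> \<Otimes>\<^sub>M ?\<gamma>)) = \<dots>" .
  qed
  also have "\<dots> = (\<integral>\<^sup>+x. \<integral>\<^sup>+y. G x y \<partial>?\<gamma> \<partial>?\<gamma>)"
    using M0 by (simp add: mult.assoc[symmetric] ennreal_of_nat_eq_real_of_nat ennreal_mult'[symmetric])
  also have "\<dots> \<le> (\<integral>\<^sup>+x. ennreal (exp (l\<^sup>2 * pi\<^sup>2 * K\<^sup>2 / 8)) * ennreal (exp (c\<^sub>0 / real M * (\<Sum>i\<in>I. \<bar>x i\<bar>))) \<partial>?\<gamma>)"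
  proof (rule nn_integral_mono)
    fix x assume x: "x \<in> space ?\<gamma>"
    define A where "A = (\<Sum>i\<in>I. D x i * x i)"
    have "G x y = ennreal (exp (l * real M * (1 - cos h) * A)) * ennreal
        (exp (\<Sum>i\<in>I. (- (l * real M * sin h) * D x i) * y i))" for y
    proof -
      have "l * real M * g x y = l * real M * (1 - cos h) * A + (\<Sum>i\<in>I. (- (l * real M * sin h) * D x i) * y i)"
        unfolding g_def A_def by (simp add: right_diff_distrib sum_subtractf sum_distrib_left sum_negf mult_ac)
      then show ?thesis unfolding G_def by (simp add: exp_add ennreal_mult')
    qed
    \<comment> \<open>Given \<open>x\<close>, the exponent is affine in the independent Gaussian
      \<open>y\<close>, so its exponential moment is explicit; \<open>M * sin h \<le> pi / 2\<close>
      yields the constant \<open>pi\<^sup>2 / 8\<close>.\<close>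
    then have "(\<integral>\<^sup>+y. G x y \<partial>?\<gamma>) = ennreal (exp (l * real M * (1 - cos h) * A))
        * (\<integral>\<^sup>+y. ennreal (exp (\<Sum>i\<in>I. (- (l * real M * sin h) * D x i) * y i)) \<partial>?\<gamma>)"
      using I
      by (simp only:) (intro nn_integral_cmult measurable_compose[OF _ measurable_ennreal] borel_measurable_exp[THEN measurable_compose[rotated]]
          borel_measurable_sum borel_measurable_times borel_measurable_const measurable_gauss_component)
    also have "\<dots> = ennreal (exp (l * real M * (1 - cos h) * A)) * ennreal
        (exp ((\<Sum>i\<in>I. (- (l * real M * sin h) * D x i)\<^sup>2) / 2))"
      by (subst nn_integral_gauss_exp_linear[OF I]) simp
    also have "\<dots> \<le> ennreal (exp (c\<^sub>0 / real M * (\<Sum>i\<in>I. \<bar>x i\<bar>))) * ennreal (exp (l\<^sup>2 * pi\<^sup>2 * K\<^sup>2 / 8))"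
    proof (intro mult_mono ennreal_leI)
      have "1 - cos h \<le> h\<^sup>2 / 2"
      proof -
        have "(sin (h / 2))\<^sup>2 \<le> (h / 2)\<^sup>2" by (rule abs_le_square_iff[THEN iffD1, OF abs_sin_x_le_abs_x])
        then show ?thesis using cos_double_sin[of "h / 2"] by (simp add: power_divide)
      qed
      moreover have "real M * (h\<^sup>2 / 2) = pi\<^sup>2 / (8 * real M)"
        using M0 by (simp add: h_def power2_eq_square)
      ultimately have "real M * (1 - cos h) \<le> pi\<^sup>2 / (8 * real M)"
        using mult_left_mono[of "1 - cos h" "h\<^sup>2 / 2" "real M"] by simp
      from mult_left_mono[OF this l] have 1: "l * real M * (1 - cos h) \<le> l * (pi\<^sup>2 / (8 * real M))"
        by (simp only: mult.assoc)
      have DK_i: "\<bar>D x i\<bar> \<le> K" if "i \<in> I" for i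
      proof -
        have "(D x i)\<^sup>2 \<le> (\<Sum>i\<in>I. (D x i)\<^sup>2)" using I that by (intro member_le_sum) auto
        then have "(D x i)\<^sup>2 \<le> K\<^sup>2" using DK[OF x] by simp
        then show ?thesis using K abs_le_square_iff[of "D x i" K] by simp
      qed
      have "A \<le> (\<Sum>i\<in>I. K * \<bar>x i\<bar>)"
        unfolding A_def
      proof (intro sum_mono)
        fix i assume i: "i \<in> I"
        have "D x i * x i \<le> \<bar>D x i\<bar> * \<bar>x i\<bar>" using abs_ge_self[of "D x i * x i"] by (simp add: abs_mult)
        also have "\<dots> \<le> K * \<bar>x i\<bar>" using DK_i[OF i] by (intro mult_right_mono) auto
        finally show "D x i * x i \<le> K * \<bar>x i\<bar>" .
      qed
      then have 2: "A \<le> K * (\<Sum>i\<in>I. \<bar>x i\<bar>)" by (simp add: sum_distrib_left)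
      have "l * real M * (1 - cos h) * A \<le> l * real M * (1 - cos h) * (K * (\<Sum>i\<in>I. \<bar>x i\<bar>))"
        using 2 l by (intro mult_left_mono) auto
      also have "\<dots> \<le> l * (pi\<^sup>2 / (8 * real M)) * (K * (\<Sum>i\<in>I. \<bar>x i\<bar>))"
        using 1 K by (intro mult_right_mono) (auto intro!: mult_nonneg_nonneg sum_nonneg)
      also have "\<dots> = c\<^sub>0 / real M * (\<Sum>i\<in>I. \<bar>x i\<bar>)" by (simp add: c\<^sub>0_def)
      finally show "exp (l * real M * (1 - cos h) * A) \<le> exp (c\<^sub>0 / real M * (\<Sum>i\<in>I. \<bar>x i\<bar>))" by simp
      have "sin h \<ge> 0" using h M0 M by (intro sin_ge_zero) (auto simp: h_def divide_simps)
      then have "real M * sin h \<le> pi / 2" "real M * sin h \<ge> 0"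
        using mult_left_mono[OF sin_x_le_x[OF h(1)] less_imp_le[OF M0]] unfolding h(2) by simp_all
      then have "(real M * sin h)\<^sup>2 \<le> (pi / 2)\<^sup>2" by (intro power_mono)
      then have "(real M * sin h)\<^sup>2 * (\<Sum>i\<in>I. (D x i)\<^sup>2) \<le> (pi / 2)\<^sup>2 * K\<^sup>2"
        using DK[OF x] by (intro mult_mono) (auto intro: sum_nonneg)
      then have "l\<^sup>2 * ((real M * sin h)\<^sup>2 * (\<Sum>i\<in>I. (D x i)\<^sup>2)) \<le> l\<^sup>2 * ((pi / 2)\<^sup>2 * K\<^sup>2)"
        by (intro mult_left_mono) auto
      moreover have "(\<Sum>i\<in>I. (- (l * real M * sin h) * D x i)\<^sup>2) = l\<^sup>2 * ((real M * sin h)\<^sup>2 * (\<Sum>i\<in>I. (D x i)\<^sup>2))"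
        by (simp add: power_mult_distrib sum_distrib_left mult_ac)
      ultimately show "exp ((\<Sum>i\<in>I. (- (l * real M * sin h) * D x i)\<^sup>2) / 2) \<le> exp (l\<^sup>2 * pi\<^sup>2 * K\<^sup>2 / 8)"
        by (simp add: power_divide)
    qed auto
    finally show "(\<integral>\<^sup>+y. G x y \<partial>?\<gamma>) \<le> ennreal (exp (l\<^sup>2 * pi\<^sup>2 * K\<^sup>2 / 8)) * ennreal
        (exp (c\<^sub>0 / real M * (\<Sum>i\<in>I. \<bar>x i\<bar>)))"
      by (simp only: mult.commute)
  qed
  also have "\<dots> = ennreal (exp (l\<^sup>2 * pi\<^sup>2 * K\<^sup>2 / 8)) * (\<integral>\<^sup>+x. ennreal (exp (c\<^sub>0 / real M * (\<Sum>i\<in>I. \<bar>x i\<bar>))) \<partial>?\<gamma>)"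
    by (intro nn_integral_cmult measurable_compose[OF _ measurable_ennreal] borel_measurable_exp[THEN measurable_compose[rotated]]
          borel_measurable_sum borel_measurable_times borel_measurable_const borel_measurable_abs measurable_gauss_component)
  also have "\<dots> \<le> ennreal (exp (l\<^sup>2 * pi\<^sup>2 * K\<^sup>2 / 8)) * ennreal 3"
  proof (intro mult_left_mono nn_integral_gauss_exp_abs I)
    have "c\<^sub>0 * (3 * real (card I)) + c\<^sub>0 \<le> real M" using M(2) by (simp add: distrib_left)
    moreover have "c\<^sub>0 * (3 * real (card I)) \<ge> 0" using c\<^sub>0 by simp
    ultimately show "c\<^sub>0 / real M \<le> 1" "3 * (c\<^sub>0 / real M) * real (card I) \<le> 1"
    proof -
      assume 1: "c\<^sub>0 * (3 * real (card I)) + c\<^sub>0 \<le> real M" "0 \<le> c\<^sub>0 * (3 * real (card I))"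
      have "c\<^sub>0 \<le> real M" "c\<^sub>0 * (3 * real (card I)) \<le> real M" using 1 c\<^sub>0 by linarith+
      then have "c\<^sub>0 / real M \<le> 1" "c\<^sub>0 * (3 * real (card I)) / real M \<le> 1" using M0 by simp_all
      then show "c\<^sub>0 / real M \<le> 1" "3 * (c\<^sub>0 / real M) * real (card I) \<le> 1" by (simp_all add: mult_ac)
    qed
  qed (use c\<^sub>0 in auto)
  also have "\<dots> = ennreal (3 * exp (l\<^sup>2 * pi\<^sup>2 * K\<^sup>2 / 8))"
    by (simp only: mult.commute[of 3] ennreal_mult'' zero_le_numeral)
  finally show ?thesis .
qed

section \<open>Soft maxima and localization to a finite set of tangent planes\<close>

definition soft_max :: "'q set \<Rightarrow> real \<Rightarrow> ('q \<Rightarrow> real) \<Rightarrow> real" where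
  "soft_max Q k v = ln (\<Sum>q\<in>Q. exp (k * v q)) / k"

text \<open>The gradient of the soft maximum: a probability vector depending explicitly, hence
  measurably, on \<open>v\<close>. With a true maximum a maximizer would have to be
  selected.\<close>

definition soft_weight :: "'q set \<Rightarrow> real \<Rightarrow> ('q \<Rightarrow> real) \<Rightarrow> 'q \<Rightarrow> real" where
  "soft_weight Q k v q = exp (k * v q) / (\<Sum>q\<in>Q. exp (k * v q))"

context
  fixes Q :: "'q set" and k :: real
  assumes Q: "finite Q" "Q \<noteq> {}" and k: "k > 0"
begin

lemma sum_exp_pos: "(\<Sum>q\<in>Q. exp (k * v q)) > 0"
  using Q by (intro sum_pos) auto

lemma soft_weight_nonneg: "soft_weight Q k v q \<ge> 0"
  using sum_exp_pos[of v] by (simp add: soft_weight_def)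

lemma sum_soft_weight: "(\<Sum>q\<in>Q. soft_weight Q k v q) = 1"
  using sum_exp_pos[of v] by (simp add: soft_weight_def sum_divide_distrib[symmetric])

lemma soft_max_ge: "q \<in> Q \<Longrightarrow> v q \<le> soft_max Q k v"
proof -
  assume q: "q \<in> Q"
  have "exp (k * v q) \<le> (\<Sum>q\<in>Q. exp (k * v q))" using Q q by (intro member_le_sum) auto
  then have "k * v q \<le> ln (\<Sum>q\<in>Q. exp (k * v q))" using sum_exp_pos[of v] by (simp add: ln_ge_iff)
  then show ?thesis using k by (simp add: soft_max_def field_simps)
qed

text \<open>The excess over the maximum is at most \<open>ln (card Q) / k\<close>, and
  \<open>card Q \<le> k \<le> exp k\<close>.\<close>

lemma soft_max_le:
  assumes "\<And>q. q \<in> Q \<Longrightarrow> v q \<le> a" "real (card Q) \<le> k"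
  shows "soft_max Q k v \<le> a + 1"
proof -
  have "(\<Sum>q\<in>Q. exp (k * v q)) \<le> (\<Sum>q\<in>Q. exp (k * a))"
    using assms k by (intro sum_mono) auto
  also have "\<dots> \<le> exp k * exp (k * a)"
  proof -
    have "real (card Q) \<le> exp k" using assms(2) exp_ge_add_one_self[of k] by linarith
    then show ?thesis by simp
  qed
  also have "\<dots> = exp (k * (a + 1))" by (simp add: mult_exp_exp algebra_simps)
  finally have "ln (\<Sum>q\<in>Q. exp (k * v q)) \<le> k * (a + 1)"
    using sum_exp_pos[of v] by (metis exp_gt_zero ln_exp ln_le_cancel_iff)
  then show ?thesis using k by (simp add: soft_max_def field_simps)
qed

text \<open>Jensen's inequality for \<open>exp\<close> with the soft weights. It serves twice: for
  soft maxima of tangent planes and, with \<open>k = 1\<close> over spin configurations, for the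
  convexity of the free energy.\<close>

lemma soft_max_subgradient:
  "soft_max Q k v + (\<Sum>q\<in>Q. soft_weight Q k v q * (w q - v q)) \<le> soft_max Q k w"
proof -
  let ?p = "soft_weight Q k v"
  have "exp (\<Sum>q\<in>Q. ?p q *\<^sub>R (k * (w q - v q))) \<le> (\<Sum>q\<in>Q. ?p q * exp (k * (w q - v q)))"
    using Q by (intro convex_on_sum[OF _ _ exp_convex]) (auto simp: sum_soft_weight soft_weight_nonneg)
  also have "\<dots> = (\<Sum>q\<in>Q. exp (k * w q) / (\<Sum>q\<in>Q. exp (k * v q)))"
    by (intro sum.cong refl) (simp add: soft_weight_def right_diff_distrib exp_diff)
  also have "\<dots> = (\<Sum>q\<in>Q. exp (k * w q)) / (\<Sum>q\<in>Q. exp (k * v q))" by (simp add: sum_divide_distrib)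
  finally have "(\<Sum>q\<in>Q. ?p q *\<^sub>R (k * (w q - v q))) \<le> ln ((\<Sum>q\<in>Q. exp (k * w q)) / (\<Sum>q\<in>Q. exp (k * v q)))"
    using sum_exp_pos by (subst ln_ge_iff) auto
  also have "\<dots> = ln (\<Sum>q\<in>Q. exp (k * w q)) - ln (\<Sum>q\<in>Q. exp (k * v q))"
    using sum_exp_pos[of w] sum_exp_pos[of v] by (simp add: ln_div)
  also have "(\<Sum>q\<in>Q. ?p q *\<^sub>R (k * (w q - v q))) = k * (\<Sum>q\<in>Q. ?p q * (w q - v q))"
    by (simp add: sum_distrib_left mult_ac)
  finally have "(\<Sum>q\<in>Q. ?p q * (w q - v q)) \<le> (ln (\<Sum>q\<in>Q. exp (k * w q)) - ln (\<Sum>q\<in>Q. exp (k * v q))) / k"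
    using k by (subst pos_le_divide_eq) (simp_all only: mult.commute[of _ k])
  then show ?thesis unfolding soft_max_def diff_divide_distrib by simp
qed

text \<open>A ball is convex: averaging gradients with the soft weights does not enlarge their
  norm.\<close>

lemma soft_weight_mean_square_le:
  assumes "finite I" "\<And>q. q \<in> Q \<Longrightarrow> (\<Sum>i\<in>I. (G q i)\<^sup>2) \<le> K\<^sup>2" "K \<ge> 0"
  shows "(\<Sum>i\<in>I. (\<Sum>q\<in>Q. soft_weight Q k v q * G q i)\<^sup>2) \<le> K\<^sup>2"
proof -
  let ?p = "soft_weight Q k v"
  have "(\<Sum>q\<in>Q. ?p q * G q i)\<^sup>2 \<le> (\<Sum>q\<in>Q. ?p q * (G q i)\<^sup>2)" for i
  proof -
    have "(\<Sum>q\<in>Q. ?p q *\<^sub>R G q i)\<^sup>2 \<le> (\<Sum>q\<in>Q. ?p q * (G q i)\<^sup>2)"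
      using Q by (intro convex_on_sum[OF _ _ convex_power2]) (auto simp: sum_soft_weight soft_weight_nonneg)
    then show ?thesis by simp
  qed
  then have "(\<Sum>i\<in>I. (\<Sum>q\<in>Q. ?p q * G q i)\<^sup>2) \<le> (\<Sum>i\<in>I. \<Sum>q\<in>Q. ?p q * (G q i)\<^sup>2)"
    by (intro sum_mono)
  also have "\<dots> = (\<Sum>q\<in>Q. ?p q * (\<Sum>i\<in>I. (G q i)\<^sup>2))"
    by (subst sum.swap) (simp add: sum_distrib_left)
  also have "\<dots> \<le> (\<Sum>q\<in>Q. ?p q * K\<^sup>2)"
    by (intro sum_mono mult_left_mono assms soft_weight_nonneg)
  also have "\<dots> = K\<^sup>2" by (simp add: sum_distrib_right[symmetric] sum_soft_weight)
  finally show ?thesis .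
qed

end

text \<open>Cubes of side \<open>\<delta>\<close> split \<open>B\<close> into countably many pieces,
  and by continuity of measure finitely many of them already carry mass above
  \<open>p\<close>.\<close>

lemma finite_grid_cover:
  fixes \<delta> :: real
  assumes I: "finite I" and B [measurable]: "B \<in> sets (gauss_measure I)" and d: "\<delta> > 0"
    and p: "p < measure (gauss_measure I) B" "0 \<le> p"
  obtains A Q where "A \<in> sets (gauss_measure I)" "A \<subseteq> B" "p < measure (gauss_measure I) A" "finite Q" "Q \<subseteq> B"
    "\<And>x. x \<in> A \<Longrightarrow> \<exists>q\<in>Q. \<forall>i\<in>I. \<bar>x i - q i\<bar> \<le> \<delta>"
proof -
  let ?\<gamma> = "gauss_measure I"
  interpret G: prob_space ?\<gamma> by (rule prob_space_gauss)
  define C where "C = I \<rightarrow>\<^sub>E (UNIV :: int set)"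
  have C: "countable C" unfolding C_def by (intro countable_PiE I) auto
  define cell where "cell x = (\<lambda>i\<in>I. \<lfloor>x i / \<delta>\<rfloor>)" for x :: "'a \<Rightarrow> real"
  have cC: "cell x \<in> C" for x by (auto simp: cell_def C_def)
  define e where "e = to_nat_on C"
  have e: "inj_on e C" unfolding e_def by (rule inj_on_to_nat_on[OF C])
  have Bsub: "B \<subseteq> space ?\<gamma>" by (rule sets.sets_into_space[OF B])
  have cm: "{x \<in> space ?\<gamma>. cell x = \<kappa>} \<in> sets ?\<gamma>" if "\<kappa> \<in> C" for \<kappa>
  proof -
    have "{x \<in> space ?\<gamma>. cell x = \<kappa>} = {x \<in> space ?\<gamma>. \<forall>i\<in>I. \<lfloor>x i / \<delta>\<rfloor> = \<kappa> i}"
      using that by (auto simp: cell_def C_def fun_eq_iff PiE_def extensional_def)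
    also have "\<dots> \<in> sets ?\<gamma>"
    proof (intro sets.sets_Collect_finite_All I)
      fix i assume i: "i \<in> I"
      have [measurable]: "(\<lambda>x. x i) \<in> borel_measurable ?\<gamma>" by (rule measurable_gauss_component[OF i])
      show "{x \<in> space ?\<gamma>. \<lfloor>x i / \<delta>\<rfloor> = \<kappa> i} \<in> sets ?\<gamma>" by measurable
    qed
    finally show ?thesis .
  qed
  define A where "A n = {x \<in> B. e (cell x) < n}" for n :: nat
  have fin: "finite {\<kappa> \<in> C. e \<kappa> < n}" for n
  proof (rule finite_imageD)
    show "finite (e ` {\<kappa> \<in> C. e \<kappa> < n})" by (rule finite_subset[of _ "{..<n}"]) auto
    show "inj_on e {\<kappa> \<in> C. e \<kappa> < n}" by (rule inj_on_subset[OF e]) auto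
  qed
  have Am: "A n \<in> sets ?\<gamma>" for n
  proof -
    have "A n = (\<Union>\<kappa>\<in>{\<kappa> \<in> C. e \<kappa> < n}. B \<inter> {x \<in> space ?\<gamma>. cell x = \<kappa>})"
      using Bsub cC by (auto simp: A_def)
    also have "\<dots> \<in> sets ?\<gamma>" using fin cm by (intro sets.finite_UN) auto
    finally show ?thesis .
  qed
  have "(\<lambda>n. measure ?\<gamma> (A n)) \<longlonglongrightarrow> measure ?\<gamma> (\<Union>n. A n)"
    using Am by (intro G.finite_Lim_measure_incseq) (auto simp: incseq_def A_def)
  also have "(\<Union>n. A n) = B" by (auto simp: A_def)
  finally have "eventually (\<lambda>n. p < measure ?\<gamma> (A n)) sequentially"
    using p(1) by (rule order_tendstoD)
  then obtain n where n: "p < measure ?\<gamma> (A n)" by (auto simp: eventually_sequentially)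
  \<comment> \<open>Representatives are taken inside \<open>B\<close>, where values and gradients
    are controlled, and not at the corners of the cells.\<close>
  define rep where "rep \<kappa> = (SOME x. x \<in> B \<and> cell x = \<kappa>)" for \<kappa>
  define Q where "Q = rep ` (cell ` A n)"
  have rep: "rep (cell x) \<in> B \<and> cell (rep (cell x)) = cell x" if "x \<in> B" for x
    unfolding rep_def by (rule someI[of _ x]) (use that in simp)
  show thesis
  proof (rule that[of "A n" Q])
    have "cell ` A n \<subseteq> {\<kappa> \<in> C. e \<kappa> < n}" using cC by (auto simp: A_def)
    then show "finite Q" unfolding Q_def using fin finite_subset by blast
    show "Q \<subseteq> B" using rep by (auto simp: Q_def A_def)
    fix x assume x: "x \<in> A n"
    then have xB: "x \<in> B" by (simp add: A_def)
    show "\<exists>q\<in>Q. \<forall>i\<in>I. \<bar>x i - q i\<bar> \<le> \<delta>"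
    proof (rule bexI[of _ "rep (cell x)"], rule ballI)
      show "rep (cell x) \<in> Q" using x by (simp add: Q_def)
      fix i assume i: "i \<in> I"
      have "\<lfloor>rep (cell x) i / \<delta>\<rfloor> = \<lfloor>x i / \<delta>\<rfloor>"
        using rep[OF xB] i by (auto simp: cell_def fun_eq_iff) (metis restrict_apply')
      then have "\<bar>x i / \<delta> - rep (cell x) i / \<delta>\<bar> \<le> 1" by linarith
      then have "\<bar>x i - rep (cell x) i\<bar> / \<delta> \<le> 1"
        unfolding diff_divide_distrib[symmetric] abs_div_pos[OF d, symmetric] .
      then show "\<bar>x i - rep (cell x) i\<bar> \<le> \<delta>" by (simp only: pos_divide_le_eq[OF d] mult_1_left)
    qed
  qed (use Am n in \<open>auto simp: A_def\<close>)
qed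

text \<open>Near \<open>B\<close> the function \<open>F\<close> lies above finitely many affine functions, whose soft maximum is convex and
  Lipschitz and so concentrates.\<close>

lemma gauss_convex_lower_tail:
  fixes F :: "('i \<Rightarrow> real) \<Rightarrow> real"
  assumes I: "finite I" and B: "B \<in> sets (gauss_measure I)" and p: "0 \<le> p" "p < measure (gauss_measure I) B"
    and sub: "\<And>x y. x \<in> B \<Longrightarrow> y \<in> space (gauss_measure I) \<Longrightarrow> F x + (\<Sum>i\<in>I. G x i * (y i - x i)) \<le> F y"
    and Fa: "\<And>x. x \<in> B \<Longrightarrow> - a \<le> F x" and GK: "\<And>x. x \<in> B \<Longrightarrow> (\<Sum>i\<in>I. (G x i)\<^sup>2) \<le> K\<^sup>2"
    and K: "K \<ge> 0" and l: "l \<ge> 0"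
  shows "ennreal p * (\<integral>\<^sup>+y. ennreal (exp (- l * F y)) \<partial>gauss_measure I)
    \<le> ennreal (3 * exp (l\<^sup>2 * pi\<^sup>2 * K\<^sup>2 / 8 + l * (a + 2)))"
proof -
  let ?\<gamma> = "gauss_measure I"
  interpret P: prob_space ?\<gamma> by (rule prob_space_gauss)
  \<comment> \<open>With gradients bounded by \<open>K\<close> in each coordinate, a tangent plane
    changes by at most \<open>K * \<delta> * card I \<le> 1\<close> within a cell; the added ones
    avoid division by zero.\<close>
  define \<delta> where "\<delta> = 1 / ((K + 1) * (real (card I) + 1))"
  have d: "\<delta> > 0" using K by (auto simp: \<delta>_def intro!: divide_pos_pos mult_pos_pos)
  obtain A Q where A: "A \<in> sets ?\<gamma>" "A \<subseteq> B" "p < measure ?\<gamma> A" and Q: "finite Q" "Q \<subseteq> B"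
    and cov: "\<And>x. x \<in> A \<Longrightarrow> \<exists>q\<in>Q. \<forall>i\<in>I. \<bar>x i - q i\<bar> \<le> \<delta>"
    using finite_grid_cover[OF I B d p(2,1)] by metis
  have "A \<noteq> {}" using A(3) p(1) by auto
  then have Qne: "Q \<noteq> {}" using cov by blast
  define k where "k = real (card Q) + 1"
  have k: "k > 0" "real (card Q) \<le> k" by (auto simp: k_def)
  define v where "v x q = F q + (\<Sum>i\<in>I. G q i * (x i - q i))" for x q
  define f where "f x = soft_max Q k (v x)" for x
  define D where "D x i = (\<Sum>q\<in>Q. soft_weight Q k (v x) q * G q i)" for x i
  have Bsub: "B \<subseteq> space ?\<gamma>" by (rule sets.sets_into_space[OF B])
  have vm: "(\<lambda>x. v x q) \<in> borel_measurable ?\<gamma>" for q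
    unfolding v_def
    by (intro borel_measurable_sum borel_measurable_times borel_measurable_diff borel_measurable_add borel_measurable_const measurable_gauss_component)
  have fm: "f \<in> borel_measurable ?\<gamma>"
    unfolding f_def soft_max_def using vm by
        (auto intro!: borel_measurable_sum borel_measurable_times borel_measurable_divide)
  have fF: "f x \<le> F x + 1" if "x \<in> space ?\<gamma>" for x
    unfolding f_def using sub Q(2) that
    by (intro soft_max_le[OF Q(1) Qne k(1) _ k(2)]) (auto simp: v_def)
  \<comment> \<open>The discretization loses 1 here, and the soft maximum lost 1 against
    \<open>F\<close> above; together they turn \<open>a\<close> into \<open>a + 2\<close>.\<close>
  have fA: "- (a + 1) \<le> f x" if xA: "x \<in> A" for x
  proof -
    obtain q where q: "q \<in> Q" "\<And>i. i \<in> I \<Longrightarrow> \<bar>x i - q i\<bar> \<le> \<delta>" using cov[OF xA] by blast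
    have qB: "q \<in> B" using q Q by auto
    have "\<bar>\<Sum>i\<in>I. G q i * (x i - q i)\<bar> \<le> (\<Sum>i\<in>I. K * \<delta>)"
    proof (intro order_trans[OF sum_abs] sum_mono)
      fix i assume i: "i \<in> I"
      have "(G q i)\<^sup>2 \<le> (\<Sum>i\<in>I. (G q i)\<^sup>2)" using I i by (intro member_le_sum) auto
      then have "(G q i)\<^sup>2 \<le> K\<^sup>2" using GK[OF qB] by simp
      then have "\<bar>G q i\<bar> \<le> K" using K abs_le_square_iff[of "G q i" K] by simp
      then show "\<bar>G q i * (x i - q i)\<bar> \<le> K * \<delta>"
        unfolding abs_mult using q(2)[OF i] K by (intro mult_mono) auto
    qed
    also have "\<dots> = (K * real (card I)) / ((K + 1) * (real (card I) + 1))" by (simp add: \<delta>_def)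
    also have "\<dots> \<le> 1"
    proof -
      have "K * real (card I) \<le> (K + 1) * (real (card I) + 1)" using K by (intro mult_mono) auto
      moreover have "0 < (K + 1) * (real (card I) + 1)" using K by (intro mult_pos_pos) auto
      ultimately show ?thesis by simp
    qed
    finally have "- (a + 1) \<le> v x q" using Fa[OF qB] by (simp add: v_def abs_le_iff)
    also have "\<dots> \<le> f x" unfolding f_def by (rule soft_max_ge[OF Q(1) Qne k(1) q(1)])
    finally show ?thesis .
  qed
  have conc: "(\<integral>\<^sup>+x. \<integral>\<^sup>+y. ennreal (exp (l * (f x - f y))) \<partial>?\<gamma> \<partial>?\<gamma>) \<le> ennreal (3 * exp (l\<^sup>2 * pi\<^sup>2 * K\<^sup>2 / 8))"
  proof (rule gauss_concentration[OF I fm _ _ _ K l, where D = D])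
    fix i assume "i \<in> I"
    show "(\<lambda>x. D x i) \<in> borel_measurable ?\<gamma>"
      unfolding D_def soft_weight_def using vm
      by (auto intro!: borel_measurable_sum borel_measurable_times borel_measurable_divide)
  next
    fix x show "(\<Sum>i\<in>I. (D x i)\<^sup>2) \<le> K\<^sup>2"
      unfolding D_def using Q GK by (intro soft_weight_mean_square_le[OF Q(1) Qne k(1) I _ K]) auto
  next
    fix x y
    have "(\<Sum>i\<in>I. D x i * (y i - x i)) = (\<Sum>q\<in>Q. soft_weight Q k (v x) q * (\<Sum>i\<in>I. G q i * (y i - x i)))"
      unfolding D_def sum_distrib_right sum_distrib_left by (subst sum.swap) (simp add: mult_ac)
    also have "\<dots> = (\<Sum>q\<in>Q. soft_weight Q k (v x) q * (v y q - v x q))"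
      by (intro sum.cong refl arg_cong2[where f = "(*)"])
          (simp add: v_def sum_subtractf[symmetric] right_diff_distrib)
    finally show "f x + (\<Sum>i\<in>I. D x i * (y i - x i)) \<le> f y"
      unfolding f_def using soft_max_subgradient[OF Q(1) Qne k(1), of "v x" "v y"] by simp
  qed
  have gm: "(\<lambda>y. ennreal (exp (- l * f y))) \<in> borel_measurable ?\<gamma>" using fm by measurable
  let ?J = "\<integral>\<^sup>+y. ennreal (exp (- l * f y)) \<partial>?\<gamma>"
  \<comment> \<open>The first variable is restricted to \<open>A\<close>, where \<open>f\<close> is
    bounded below, so the concentration of \<open>f x - f y\<close> becomes a bound for
    \<open>- f y\<close> alone.\<close>
  have "ennreal (exp (- l * (a + 1))) * (ennreal p * ?J) \<le> ennreal (exp (- l * (a + 1))) * (emeasure ?\<gamma> A * ?J)"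
    using A(3) p(1) by (intro mult_left_mono mult_right_mono) (auto simp: P.emeasure_eq_measure intro: ennreal_leI)
  also have "\<dots> = (\<integral>\<^sup>+x. ennreal (exp (- l * (a + 1))) * ?J * indicator A x \<partial>?\<gamma>)"
    using A(1) by (subst nn_integral_cmult_indicator) (auto simp: mult_ac)
  also have "\<dots> \<le> (\<integral>\<^sup>+x. \<integral>\<^sup>+y. ennreal (exp (l * (f x - f y))) \<partial>?\<gamma> \<partial>?\<gamma>)"
  proof (rule nn_integral_mono)
    fix x assume "x \<in> space ?\<gamma>"
    have "(\<integral>\<^sup>+y. ennreal (exp (l * (f x - f y))) \<partial>?\<gamma>)
        = (\<integral>\<^sup>+y. ennreal (exp (l * f x)) * ennreal (exp (- l * f y)) \<partial>?\<gamma>)"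
      by (intro nn_integral_cong) (simp add: ennreal_mult'[symmetric] mult_exp_exp algebra_simps)
    also have "\<dots> = ennreal (exp (l * f x)) * ?J" by (rule nn_integral_cmult[OF gm])
    finally have e: "(\<integral>\<^sup>+y. ennreal (exp (l * (f x - f y))) \<partial>?\<gamma>) = ennreal (exp (l * f x)) * ?J" .
    show "ennreal (exp (- l * (a + 1))) * ?J * indicator A x \<le> (\<integral>\<^sup>+y. ennreal (exp (l * (f x - f y))) \<partial>?\<gamma>)"
    proof (cases "x \<in> A")
      case True
      have "- l * (a + 1) \<le> l * f x" using mult_left_mono[OF fA[OF True] l] by (simp add: algebra_simps)
      then have "ennreal (exp (- l * (a + 1))) \<le> ennreal (exp (l * f x))" by (intro ennreal_leI) simp
      then show ?thesis unfolding e using True by (simp add: mult_right_mono)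
    qed simp
  qed
  finally have main: "ennreal (exp (- l * (a + 1))) * (ennreal p * ?J) \<le> ennreal (3 * exp (l\<^sup>2 * pi\<^sup>2 * K\<^sup>2 / 8))"
    using conc by (rule order_trans)
  have "(\<integral>\<^sup>+y. ennreal (exp (- l * F y)) \<partial>?\<gamma>) \<le> (\<integral>\<^sup>+y. ennreal (exp l) * ennreal (exp (- l * f y)) \<partial>?\<gamma>)"
  proof (rule nn_integral_mono)
    fix y assume "y \<in> space ?\<gamma>"
    have "- l * F y \<le> l + - l * f y" using mult_left_mono[OF fF[OF \<open>y \<in> space ?\<gamma>\<close>] l] by (simp add: distrib_left)
    then have "exp (- l * F y) \<le> exp l * exp (- l * f y)" by (simp add: mult_exp_exp)
    then show "ennreal (exp (- l * F y)) \<le> ennreal (exp l) * ennreal (exp (- l * f y))"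
      by (simp add: ennreal_mult'[symmetric] ennreal_leI)
  qed
  also have "\<dots> = ennreal (exp l) * ?J" by (rule nn_integral_cmult[OF gm])
  finally have "ennreal p * (\<integral>\<^sup>+y. ennreal (exp (- l * F y)) \<partial>?\<gamma>) \<le> ennreal p * (ennreal (exp l) * ?J)"
    by (rule mult_left_mono) simp
  also have "\<dots> = ennreal (exp (l * (a + 2))) * (ennreal (exp (- l * (a + 1))) * (ennreal p * ?J))"
  proof -
    have "ennreal (exp (l * (a + 2))) * ennreal (exp (- l * (a + 1))) = ennreal (exp l)"
      by (simp add: ennreal_mult'[symmetric] mult_exp_exp algebra_simps)
    then have "ennreal (exp (l * (a + 2))) * (ennreal (exp (- l * (a + 1))) * X) = ennreal (exp l) * X" for X
      by (simp only: mult.assoc[symmetric])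
    then show ?thesis by (simp only: mult.left_commute[of "ennreal p"])
  qed
  also have "\<dots> \<le> ennreal (exp (l * (a + 2))) * ennreal (3 * exp (l\<^sup>2 * pi\<^sup>2 * K\<^sup>2 / 8))"
    by (rule mult_left_mono[OF main]) simp
  also have "\<dots> = ennreal (3 * exp (l\<^sup>2 * pi\<^sup>2 * K\<^sup>2 / 8 + l * (a + 2)))"
    by (subst ennreal_mult''[symmetric]) (simp_all add: exp_add mult_ac)
  finally show ?thesis .
qed

section \<open>The covariance matrix\<close>

lemma op_norm_scaled:
  assumes "op_norm n (\<lambda>i j. c * A i j) \<le> X" "c > 0"
  shows "op_norm n A \<le> X / c"
  unfolding op_norm_le_iff
proof (intro allI impI)
  fix x assume "L2_set x {..<n} \<le> 1"
  then have "L2_set (\<lambda>i. \<Sum>j<n. c * A i j * x j) {..<n} \<le> X"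
    using assms(1) by (simp add: op_norm_le_iff)
  also have "L2_set (\<lambda>i. \<Sum>j<n. c * A i j * x j) {..<n} = c * L2_set (\<lambda>i. \<Sum>j<n. A i j * x j) {..<n}"
    using assms(2) by (subst L2_set_right_distrib) (simp_all add: sum_distrib_left mult.assoc)
  finally show "L2_set (\<lambda>i. \<Sum>j<n. A i j * x j) {..<n} \<le> X / c"
    using assms(2) by (simp add: pos_le_divide_eq mult.commute)
qed

lemma sk_avg_cmult: "sk_avg n z g (\<lambda>\<sigma>. a * F \<sigma>) = a * sk_avg n z g F"
  unfolding sk_avg_def by (simp add: sum_distrib_left mult_ac)

lemma sk_avg_diff: "sk_avg n z g (\<lambda>\<sigma>. F \<sigma> - G \<sigma>) = sk_avg n z g F - sk_avg n z g G"
  unfolding sk_avg_def by (simp add: right_diff_distrib sum_subtractf)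

lemma sk_avg_sum: "sk_avg n z g (\<lambda>\<sigma>. \<Sum>k\<in>A. F k \<sigma>) = (\<Sum>k\<in>A. sk_avg n z g (F k))"
  unfolding sk_avg_def by (subst sum.swap) (simp add: sum_distrib_left)

text \<open>An algebraic identity for each disorder: the averaged definition of the residual. All
  probabilistic content lies in the smallness of \<open>sk_Y\<close>.\<close>

lemma sk_resolvent_identity:
  "(1 + z\<^sup>2) * sk_Q n z g i j - z * (\<Sum>k<n. of_real (coupling n g i k) * sk_Q n z g k j)
    = sk_Y n z g i j + (if i = j then sk_Z n z g else 0)"
proof -
  have "sk_Y n z g i j = sk_avg n z g (\<lambda>\<sigma>. (1 + z\<^sup>2) * (of_real (\<sigma> i) * of_real (\<sigma> j))
      - z * (\<Sum>k<n. of_real (coupling n g i k) * (of_real (\<sigma> k) * of_real (\<sigma> j))) - (if i = j then 1 else 0) * 1)"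
    unfolding sk_Y_def resid_def resid_vec_def local_field_def
    by (intro arg_cong[where f = "sk_avg n z g"] ext) (simp add: left_diff_distrib sum_distrib_right mult.assoc)
  also have "\<dots> = (1 + z\<^sup>2) * sk_Q n z g i j - z * (\<Sum>k<n. of_real (coupling n g i k) * sk_Q n z g k j)
      - (if i = j then 1 else 0) * sk_Z n z g"
    unfolding sk_avg_diff sk_avg_cmult sk_avg_sum sk_Q_def sk_Z_def ..
  finally show ?thesis by simp
qed

lemma holomorphic_sk_avg: "(\<And>\<sigma>. (\<lambda>z. F z \<sigma>) holomorphic_on UNIV) \<Longrightarrow> (\<lambda>z. sk_avg n z g (F z)) holomorphic_on UNIV"
  unfolding sk_avg_def by (intro holomorphic_intros) auto

lemma holomorphic_sk_Q: "(\<lambda>z. sk_Q n z g i j) holomorphic_on UNIV"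
  unfolding sk_Q_def by (intro holomorphic_sk_avg holomorphic_intros)

lemma continuous_sk_Z: "continuous_on UNIV (\<lambda>z. sk_Z n z g)"
  unfolding sk_Z_def by (intro holomorphic_on_imp_continuous_on holomorphic_sk_avg holomorphic_intros)

lemma continuous_sk_Y: "continuous_on UNIV (\<lambda>z. sk_Y n z g i j)"
  unfolding sk_Y_def resid_def resid_vec_def
  by (intro holomorphic_on_imp_continuous_on holomorphic_sk_avg holomorphic_intros)

section \<open>Measurability in the disorder and the temperature\<close>

lemma measurable_disorder_coord: "e \<in> site_pairs n \<Longrightarrow> (\<lambda>g. g e) \<in> borel_measurable (disorder n)"
  unfolding disorder_eq by (rule measurable_gauss_component)

lemma measurable_sk_ham: "(\<lambda>g. sk_ham n g \<sigma>) \<in> borel_measurable (disorder n)"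
  unfolding sk_ham_def by (intro borel_measurable_sum borel_measurable_times borel_measurable_const measurable_disorder_coord)

lemma measurable_local_field: "i < n \<Longrightarrow> (\<lambda>g. local_field n g \<sigma> i) \<in> borel_measurable (disorder n)"
  by (simp only: local_field_eq)
     (intro borel_measurable_sum borel_measurable_times borel_measurable_const measurable_disorder_coord)

lemma measurable_sk_avg:
  assumes [measurable]: "z \<in> borel_measurable M" "g \<in> measurable M (disorder n)"
    and [measurable]: "\<And>\<sigma>. F \<sigma> \<in> borel_measurable M"
  shows "(\<lambda>x. sk_avg n (z x) (g x) (\<lambda>\<sigma>. F \<sigma> x)) \<in> borel_measurable M"
proof -
  have [measurable]: "(\<lambda>x. sk_ham n (g x) \<sigma>) \<in> borel_measurable M" for \<sigma>
    by (rule measurable_compose[OF assms(2) measurable_sk_ham])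
  show ?thesis unfolding sk_avg_def by measurable
qed

lemma measurable_sk_Z:
  assumes "z \<in> borel_measurable M" "g \<in> measurable M (disorder n)"
  shows "(\<lambda>x. sk_Z n (z x) (g x)) \<in> borel_measurable M"
  unfolding sk_Z_def by (intro measurable_sk_avg assms) auto

lemma measurable_sk_Y:
  assumes [measurable]: "z \<in> borel_measurable M" "g \<in> measurable M (disorder n)" and i: "i < n"
  shows "(\<lambda>x. sk_Y n (z x) (g x) i j) \<in> borel_measurable M"
proof -
  have [measurable]: "(\<lambda>x. local_field n (g x) \<sigma> i) \<in> borel_measurable M" for \<sigma>
    by (rule measurable_compose[OF assms(2) measurable_local_field[OF i]])
  show ?thesis
    unfolding sk_Y_def resid_def resid_vec_def by (intro measurable_sk_avg assms) measurable
qed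

section \<open>The normalized partition function and its negative moment\<close>

definition sk_ratio :: "nat \<Rightarrow> real \<Rightarrow> (nat \<times> nat \<Rightarrow> real) \<Rightarrow> real" where
  "sk_ratio n b g = exp (- (b\<^sup>2 * (real n - 1) / 4)) / 2 ^ n * sk_partition n b g"

lemma sk_ratio_pos: "sk_ratio n b g > 0"
  unfolding sk_ratio_def using sk_partition_pos by (intro mult_pos_pos divide_pos_pos) auto

lemma sk_avg_of_real:
  "sk_avg n (of_real b) g (\<lambda>\<sigma>. of_real (F \<sigma>)) = of_real (\<Sum>\<sigma>\<in>spin_configs n.
    exp (- (b\<^sup>2 * (real n - 1) / 4)) / 2 ^ n * sk_weight n b g \<sigma> * F \<sigma>)"
  unfolding sk_avg_def sk_weight_eq by (simp add: exp_of_real[symmetric])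

lemma sk_Z_of_real: "sk_Z n (of_real b) g = of_real (sk_ratio n b g)"
  using sk_avg_of_real[of n b g "\<lambda>_. 1"]
  by (simp add: sk_Z_def sk_ratio_def sk_partition_def sum_distrib_left)

lemma sk_Q_of_real: "sk_Q n (of_real b) g i j = of_real (sk_ratio n b g * sk_cov n b g i j)"
proof -
  let ?C = "spin_configs n"
  have "sk_Q n (of_real b) g i j = of_real (\<Sum>\<sigma>\<in>?C.
      exp (- (b\<^sup>2 * (real n - 1) / 4)) / 2 ^ n * sk_weight n b g \<sigma> * (\<sigma> i * \<sigma> j))"
    using sk_avg_of_real[of n b g "\<lambda>\<sigma>. \<sigma> i * \<sigma> j"] by (simp add: sk_Q_def)
  also have "(\<Sum>\<sigma>\<in>?C. exp (- (b\<^sup>2 * (real n - 1) / 4)) / 2 ^ n * sk_weight n b g \<sigma> * (\<sigma> i * \<sigma> j))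
      = sk_ratio n b g * sk_cov n b g i j"
    unfolding sk_cov_def sk_gibbs_integral sk_ratio_def sum_distrib_left
    using sk_partition_pos[of n b g] by (intro sum.cong) auto
  finally show ?thesis .
qed

lemma measurable_sk_ratio: "sk_ratio n b \<in> borel_measurable (disorder n)"
proof -
  have "(\<lambda>g. Re (sk_Z n (of_real b) g)) \<in> borel_measurable (disorder n)"
    by (intro measurable_compose[OF _ borel_measurable_Re] measurable_sk_Z) auto
  then show ?thesis by (simp add: sk_Z_of_real)
qed

text \<open>The two-replica formula with the second replica at temperature parameter 0, whose
  normalized partition function is 1.\<close>

lemma sk_ratio_mean_one:
  assumes "n \<ge> 1"
  shows "has_bochner_integral (disorder n) (sk_ratio n b) 1"
proof -
  let ?C = "spin_configs n"
  let ?x = "complex_of_real b"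
  have Z0: "sk_Z n 0 g = 1" for g
    unfolding sk_Z_def sk_avg_def by (simp add: card_spin_configs)
  have "has_bochner_integral (disorder n) (\<lambda>g. \<Sum>\<sigma>\<in>?C. \<Sum>\<tau>\<in>?C. pair_weight n \<sigma> \<tau> ?x 0 g)
      (\<Sum>\<sigma>\<in>?C. \<Sum>\<tau>\<in>?C. cw_weight n \<sigma> \<tau> (?x * 0))"
    by (intro has_bochner_integral_sum integral_pair_weight assms)
  moreover have "(\<Sum>\<sigma>\<in>?C. \<Sum>\<tau>\<in>?C. pair_weight n \<sigma> \<tau> ?x 0 g) = of_real (sk_ratio n b g)" for g
  proof -
    have "(\<Sum>\<sigma>\<in>?C. \<Sum>\<tau>\<in>?C. pair_weight n \<sigma> \<tau> ?x 0 g) = sk_Z n ?x g * sk_Z n 0 g"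
      unfolding sk_Z_def sk_avg_mult by simp
    then show ?thesis by (simp add: Z0 sk_Z_of_real)
  qed
  moreover have "(\<Sum>\<sigma>\<in>?C. \<Sum>\<tau>\<in>?C. cw_weight n \<sigma> \<tau> (?x * 0)) = 1"
    by (simp add: cw_weight_def card_spin_configs)
  ultimately have "has_bochner_integral (disorder n) (\<lambda>g. complex_of_real (sk_ratio n b g)) 1" by simp
  from has_bochner_integral_bounded_linear[OF bounded_linear_Re this] show ?thesis by simp
qed

text \<open>Up to a constant the logarithm is a soft maximum, with \<open>k = 1\<close>, of
  functions linear in the couplings; its gradient consists of the covariances times
  \<open>b / sqrt n\<close>.\<close>

lemma sk_log_ratio_convex:
  "ln (sk_ratio n b g) + (\<Sum>e\<in>site_pairs n. b / sqrt (real n) * sk_cov n b g (fst e) (snd e) * (g' e - g e))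
    \<le> ln (sk_ratio n b g')"
proof -
  let ?C = "spin_configs n"
  let ?v = "\<lambda>g \<sigma>. b * sk_ham n g \<sigma>"
  have sm: "soft_max ?C 1 (?v g) = ln (sk_partition n b g)" for g
    by (simp add: soft_max_def sk_partition_def sk_weight_eq)
  have sw: "soft_weight ?C 1 (?v g) \<sigma> = sk_weight n b g \<sigma> / sk_partition n b g" for \<sigma>
    by (simp add: soft_weight_def sk_partition_def sk_weight_eq)
  have lr: "ln (sk_ratio n b g) = ln (exp (- (b\<^sup>2 * (real n - 1) / 4)) / 2 ^ n) + ln (sk_partition n b g)" for g
    unfolding sk_ratio_def using sk_partition_pos[of n b g] by (intro ln_mult_pos) auto
  have ham: "b * sk_ham n g' \<sigma> - b * sk_ham n g \<sigma>
      = (\<Sum>e\<in>site_pairs n. b / sqrt (real n) * (\<sigma> (fst e) * \<sigma> (snd e)) * (g' e - g e))" for \<sigma>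
    unfolding sk_ham_def sum_distrib_left sum_subtractf[symmetric] by (intro sum.cong refl)
        (simp add: algebra_simps diff_divide_distrib)
  have "(\<Sum>e\<in>site_pairs n. b / sqrt (real n) * sk_cov n b g (fst e) (snd e) * (g' e - g e))
      = (\<Sum>e\<in>site_pairs n. \<Sum>\<sigma>\<in>?C. sk_weight n b g \<sigma> / sk_partition n b g *
          (b / sqrt (real n) * (\<sigma> (fst e) * \<sigma> (snd e)) * (g' e - g e)))"
    unfolding sk_cov_def sk_gibbs_integral sum_distrib_left sum_distrib_right by (intro sum.cong refl)
        (simp only: mult_ac)
  also have "\<dots> = (\<Sum>\<sigma>\<in>?C. soft_weight ?C 1 (?v g) \<sigma> * (?v g' \<sigma> - ?v g \<sigma>))"
    by (subst sum.swap) (simp only: sw ham sum_distrib_left)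
  finally show ?thesis
    using soft_max_subgradient[OF finite_spin_configs spin_configs_nonempty zero_less_one, of n "?v g" "?v g'"]
    unfolding sm lr by simp
qed

lemma sum_site_pairs_square_le:
  "(\<Sum>e\<in>site_pairs n. (c (fst e) (snd e))\<^sup>2) \<le> (\<Sum>i<n. \<Sum>j<n. (c i j :: real)\<^sup>2)"
proof -
  have "(\<Sum>e\<in>site_pairs n. (c (fst e) (snd e))\<^sup>2) \<le> (\<Sum>e\<in>{..<n} \<times> {..<n}. (c (fst e) (snd e))\<^sup>2)"
    by (intro sum_mono2) (auto simp: site_pairs_def)
  then show ?thesis by (simp add: sum.cartesian_product case_prod_beta)
qed

text \<open>A second-moment argument of Paley--Zygmund type that also keeps the Hilbert--Schmidt
  norm of the covariance under control: the mean 1 of the ratio cannot come only from disorders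
  where the ratio is small or this norm is large.\<close>

lemma good_disorder_measure:
  assumes n: "n \<ge> 1" and b: "0 \<le> b" "b < 1"
  defines "C \<equiv> 64 / (1 - b\<^sup>2) ^ 3"
  defines "B \<equiv> {g \<in> space (disorder n). 1 / 2 \<le> sk_ratio n b g \<and> (\<Sum>i<n. \<Sum>j<n. (sk_cov n b g i j)\<^sup>2) \<le> 8 * C * real n}"
  shows "B \<in> sets (disorder n)" "1 / (32 * C) < measure (disorder n) B"
proof -
  let ?\<gamma> = "disorder n" and ?Z = "sk_ratio n b" and ?V = "\<lambda>g. \<Sum>i<n. \<Sum>j<n. (sk_cov n b g i j)\<^sup>2"
  interpret P: prob_space ?\<gamma> by (rule prob_space_disorder)
  have b2: "b\<^sup>2 < 1" using b by (simp add: power_less_one_iff)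
  have C: "C > 0" unfolding C_def using b2 by (intro divide_pos_pos) auto
  have n0: "real n > 0" using n by simp
  have cb: "cmod (of_real b) < 1" "(cmod (of_real b))\<^sup>2 = b\<^sup>2" using b by auto
  note [measurable] = measurable_sk_ratio measurable_sk_cov
  show Bm: "B \<in> sets ?\<gamma>" unfolding B_def by measurable
  have Z2: "integrable ?\<gamma> (\<lambda>g. (?Z g)\<^sup>2)" "(\<integral>g. (?Z g)\<^sup>2 \<partial>?\<gamma>) \<le> C"
    using integral_sk_Z[OF n, of "of_real b"] integral_sk_Z_le[OF n cb(1)]
    by (simp_all add: sk_Z_of_real has_bochner_integral_iff C_def)
  have Qeq: "(\<Sum>i<n. \<Sum>j<n. (cmod (sk_Q n (of_real b) g i j))\<^sup>2) = (?Z g)\<^sup>2 * ?V g" for g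
    by (simp add: sk_Q_of_real norm_mult power_mult_distrib sum_distrib_left)
  have Q2: "integrable ?\<gamma> (\<lambda>g. (?Z g)\<^sup>2 * ?V g)" "(\<integral>g. (?Z g)\<^sup>2 * ?V g \<partial>?\<gamma>) \<le> real n * C"
    using integral_sk_Q[OF n, of "of_real b"] integral_sk_Q_le[OF n cb(1)] cb(2)
    unfolding Qeq by (simp_all add: has_bochner_integral_iff C_def)
  have Z1: "integrable ?\<gamma> ?Z" "(\<integral>g. ?Z g \<partial>?\<gamma>) = 1"
    using sk_ratio_mean_one[OF n, of b] by (auto simp: has_bochner_integral_iff)
  \<comment> \<open>One summand for each case: a small ratio; large covariances, where
    \<open>?Z g \<ge> 1 / 2\<close> and \<open>?V g > 8 * C * n\<close> combine; and the good set,
    by completing a square.\<close>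
  have pw: "?Z g \<le> 1 / 2 + 1 / (4 * C * real n) * ((?Z g)\<^sup>2 * ?V g) +
      (1 / (8 * C) * (?Z g)\<^sup>2 + 2 * C * indicator B g)"
    if g: "g \<in> space ?\<gamma>" for g
  proof -
    have Zp: "?Z g > 0" by (rule sk_ratio_pos)
    have V0: "?V g \<ge> 0" by (intro sum_nonneg) auto
    have t1: "1 / (4 * C * real n) * ((?Z g)\<^sup>2 * ?V g) \<ge> 0" using C n0 V0 by (intro mult_nonneg_nonneg) auto
    have t2: "1 / (8 * C) * (?Z g)\<^sup>2 \<ge> 0" using C by simp
    consider "?Z g < 1 / 2" | "?Z g \<ge> 1 / 2" "?V g > 8 * C * real n" | "g \<in> B"
      using g unfolding B_def by (cases "?Z g < 1 / 2"; cases "?V g > 8 * C * real n") (auto simp: not_less)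
    then show ?thesis
    proof cases
      case 1
      have "2 * C * indicator B g \<ge> 0" using C by simp
      then show ?thesis using 1 t1 t2 by linarith
    next
      case 2
      have "?Z g = 1 / (4 * C * real n) * (1 / 2 * ?Z g * (8 * C * real n))" using C n0 by simp
      also have "\<dots> \<le> 1 / (4 * C * real n) * (?Z g * ?Z g * ?V g)"
        using 2 Zp C n0 V0 by (intro mult_left_mono mult_mono) auto
      finally have "?Z g \<le> 1 / (4 * C * real n) * ((?Z g)\<^sup>2 * ?V g)" by (simp add: power2_eq_square)
      moreover have "2 * C * indicator B g \<ge> 0" using C by simp
      ultimately show ?thesis using t2 by linarith
    next
      case 3
      have "0 \<le> (?Z g - 4 * C)\<^sup>2 / (8 * C)" using C by simp
      also have "(?Z g - 4 * C)\<^sup>2 / (8 * C) = 1 / (8 * C) * (?Z g)\<^sup>2 - ?Z g + 2 * C"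
        using C by (simp add: power2_diff power2_eq_square field_simps)
      finally show ?thesis using 3 t1 by simp
    qed
  qed
  have iB: "integrable ?\<gamma> (\<lambda>g. indicator B g :: real)"
    using Bm by (intro integrable_real_indicator) (auto simp: P.emeasure_eq_measure)
  have "1 = (\<integral>g. ?Z g \<partial>?\<gamma>)" using Z1 by simp
  also have "\<dots> \<le> (\<integral>g. 1 / 2 + 1 / (4 * C * real n) * ((?Z g)\<^sup>2 * ?V g) +
      (1 / (8 * C) * (?Z g)\<^sup>2 + 2 * C * indicator B g) \<partial>?\<gamma>)"
    by (intro integral_mono Z1 pw Bochner_Integration.integrable_add P.integrable_const integrable_mult_right Q2 Z2 iB)
  also have "\<dots> = 1 / 2 + 1 / (4 * C * real n) * (\<integral>g. (?Z g)\<^sup>2 * ?V g \<partial>?\<gamma>) +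
      (1 / (8 * C) * (\<integral>g. (?Z g)\<^sup>2 \<partial>?\<gamma>) + 2 * C * measure ?\<gamma> B)"
  proof -
    note i = Bochner_Integration.integrable_add P.integrable_const integrable_mult_right Q2(1) Z2(1) iB
    have "(\<integral>g. 1 / 2 + 1 / (4 * C * real n) * ((?Z g)\<^sup>2 * ?V g) + (1 / (8 * C) * (?Z g)\<^sup>2 + 2 * C * indicator B g)
        \<partial>?\<gamma>)
        = (\<integral>g. 1 / 2 + 1 / (4 * C * real n) * ((?Z g)\<^sup>2 * ?V g) \<partial>?\<gamma>) +
          (\<integral>g. 1 / (8 * C) * (?Z g)\<^sup>2 + 2 * C * indicator B g \<partial>?\<gamma>)"
      by (intro Bochner_Integration.integral_add i)
    also have "(\<integral>g. 1 / 2 + 1 / (4 * C * real n) * ((?Z g)\<^sup>2 * ?V g) \<partial>?\<gamma>)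
        = (\<integral>g. 1 / 2 \<partial>?\<gamma>) + (\<integral>g. 1 / (4 * C * real n) * ((?Z g)\<^sup>2 * ?V g) \<partial>?\<gamma>)"
      by (intro Bochner_Integration.integral_add i)
    also have "(\<integral>g. 1 / (8 * C) * (?Z g)\<^sup>2 + 2 * C * indicator B g \<partial>?\<gamma>)
        = (\<integral>g. 1 / (8 * C) * (?Z g)\<^sup>2 \<partial>?\<gamma>) + (\<integral>g. 2 * C * indicator B g \<partial>?\<gamma>)"
      by (intro Bochner_Integration.integral_add i)
    also have "(\<integral>g. 2 * C * indicator B g \<partial>?\<gamma>) = 2 * C * measure ?\<gamma> B"
      using sets.sets_into_space[OF Bm] by (simp add: Int_absorb2)
    finally show ?thesis by (simp add: P.prob_space)
  qed
  also have "\<dots> \<le> 1 / 2 + 1 / (4 * C * real n) * (real n * C) + (1 / (8 * C) * C + 2 * C * measure ?\<gamma> B)"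
    using Q2(2) Z2(2) C n0 by (intro add_mono mult_left_mono) auto
  \<comment> \<open>The bad contributions are \<open>1 / 2\<close>, \<open>1 / 4\<close> and
    \<open>1 / 8\<close>, leaving \<open>1 / 8\<close> for the good set. Its mass is thus at least
    \<open>1 / (16 * C)\<close>, halved at the end to make the bound strict.\<close>
  also have "\<dots> = 7 / 8 + 2 * C * measure ?\<gamma> B" using C n0 by simp
  finally have "1 / 8 \<le> 2 * C * measure ?\<gamma> B" by simp
  then have "1 / (16 * C) \<le> measure ?\<gamma> B" using C by (simp add: field_simps)
  moreover have "1 / (32 * C) < 1 / (16 * C)" using C by (intro divide_strict_left_mono) auto
  ultimately show "1 / (32 * C) < measure ?\<gamma> B" by simp
qed

text \<open>The lower tail bound with \<open>l = 2\<close>, \<open>a = ln 2\<close> from the ratio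
  being at least \<open>1 / 2\<close>, and \<open>K\<^sup>2 = 8 * C\<close>: on the good set the
  squared gradient is at most \<open>b\<^sup>2 / n\<close> times \<open>8 * C * n\<close>.\<close>

lemma sk_ratio_negative_moment:
  assumes n: "n \<ge> 1" and b: "0 \<le> b" "b < 1"
  defines "C \<equiv> 64 / (1 - b\<^sup>2) ^ 3"
  shows "ennreal (1 / (32 * C)) * (\<integral>\<^sup>+g. ennreal (1 / (sk_ratio n b g)\<^sup>2) \<partial>disorder n)
    \<le> ennreal (3 * exp (2\<^sup>2 * pi\<^sup>2 * (sqrt (8 * C))\<^sup>2 / 8 + 2 * (ln 2 + 2)))"
proof -
  define B where "B = {g \<in> space (disorder n). 1 / 2 \<le> sk_ratio n b g \<and> (\<Sum>i<n. \<Sum>j<n. (sk_cov n b g i j)\<^sup>2)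
      \<le> 8 * C * real n}"
  have B: "B \<in> sets (disorder n)" "1 / (32 * C) < measure (disorder n) B"
    using good_disorder_measure[OF n b] by (simp_all add: B_def C_def)
  have b2: "b\<^sup>2 < 1" using b by (simp add: power_less_one_iff)
  have C: "C > 0" unfolding C_def using b2 by (intro divide_pos_pos) auto
  let ?G = "\<lambda>g e. b / sqrt (real n) * sk_cov n b g (fst e) (snd e)"
  have "ennreal (1 / (32 * C)) * (\<integral>\<^sup>+g. ennreal (exp (- 2 * ln (sk_ratio n b g))) \<partial>gauss_measure (site_pairs n))
      \<le> ennreal (3 * exp (2\<^sup>2 * pi\<^sup>2 * (sqrt (8 * C))\<^sup>2 / 8 + 2 * (ln 2 + 2)))"
  proof (rule gauss_convex_lower_tail[OF finite_site_pairs, where B = B and G = ?G])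
    show "B \<in> sets (gauss_measure (site_pairs n))" "1 / (32 * C) < measure (gauss_measure (site_pairs n)) B"
      using B by (simp_all add: disorder_eq)
    show "ln (sk_ratio n b x) + (\<Sum>i\<in>site_pairs n. ?G x i * (y i - x i)) \<le> ln (sk_ratio n b y)" for x y
      by (rule sk_log_ratio_convex)
    show "- ln 2 \<le> ln (sk_ratio n b x)" if "x \<in> B" for x
    proof -
      have "ln (1 / 2) \<le> ln (sk_ratio n b x)" using that sk_ratio_pos[of n b x] by (subst ln_le_cancel_iff)
          (auto simp: B_def)
      then show ?thesis by (simp add: ln_div)
    qed
    show "(\<Sum>e\<in>site_pairs n. (?G x e)\<^sup>2) \<le> (sqrt (8 * C))\<^sup>2" if "x \<in> B" for x
    proof -
      have n0: "real n > 0" using n by simp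
      have "(\<Sum>e\<in>site_pairs n. (?G x e)\<^sup>2) = b\<^sup>2 / real n * (\<Sum>e\<in>site_pairs n. (sk_cov n b x (fst e) (snd e))\<^sup>2)"
        by (simp add: power_mult_distrib power_divide sum_distrib_left)
      also have "\<dots> \<le> 1 / real n * (8 * C * real n)"
        using b2 n0 that order_trans[OF sum_site_pairs_square_le[where c = "sk_cov n b x"]]
        by (intro mult_mono divide_right_mono) (auto simp: B_def intro!: sum_nonneg)
      also have "\<dots> = (sqrt (8 * C))\<^sup>2" using n0 C by simp
      finally show ?thesis .
    qed
  qed (use C in auto)
  moreover have "exp (- 2 * ln (sk_ratio n b g)) = 1 / (sk_ratio n b g)\<^sup>2" for g
  proof -
    have "exp (- 2 * ln (sk_ratio n b g)) = 1 / (exp (ln (sk_ratio n b g)) * exp (ln (sk_ratio n b g)))"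
      by (simp add: exp_minus exp_add[symmetric] divide_inverse)
    then show ?thesis using sk_ratio_pos[of n b g] by (simp add: power2_eq_square)
  qed
  ultimately show ?thesis by (simp only: disorder_eq)
qed

section \<open>Averaging over the circle and the disorder\<close>

definition circle_point :: "real \<Rightarrow> real \<Rightarrow> complex" where
  "circle_point r t = of_real r * exp (2 * of_real pi * \<i> * of_real t)"

lemma cmod_circle_point: "0 \<le> r \<Longrightarrow> cmod (circle_point r t) = r"
  by (simp add: circle_point_def norm_mult)

lemma measurable_circle_point: "circle_point r \<in> borel_measurable borel"
  unfolding circle_point_def by (intro borel_measurable_continuous_onI continuous_intros)

definition sk_energy :: "nat \<Rightarrow> complex \<Rightarrow> (nat \<times> nat \<Rightarrow> real) \<Rightarrow> real" where
  "sk_energy n z g = (cmod (sk_Z n z g))\<^sup>2 + (\<Sum>i<n. \<Sum>j<n. (cmod (sk_Y n z g i j))\<^sup>2)"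

lemma sk_energy_nonneg: "sk_energy n z g \<ge> 0"
  unfolding sk_energy_def by (intro add_nonneg_nonneg sum_nonneg) auto

lemma measurable_sk_energy:
  assumes "z \<in> borel_measurable M" "g \<in> measurable M (disorder n)"
  shows "(\<lambda>x. sk_energy n (z x) (g x)) \<in> borel_measurable M"
proof -
  have "(\<lambda>x. cmod (sk_Y n (z x) (g x) i j)) \<in> borel_measurable M" if "i < n" for i j
    by (rule measurable_compose[OF measurable_sk_Y[OF assms that] borel_measurable_norm])
  moreover have "(\<lambda>x. cmod (sk_Z n (z x) (g x))) \<in> borel_measurable M"
    by (rule measurable_compose[OF measurable_sk_Z[OF assms] borel_measurable_norm])
  ultimately show ?thesis
    unfolding sk_energy_def by (intro borel_measurable_add borel_measurable_sum borel_measurable_power) auto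
qed

lemma nn_integral_sk_energy_le:
  assumes "n \<ge> 1" "cmod z < 1"
  shows "(\<integral>\<^sup>+g. ennreal (sk_energy n z g) \<partial>disorder n) \<le> ennreal (640 / (1 - (cmod z)\<^sup>2) ^ 3)"
proof -
  have Z: "integrable (disorder n) (\<lambda>g. (cmod (sk_Z n z g))\<^sup>2)"
    and Y: "integrable (disorder n) (\<lambda>g. \<Sum>i<n. \<Sum>j<n. (cmod (sk_Y n z g i j))\<^sup>2)"
    using integral_sk_Z[OF assms(1), of z] integral_sk_Y[OF assms(1), of z] by (auto simp: has_bochner_integral_iff)
  have "(\<integral>\<^sup>+g. ennreal (sk_energy n z g) \<partial>disorder n) = ennreal (\<integral>g. sk_energy n z g \<partial>disorder n)"
    using Z Y by (intro nn_integral_eq_integral AE_I2 sk_energy_nonneg) (simp add: sk_energy_def)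
  also have "(\<integral>g. sk_energy n z g \<partial>disorder n)
      = (\<integral>g. (cmod (sk_Z n z g))\<^sup>2 \<partial>disorder n) + (\<integral>g. (\<Sum>i<n. \<Sum>j<n. (cmod (sk_Y n z g i j))\<^sup>2) \<partial>disorder n)"
    unfolding sk_energy_def by (rule Bochner_Integration.integral_add[OF Z Y])
  also have "\<dots> \<le> 64 / (1 - (cmod z)\<^sup>2) ^ 3 + 9 * (64 / (1 - (cmod z)\<^sup>2) ^ 3)"
    by (intro add_mono integral_sk_Z_le integral_sk_Y_le assms)
  also have "\<dots> = 640 / (1 - (cmod z)\<^sup>2) ^ 3" by simp
  finally show ?thesis by (simp add: ennreal_leI)
qed

text \<open>A bound for each disorder in which the circle quantities and the inverse ratio appear
  additively, so that their expectations can be taken separately despite their dependence.\<close>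

lemma sk_cov_op_norm_le:
  assumes b: "0 \<le> b" "b < r" "r < 1"
  defines "K \<equiv> 2 * r ^ 3 / ((1 - r\<^sup>2) * (r - b) * (r\<^sup>2 - b\<^sup>2))"
  shows "ennreal (op_norm n (sk_cov n b g))
    \<le> (\<integral>\<^sup>+t. ennreal (K * (sk_energy n (circle_point r t) g + 1 / (sk_ratio n b g)\<^sup>2)) * indicator {0..1} t \<partial>lborel)"
proof -
  let ?e = "circle_point r" and ?z = "sk_ratio n b g"
  let ?Y = "\<lambda>t. \<Sum>i<n. \<Sum>j<n. (cmod (sk_Y n (?e t) g i j))\<^sup>2"
  let ?W = "\<lambda>t. cmod (sk_Z n (?e t) g) + sqrt (?Y t)"
  have z: "?z > 0" by (rule sk_ratio_pos)
  have r: "0 < r" "r\<^sup>2 < 1" "b\<^sup>2 < r\<^sup>2"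
    using b by (auto simp: power_less_one_iff intro: power_strict_mono)
  have K: "K \<ge> 0" unfolding K_def using r b by (intro divide_nonneg_nonneg mult_nonneg_nonneg) auto
  have Y0: "?Y t \<ge> 0" for t by (intro sum_nonneg) auto
  have cont: "continuous_on {0..1} ?W"
    unfolding circle_point_def
    by (intro continuous_intros continuous_on_compose2[OF continuous_sk_Z] continuous_on_compose2[OF continuous_sk_Y]) auto
  have "op_norm n (\<lambda>i j. ?z * sk_cov n b g i j) \<le> K * integral {0..1} ?W"
    unfolding K_def circle_point_def
    by (rule op_norm_circle_bound[where Q = "\<lambda>z. sk_Q n z g" and Z = "\<lambda>z. sk_Z n z g" and Y
        = "\<lambda>z. sk_Y n z g" and A = "coupling n g"])
      (use b in \<open>simp_all add: coupling_sym holomorphic_sk_Q continuous_sk_Z continuous_sk_Y sk_resolvent_identity sk_Q_of_real\<close>)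
  then have "op_norm n (sk_cov n b g) \<le> K * integral {0..1} ?W / ?z"
    using z by (rule op_norm_scaled)
  also have "\<dots> = integral {0..1} (\<lambda>t. K / ?z * ?W t)" by simp
  finally have "ennreal (op_norm n (sk_cov n b g)) \<le> ennreal (integral {0..1} (\<lambda>t. K / ?z * ?W t))"
    by (rule ennreal_leI)
  also have "\<dots> = (\<integral>\<^sup>+t. ennreal (K / ?z * ?W t) * indicator {0..1} t \<partial>lborel)"
    using K z Y0
    by (intro nn_integral_has_integral_lebesgue'[symmetric] integrable_integral integrable_continuous_real continuous_intros cont)
      (auto intro!: mult_nonneg_nonneg add_nonneg_nonneg divide_nonneg_nonneg)
  also have "\<dots> \<le> (\<integral>\<^sup>+t. ennreal (K * (sk_energy n (?e t) g + 1 / ?z\<^sup>2)) * indicator {0..1} t \<partial>lborel)"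
  proof (intro nn_integral_mono mult_right_mono ennreal_leI)
    fix t
    \<comment> \<open>Applied to \<open>|Z|\<close>, the Hilbert--Schmidt norm of the error matrix,
      and the inverse ratio.\<close>
    have amgm: "(u + v) * w \<le> u\<^sup>2 + v\<^sup>2 + w\<^sup>2" for u v w :: real
    proof -
      have "0 \<le> (u + v - w)\<^sup>2 + (u - v)\<^sup>2 + w\<^sup>2" by simp
      also have "\<dots> = 2 * (u\<^sup>2 + v\<^sup>2 + w\<^sup>2 - (u + v) * w)"
        by (simp add: power2_eq_square algebra_simps)
      finally show ?thesis by simp
    qed
    have "?W t * (1 / ?z) \<le> (cmod (sk_Z n (?e t) g))\<^sup>2 + (sqrt (?Y t))\<^sup>2 + (1 / ?z)\<^sup>2" by (rule amgm)
    also have "\<dots> = sk_energy n (?e t) g + 1 / ?z\<^sup>2"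
      using Y0[of t] by (simp add: sk_energy_def power_divide)
    finally have "K * (?W t * (1 / ?z)) \<le> K * (sk_energy n (?e t) g + 1 / ?z\<^sup>2)"
      using K by (rule mult_left_mono)
    then show "K / ?z * ?W t \<le> K * (sk_energy n (?e t) g + 1 / ?z\<^sup>2)" by (simp add: mult_ac)
  qed simp
  finally show ?thesis .
qed

theorem theorem1p1:
  fixes \<beta> :: real
  assumes "0 \<le> \<beta>" and "\<beta> < 1"
  shows "\<exists>C :: real. \<forall>n :: nat. n \<ge> 1 \<longrightarrow>
           (\<integral>g. op_norm n (sk_cov n \<beta> g) \<partial>disorder n) \<le> C"
proof -
  \<comment> \<open>Any radius strictly between \<open>\<beta>\<close> and 1 would do: it must stay
    away from \<open>\<beta>\<close> for Cauchy's formula and from 1 for the second moments.\<close>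
  define r where "r = (1 + \<beta>) / 2"
  have r: "\<beta> < r" "r < 1" "0 < r" using assms by (auto simp: r_def)
  have b2: "\<beta>\<^sup>2 < 1" and r2: "r\<^sup>2 < 1" "\<beta>\<^sup>2 < r\<^sup>2"
    using assms r by (auto simp: power_less_one_iff intro: power_strict_mono)
  define K where "K = 2 * r ^ 3 / ((1 - r\<^sup>2) * (r - \<beta>) * (r\<^sup>2 - \<beta>\<^sup>2))"
  define D where "D = 64 / (1 - \<beta>\<^sup>2) ^ 3"
  define L where "L = 3 * exp (2\<^sup>2 * pi\<^sup>2 * (sqrt (8 * D))\<^sup>2 / 8 + 2 * (ln 2 + 2))"
  define E where "E = 640 / (1 - r\<^sup>2) ^ 3"
  have K: "K \<ge> 0" unfolding K_def using r r2 by (intro divide_nonneg_nonneg mult_nonneg_nonneg) auto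
  have D: "D > 0" unfolding D_def using b2 by (intro divide_pos_pos) auto
  have L: "L \<ge> 0" by (simp add: L_def)
  have E: "E \<ge> 0" unfolding E_def using r2 by (intro divide_nonneg_nonneg) auto
  show ?thesis
  proof (intro exI allI impI)
    fix n :: nat assume n: "n \<ge> 1"
    let ?\<gamma> = "disorder n" and ?f = "\<lambda>g t. sk_energy n (circle_point r t) g + 1 / (sk_ratio n \<beta> g)\<^sup>2"
    interpret P: prob_space ?\<gamma> by (rule prob_space_disorder)
    interpret Q: pair_sigma_finite lborel ?\<gamma> ..
    have neg: "(\<integral>\<^sup>+g. ennreal (1 / (sk_ratio n \<beta> g)\<^sup>2) \<partial>?\<gamma>) \<le> ennreal (32 * D * L)"
    proof -
      let ?J = "\<integral>\<^sup>+g. ennreal (1 / (sk_ratio n \<beta> g)\<^sup>2) \<partial>?\<gamma>"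
      have "?J = ennreal (32 * D) * (ennreal (1 / (32 * D)) * ?J)"
        using D by (simp add: mult.assoc[symmetric] ennreal_mult'[symmetric])
      also have "\<dots> \<le> ennreal (32 * D) * ennreal L"
        using sk_ratio_negative_moment[OF n assms] unfolding D_def L_def by (intro mult_left_mono) auto
      finally show ?thesis using D by (simp add: ennreal_mult'[symmetric])
    qed
    have sm: "(\<lambda>g. ennreal (1 / (sk_ratio n \<beta> g)\<^sup>2)) \<in> borel_measurable ?\<gamma>"
      using measurable_sk_ratio by measurable
    have em: "(\<lambda>g. ennreal (sk_energy n z g)) \<in> borel_measurable ?\<gamma>" for z
      by (intro measurable_compose[OF _ measurable_ennreal] measurable_sk_energy) auto
    have "(\<lambda>p. sk_energy n (circle_point r (fst p)) (snd p)) \<in> borel_measurable (lborel \<Otimes>\<^sub>M ?\<gamma>)"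
      by (intro measurable_sk_energy measurable_snd measurable_compose[OF measurable_fst] measurable_circle_point)
        (simp add: measurable_circle_point)
    moreover have "(\<lambda>p. sk_ratio n \<beta> (snd p)) \<in> borel_measurable (lborel \<Otimes>\<^sub>M ?\<gamma>)"
      by (rule measurable_compose[OF measurable_snd measurable_sk_ratio])
    ultimately have fm: "(\<lambda>(t, g). ennreal (K * ?f g t) * indicator {0..1} t) \<in> borel_measurable (lborel \<Otimes>\<^sub>M ?\<gamma>)"
      unfolding case_prod_beta by measurable
    have "ennreal (\<integral>g. op_norm n (sk_cov n \<beta> g) \<partial>?\<gamma>) = (\<integral>\<^sup>+g. ennreal (op_norm n (sk_cov n \<beta> g)) \<partial>?\<gamma>)"
      by (intro nn_integral_eq_integral[symmetric] integrable_op_norm_sk_cov AE_I2 op_norm_nonneg)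
    also have "\<dots> \<le> (\<integral>\<^sup>+g. (\<integral>\<^sup>+t. ennreal (K * ?f g t) * indicator {0..1} t \<partial>lborel) \<partial>?\<gamma>)"
      unfolding K_def using assms r by (intro nn_integral_mono sk_cov_op_norm_le) auto
    \<comment> \<open>With the disorder integrated first, the second moment bound applies at each
      point of the circle, uniformly because the modulus is constantly \<open>r\<close>.\<close>
    also have "\<dots> = (\<integral>\<^sup>+t. (\<integral>\<^sup>+g. ennreal (K * ?f g t) * indicator {0..1} t \<partial>?\<gamma>) \<partial>lborel)"
      by (rule Q.Fubini'[OF fm])
    also have "\<dots> \<le> (\<integral>\<^sup>+t. ennreal (K * (E + 32 * D * L)) * indicator {0..1} t \<partial>(lborel :: real measure))"
    proof (rule nn_integral_mono)
      fix t :: real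
      have "(\<integral>\<^sup>+g. ennreal (K * ?f g t) * indicator {0..1} t \<partial>?\<gamma>)
          = (\<integral>\<^sup>+g. indicator {0..1} t * ennreal K *
            (ennreal (sk_energy n (circle_point r t) g) + ennreal (1 / (sk_ratio n \<beta> g)\<^sup>2)) \<partial>?\<gamma>)"
        using K by (intro nn_integral_cong)
            (simp add: ennreal_mult' ennreal_plus sk_energy_nonneg mult_ac del: ennreal_plus[symmetric])
      also have "\<dots> = indicator {0..1} t * ennreal K * ((\<integral>\<^sup>+g. ennreal (sk_energy n (circle_point r t) g) \<partial>?\<gamma>)
          + (\<integral>\<^sup>+g. ennreal (1 / (sk_ratio n \<beta> g)\<^sup>2) \<partial>?\<gamma>))"
        using em sm by (simp add: nn_integral_cmult nn_integral_add)
      also have "\<dots> \<le> indicator {0..1} t * ennreal K * (ennreal E + ennreal (32 * D * L))"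
        using nn_integral_sk_energy_le[OF n, of "circle_point r t"] r neg
        by (intro mult_left_mono add_mono) (auto simp: cmod_circle_point E_def)
      also have "\<dots> = ennreal (K * (E + 32 * D * L)) * indicator {0..1} t"
        using K E D L by (simp add: ennreal_mult' mult_ac)
      finally show "(\<integral>\<^sup>+g. ennreal (K * ?f g t) * indicator {0..1} t \<partial>?\<gamma>) \<le> \<dots>" .
    qed
    also have "\<dots> = ennreal (K * (E + 32 * D * L))"
      by (simp add: nn_integral_cmult_indicator)
    finally show "(\<integral>g. op_norm n (sk_cov n \<beta> g) \<partial>?\<gamma>) \<le> K * (E + 32 * D * L)"
      using K E D L by (simp add: ennreal_le_iff mult_nonneg_nonneg add_nonneg_nonneg)
  qed
qed

end
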